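(* Let $E$ be a Banach space and let $1\leq q<\infty$. Suppose that for some natural number $n$ and some number $p_0$ with $0<p_0<q$ at least one of the following holds: - $\mathcal{P}_{d,p_0}(^{n}E;F)=\mathcal{P}_{d,q}(^{n}E;F)$ for all Banach spaces $F$; - $\mathcal{P}_{[as,p_0]}(^{n}E;F)=\mathcal{P}_{[as,q]}(^{n}E;F)$ for all Banach spaces $F$. Then, for all Banach spaces $F$, all numbers $p$ with $0<p<q$ and all natural numbers $m$, $$\mathcal{P}_{d,p}(^{m}E;F)=\mathcal{P}_{d,q}(^{m}E;F)\quad\text{and}\quad\mathcal{P}_{[as,p]}(^{m}E;F)=\mathcal{P}_{[as,q]}(^{m}E;F).$$
   Context: Banach spaces are over $\mathbb{K}=\mathbb{R}$ or $\mathbb{C}$; $E'$ is the dual of $E$ and $B_{E'}$ its closed unit ball with the weak* topology. $\mathcal{P}(^{n}E;F)$ is the space of continuous $n$-homogeneous polynomials $E\to F$, and $\overset{\vee}{P}$ is the unique symmetric continuous $n$-linear mapping associated to $P$. $\mathcal{L}(^{k}E;F)$ is the space of continuous $k$-linear mappings $E\times\dots\times E\to F$. For $0<p<\infty$, a continuous linear operator $u:E\to F$ is absolutely $p$-summing ($u\in\mathcal{L}_{as,p}(E;F)$) if there is $C\ge 0$ with $\left(\sum_{j=1}^k\|u(x_j)\|^p\right)^{1/p}\le C\sup_{\varphi\in B_{E'}}\left(\sum_{j=1}^k|\varphi(x_j)|^p\right)^{1/p}$ for all $k$ and $x_1,\dots,x_k\in E$. $P\in\mathcal{P}_{[as,p]}(^{n}E;F)$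 means: $P\in\mathcal{P}(^nE;F)$ and for every $i=1,\dots,n$ the linear operator $E\to\mathcal{L}(^{n-1}E;F)$ sending $x_i$ to $\big((x_j)_{j\ne i}\mapsto \overset{\vee}{P}(x_1,\dots,x_n)\big)$ is absolutely $p$-summing (for $n=1$: $P$ itself is absolutely $p$-summing). $P\in\mathcal{P}_{d,p}(^{n}E;F)$ ($P$ is $p$-dominated) means: $P\in\mathcal{P}(^nE;F)$ and there exist $C\ge0$ and a regular Borel probability measure $\mu$ on $B_{E'}$ such that $\|P(x)\|\le C\left[\int_{B_{E'}}|\varphi(x)|^p\,d\mu(\varphi)\right]^{n/p}$ for all $x\in E$. *)

theory Defs
  imports "HOL-Analysis.Analysis" "HOL-Combinatorics.Permutations" "HOL-Algebra.Module"
begin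

section \<open>Scalars\<close>

text \<open>The scalar field is, up to an isometric field isomorphism, \<open>\<real>\<close> or \<open>\<complex>\<close>.\<close>

class real_or_complex = real_normed_field +
  assumes real_or_complex:
    "\<exists>g :: 'a \<Rightarrow> complex. (\<forall>x y. g (x + y) = g x + g y) \<and> (\<forall>x y. g (x * y) = g x * g y) \<and>
       (\<forall>x. norm (g x) = norm x) \<and> (range g = \<real> \<or> range g = UNIV)"

instance real :: real_or_complex
  by standard (rule exI [of _ complex_of_real], auto simp: Reals_def)

instance complex :: real_or_complex
  by standard (rule exI [of _ "\<lambda>x. x"], auto)

definition scalars :: "'k::real_or_complex ring" where
  "scalars = \<lparr>carrier = UNIV, monoid.mult = (*), one = 1, ring.zero = 0, add = (+)\<rparr>"


section \<open>Banach spaces\<close>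

text \<open>
  The domain \<open>E\<close> is fixed throughout, so it is a type of class \<^class>\<open>banach\<close> with a multiplication
  by scalars of type \<open>'k\<close> that extends its real one.
\<close>

definition banach_scaling :: "('k::real_or_complex \<Rightarrow> 'e::banach \<Rightarrow> 'e) \<Rightarrow> bool" where
  "banach_scaling sE \<longleftrightarrow> vector_space sE \<and> (\<forall>r x. sE (of_real r) x = r *\<^sub>R x) \<and>
     (\<forall>c x. norm (sE c x) = norm c * norm x)"

text \<open>
  The range spaces are quantified inside formulas, so they are structures on subsets of a type.
  The fields \<open>mult\<close> and \<open>one\<close> that the record type \<open>module\<close> inherits from \<open>ring\<close> play no role.
\<close>

record ('k, 'f) nspace = "('k, 'f) module" +
  vnorm :: "'f \<Rightarrow> real"

text \<open>The value off the carrier makes this an instance of the locale \<^locale>\<open>Metric_space\<close>.\<close>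

definition vdist :: "('k, 'f) nspace \<Rightarrow> 'f \<Rightarrow> 'f \<Rightarrow> real" where
  "vdist F x y =
     (if x \<in> carrier F \<and> y \<in> carrier F then vnorm F (x \<ominus>\<^bsub>F\<^esub> y) else 0)"

definition vtopology :: "('k, 'f) nspace \<Rightarrow> 'f topology" where
  "vtopology F = Metric_space.mtopology (carrier F) (vdist F)"

definition normed_space :: "('k::real_or_complex, 'f) nspace \<Rightarrow> bool" where
  "normed_space F \<longleftrightarrow> Module.module scalars F \<and>
     (\<forall>x\<in>carrier F. vnorm F x = 0 \<longleftrightarrow> x = \<zero>\<^bsub>F\<^esub>) \<and>
     (\<forall>x\<in>carrier F. \<forall>y\<in>carrier F. vnorm F (x \<oplus>\<^bsub>F\<^esub> y) \<le> vnorm F x + vnorm F y) \<and>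
     (\<forall>c. \<forall>x\<in>carrier F. vnorm F (c \<odot>\<^bsub>F\<^esub> x) = norm c * vnorm F x)"

lemma Metric_space_vdist:
  fixes F :: "('k::real_or_complex,'f) nspace"
  assumes "normed_space F"
  shows "Metric_space (carrier F) (vdist F)"
proof -
  interpret Module.module scalars F using assms by (simp add: normed_space_def)
  have N0: "\<And>x. x \<in> carrier F \<Longrightarrow> vnorm F x = 0 \<longleftrightarrow> x = \<zero>\<^bsub>F\<^esub>"
    and tri: "\<And>x y. x \<in> carrier F \<Longrightarrow> y \<in> carrier F \<Longrightarrow> vnorm F (x \<oplus>\<^bsub>F\<^esub> y) \<le> vnorm F x + vnorm F y"
    and hom: "\<And>c x. x \<in> carrier F \<Longrightarrow> vnorm F (c \<odot>\<^bsub>F\<^esub> x) = norm c * vnorm F x"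
    using assms by (auto simp: normed_space_def)
  have c: "(c::'k) \<in> carrier scalars" for c by (simp add: scalars_def)
  have m1: "\<ominus>\<^bsub>scalars\<^esub> (1::'k) = -1"
    using R.minus_equality[of "-1" 1] by (simp add: scalars_def)
  have neg: "vnorm F (\<ominus>\<^bsub>F\<^esub> x) = vnorm F x" if "x \<in> carrier F" for x
  proof -
    have "\<ominus>\<^bsub>F\<^esub> x = (-1) \<odot>\<^bsub>F\<^esub> x"
      using smult_l_minus[of 1 x] that smult_one[of x] m1 c by (simp add: scalars_def)
    then show ?thesis using hom[OF that, of "-1"] by simp
  qed
  have nn: "0 \<le> vnorm F x" if "x \<in> carrier F" for x
    using tri[of x "\<ominus>\<^bsub>F\<^esub> x"] neg[OF that] N0[of "\<zero>\<^bsub>F\<^esub>"] that by (simp add: M.r_neg)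
  have sw: "\<ominus>\<^bsub>F\<^esub> (x \<ominus>\<^bsub>F\<^esub> y) = y \<ominus>\<^bsub>F\<^esub> x" if "x \<in> carrier F" "y \<in> carrier F" for x y
    using that by (simp add: M.minus_eq M.minus_add M.a_comm)
  have add: "(x \<ominus>\<^bsub>F\<^esub> y) \<oplus>\<^bsub>F\<^esub> (y \<ominus>\<^bsub>F\<^esub> z) = x \<ominus>\<^bsub>F\<^esub> z"
    if "x \<in> carrier F" "y \<in> carrier F" "z \<in> carrier F" for x y z
    using that by (simp add: M.minus_eq M.a_assoc M.r_neg1)
  show ?thesis
  proof
    show "0 \<le> vdist F x y" for x y by (simp add: vdist_def nn)
    show "vdist F x y = vdist F y x" for x y
      using neg[of "x \<ominus>\<^bsub>F\<^esub> y"] sw[of x y] by (auto simp: vdist_def)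
    show "(vdist F x y = 0) = (x = y)" if "x \<in> carrier F" "y \<in> carrier F" for x y
      using that N0[of "x \<ominus>\<^bsub>F\<^esub> y"] 
      by (simp add: vdist_def) (metis M.minus_closed M.minus_eq M.r_neg M.a_inv_closed M.minus_equality M.minus_minus M.a_comm)
    show "vdist F x z \<le> vdist F x y + vdist F y z"
      if "x \<in> carrier F" "y \<in> carrier F" "z \<in> carrier F" for x y z
      using that tri[of "x \<ominus>\<^bsub>F\<^esub> y" "y \<ominus>\<^bsub>F\<^esub> z"] add[of x y z] by (auto simp: vdist_def)
  qed
qed

definition banach_space :: "('k::real_or_complex, 'f) nspace \<Rightarrow> bool" where
  "banach_space F \<longleftrightarrow> normed_space F \<and> Metric_space.mcomplete (carrier F) (vdist F)"

text \<open>
  The type variable \<open>'u\<close> stands for an arbitrary universe of points. The second summand guarantees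
  that, whatever \<open>'u\<close> is, there is room for the classical sequence spaces over \<open>'k\<close>; without it,
  ``all Banach spaces'' could mean the zero space only.
\<close>

type_synonym ('k, 'u) universe = "'u + (nat \<Rightarrow> 'k)"


section \<open>Multilinear mappings and homogeneous polynomials\<close>

text \<open>
  An element of \<open>E\<^sup>n\<close> is a function \<open>x :: nat \<Rightarrow> 'e\<close> of which only \<open>x 0, \<dots>, x (n - 1)\<close> matter. For
  mappings depending on these coordinates only, continuity on \<open>E\<^sup>n\<close> is continuity for the product
  topology on \<open>nat \<Rightarrow> 'e\<close>.
\<close>

definition multilinear ::
    "nat \<Rightarrow> ('k::real_or_complex \<Rightarrow> 'e::banach \<Rightarrow> 'e) \<Rightarrow> ('k, 'f) nspace \<Rightarrow> ((nat \<Rightarrow> 'e) \<Rightarrow> 'f) \<Rightarrow> bool" where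
  "multilinear n sE F A \<longleftrightarrow>
     (\<forall>x. A x \<in> carrier F) \<and>
     (\<forall>x y. (\<forall>i<n. x i = y i) \<longrightarrow> A x = A y) \<and>
     (\<forall>i<n. \<forall>x a b. A (x(i := a + b)) = A (x(i := a)) \<oplus>\<^bsub>F\<^esub> A (x(i := b))) \<and>
     (\<forall>i<n. \<forall>x c a. A (x(i := sE c a)) = c \<odot>\<^bsub>F\<^esub> A (x(i := a)))"

definition continuous_multilinear ::
    "nat \<Rightarrow> ('k::real_or_complex \<Rightarrow> 'e::banach \<Rightarrow> 'e) \<Rightarrow> ('k, 'f) nspace \<Rightarrow> ((nat \<Rightarrow> 'e) \<Rightarrow> 'f) set" where
  "continuous_multilinear n sE F =
     {A. multilinear n sE F A \<and> continuous_map euclidean (vtopology F) A}"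

definition symmetric_map :: "nat \<Rightarrow> ((nat \<Rightarrow> 'e) \<Rightarrow> 'f) \<Rightarrow> bool" where
  "symmetric_map n A \<longleftrightarrow> (\<forall>\<pi>. \<pi> permutes {..<n} \<longrightarrow> (\<forall>x. A (x \<circ> \<pi>) = A x))"

text \<open>For \<open>n = 0\<close> this is \<open>F\<close> itself, as constant mappings.\<close>

definition multilinear_space ::
    "nat \<Rightarrow> ('k::real_or_complex \<Rightarrow> 'e::banach \<Rightarrow> 'e) \<Rightarrow> ('k, 'f) nspace \<Rightarrow> ('k, (nat \<Rightarrow> 'e) \<Rightarrow> 'f) nspace" where
  "multilinear_space n sE F =
     \<lparr>carrier = continuous_multilinear n sE F, monoid.mult = undefined, one = undefined,
      ring.zero = (\<lambda>x. \<zero>\<^bsub>F\<^esub>), add = (\<lambda>A B x. A x \<oplus>\<^bsub>F\<^esub> B x),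
      smult = (\<lambda>c A x. c \<odot>\<^bsub>F\<^esub> A x),
      vnorm = (\<lambda>A. SUP x\<in>{x. \<forall>i<n. norm (x i) \<le> 1}. vnorm F (A x))\<rparr>"

definition polynomials ::
    "nat \<Rightarrow> ('k::real_or_complex \<Rightarrow> 'e::banach \<Rightarrow> 'e) \<Rightarrow> ('k, 'f) nspace \<Rightarrow> ('e \<Rightarrow> 'f) set" where
  "polynomials n sE F =
     {P. (\<exists>A. multilinear n sE F A \<and> (\<forall>x. P x = A (\<lambda>_. x))) \<and>
         continuous_map euclidean (vtopology F) P}"

definition associated_map ::
    "nat \<Rightarrow> ('k::real_or_complex \<Rightarrow> 'e::banach \<Rightarrow> 'e) \<Rightarrow> ('k, 'f) nspace \<Rightarrow> ('e \<Rightarrow> 'f) \<Rightarrow> (nat \<Rightarrow> 'e) \<Rightarrow> 'f" where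
  "associated_map n sE F P =
     (THE A. A \<in> continuous_multilinear n sE F \<and> symmetric_map n A \<and> (\<forall>x. P x = A (\<lambda>_. x)))"


section \<open>The dual ball\<close>

definition dual_ball :: "('k::real_or_complex \<Rightarrow> 'e::banach \<Rightarrow> 'e) \<Rightarrow> ('e \<Rightarrow> 'k) set" where
  "dual_ball sE =
     {\<phi>. Vector_Spaces.linear sE (*) \<phi> \<and> continuous_on UNIV \<phi> \<and> onorm \<phi> \<le> 1}"

text \<open>
  The topology of the type \<open>'e \<Rightarrow> 'k\<close> is that of pointwise convergence, so it induces the weak*
  topology on the dual ball.
\<close>

definition regular_prob_measure ::
    "('k::real_or_complex \<Rightarrow> 'e::banach \<Rightarrow> 'e) \<Rightarrow> ('e \<Rightarrow> 'k) measure \<Rightarrow> bool" where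
  "regular_prob_measure sE \<mu> \<longleftrightarrow>
     sets \<mu> = sets (restrict_space borel (dual_ball sE)) \<and> emeasure \<mu> (space \<mu>) = 1 \<and>
     (\<forall>A\<in>sets \<mu>.
        emeasure \<mu> A = (SUP K\<in>{K. compact K \<and> K \<subseteq> A}. emeasure \<mu> K) \<and>
        emeasure \<mu> A = (INF U\<in>{U. openin (top_of_set (dual_ball sE)) U \<and> A \<subseteq> U}. emeasure \<mu> U))"


section \<open>Summing operators and polynomials\<close>

definition summing_operators ::
    "real \<Rightarrow> ('k::real_or_complex \<Rightarrow> 'e::banach \<Rightarrow> 'e) \<Rightarrow> ('k, 'f) nspace \<Rightarrow> ('e \<Rightarrow> 'f) set" where
  "summing_operators p sE F =
     {u. (\<forall>x. u x \<in> carrier F) \<and>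
         (\<forall>x y. u (x + y) = u x \<oplus>\<^bsub>F\<^esub> u y) \<and>
         (\<forall>c x. u (sE c x) = c \<odot>\<^bsub>F\<^esub> u x) \<and>
         continuous_map euclidean (vtopology F) u \<and>
         (\<exists>C\<ge>0. \<forall>k. \<forall>x :: nat \<Rightarrow> 'e.
            (\<Sum>j<k. vnorm F (u (x j)) powr p) powr (1 / p)
              \<le> C * (SUP \<phi>\<in>dual_ball sE. (\<Sum>j<k. norm (\<phi> (x j)) powr p) powr (1 / p)))}"

definition insert_at :: "nat \<Rightarrow> 'e \<Rightarrow> (nat \<Rightarrow> 'e) \<Rightarrow> nat \<Rightarrow> 'e" where
  "insert_at i a x = (\<lambda>j. if j < i then x j else if j = i then a else x (j - 1))"

text \<open>
  For \<open>n = 1\<close> the operator below is \<open>P\<close> itself, up to the identification of the \<open>0\<close>-linear mappings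
  with \<open>F\<close>.
\<close>

definition as_polynomials ::
    "real \<Rightarrow> nat \<Rightarrow> ('k::real_or_complex \<Rightarrow> 'e::banach \<Rightarrow> 'e) \<Rightarrow> ('k, 'f) nspace \<Rightarrow> ('e \<Rightarrow> 'f) set" where
  "as_polynomials p n sE F =
     {P \<in> polynomials n sE F.
        \<forall>i<n. (\<lambda>a x. associated_map n sE F P (insert_at i a x))
                \<in> summing_operators p sE (multilinear_space (n - 1) sE F)}"

definition dominated_polynomials ::
    "real \<Rightarrow> nat \<Rightarrow> ('k::real_or_complex \<Rightarrow> 'e::banach \<Rightarrow> 'e) \<Rightarrow> ('k, 'f) nspace \<Rightarrow> ('e \<Rightarrow> 'f) set" where
  "dominated_polynomials p n sE F =
     {P \<in> polynomials n sE F.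
        \<exists>C\<ge>0. \<exists>\<mu>. regular_prob_measure sE \<mu> \<and>
          (\<forall>x. vnorm F (P x) \<le> C * (\<integral>\<phi>. norm (\<phi> x) powr p \<partial>\<mu>) powr (real n / p))}"

end

theory Submission
  imports Defs "HOL-Computational_Algebra.Polynomial"
begin

text \<open>
  Call \<open>h\<close> \<open>p\<close>-dominated if \<open>h x \<le> \<integral> |\<phi> x|^p d\<mu>\<close> for some regular probability measure \<open>\<mu>\<close> on the
  dual ball; by Pietsch domination this is a condition on finite families of vectors only. Both
  kinds of summability of a polynomial say that some positively homogeneous function is, up to a
  power and a constant, \<open>p\<close>-dominated. So all conclusions follow once every \<open>q\<close>-dominated \<open>h\<close> has a
  \<open>p\<close>-dominated multiple of \<open>h powr (p / q)\<close>, with a constant independent of \<open>h\<close>.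

  The hypothesis gives this for the exponent \<open>p0\<close>: it is applied to the polynomials
  \<open>P x = \<phi> x ^ (n - 1) *\<^sub>R u x\<close>, where \<open>u x = (w\<^sub>l powr (1 / q) * \<psi>\<^sub>l x)\<^sub>l\<close> maps into the space of
  \<open>q\<close>-summable sequences, and \<open>u\<close> is recovered from \<open>P\<close>. One such \<open>u\<close> can contain scaled copies of
  countably many discrete measures, which makes the constant uniform. Maurey's extrapolation argument
  then passes from \<open>p0\<close> to all \<open>p < q\<close>: the hypothesis yields a sequence of measures \<open>\<mu>\<^sub>i\<close> such that the
  \<open>q\<close>-norm for \<open>\<mu>\<^sub>i\<close> is bounded by the \<open>p0\<close>-norm for \<open>\<mu>\<^sub>i\<^sub>+\<^sub>1\<close>, the latter is interpolated between the
  \<open>p\<close>-norm and the \<open>q\<close>-norm, and the resulting recursion is solved.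
\<close>

section \<open>Regular measures on compact Hausdorff spaces\<close>

text \<open>The hypothesis reaches only ranges that live on the universe
  \<open>'u + (nat => 'k)\<close>, so L^q of an arbitrary measure on the dual ball is not an
  available range: only sequence spaces, that is discrete measures, can be tested. Arbitrary
  measures are reached because domination concerns finitely many vectors at a time, and on these a
  measure is approximated by averages of point masses. For the approximation to pass to the limit,
  the constant must not depend on the point masses; the extrapolation, which uses the estimate
  infinitely often, needs the same uniformity. The operator \<open>u\<close> is recovered from
  \<open>P\<close> only up to an error of the size of |\<phi> a|. The error is harmless because
  |\<phi>|^r is itself r-dominated, by the point mass at \<phi>. The condition 1 \<le> q makes the
  range a normed space; exponents below 1 never serve to form a norm, and for them the crude
  inequality \<open>powr_add_le\<close> is enough.\<close>

lemma compact_split_open_cover: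
  fixes C :: "'a::topological_space set"
  assumes haus: "Hausdorff_space (euclidean :: 'a topology)"
    and C: "compact C" and U: "open U" and V: "open V" and sub: "C \<subseteq> U \<union> V"
  obtains C1 C2 where "compact C1" "compact C2" "C = C1 \<union> C2" "C1 \<subseteq> U" "C2 \<subseteq> V"
proof -
  \<comment> \<open>What \<open>U\<close> misses and what \<open>V\<close> misses of
    \<open>C\<close> are disjoint compact sets. Removing disjoint open neighbourhoods of them leaves
    two compact sets whose union is still \<open>C\<close>.\<close>
  have "compact (C - U)" "compact (C - V)"
    using C U V by (auto intro: compact_diff)
  moreover have "(C - U) \<inter> (C - V) = {}" using sub by blast
  ultimately obtain P Q where PQ: "open P" "open Q" "C - U \<subseteq> P" "C - V \<subseteq> Q" "P \<inter> Q = {}"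
    using Hausdorff_space_compact_separation[of euclidean "C - U" "C - V"] haus
    unfolding compactin_euclidean_iff disjnt_def open_openin[symmetric] by metis
  show ?thesis
    by (rule that[of "C - P" "C - Q"]) (use C PQ in \<open>auto intro: compact_diff\<close>)
qed

text \<open>For open \<open>U\<close> put \<open>\<theta> U = sup {m C | C \<subseteq> U compact}\<close>; the measure is the outer measure generated by
  \<open>\<theta>\<close>. Since compact sets are approximated from outside only, their measure may exceed their content.\<close>

lemma regular_measure_from_content:
  fixes K :: "'a::topological_space set" and m :: "'a set \<Rightarrow> real"
  assumes haus: "Hausdorff_space (euclidean :: 'a topology)"
    and K: "compact K" and nn: "\<And>A. 0 \<le> m A"
    and add: "\<And>A B. A \<inter> B = {} \<Longrightarrow> m (A \<union> B) = m A + m B" and mK: "m K = 1"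
  obtains \<mu> where "sets \<mu> = sets (restrict_space borel K)" "emeasure \<mu> (space \<mu>) = 1"
    "\<And>A. A \<in> sets \<mu> \<Longrightarrow> emeasure \<mu> A = (SUP C\<in>{C. compact C \<and> C \<subseteq> A}. emeasure \<mu> C)"
    "\<And>A. A \<in> sets \<mu> \<Longrightarrow>
       emeasure \<mu> A = (INF U\<in>{U. openin (top_of_set K) U \<and> A \<subseteq> U}. emeasure \<mu> U)"
    "\<And>C. compact C \<Longrightarrow> C \<subseteq> K \<Longrightarrow> m C \<le> measure \<mu> C"
proof -
  let ?op = "openin (top_of_set K)"
  have cc: "closed C" if "compact C" for C :: "'a set"
    using compactin_imp_closedin[OF haus, of C] that by simp
  define \<theta> where "\<theta> U = (SUP C\<in>{C. compact C \<and> C \<subseteq> U}. ennreal (m C))" for U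
  define M where "M A = (INF U\<in>{U. ?op U \<and> A \<subseteq> U}. \<theta> U)" for A
  have m_mono: "m A \<le> m B" if "A \<subseteq> B" for A B
    using add[of A "B - A"] nn[of "B - A"] that by (simp add: Un_absorb1)
  have m_sub: "m (A \<union> B) \<le> m A + m B" for A B
    using add[of A "B - A"] m_mono[of "B - A" B] by simp
  have m0: "m {} = 0" using add[of "{}" "{}"] by simp
  have \<theta>_upper: "ennreal (m C) \<le> \<theta> U" if "compact C" "C \<subseteq> U" for C U
    unfolding \<theta>_def using that by (auto intro: SUP_upper)
  have \<theta>_least: "\<theta> U \<le> z" if "\<And>C. compact C \<Longrightarrow> C \<subseteq> U \<Longrightarrow> ennreal (m C) \<le> z" for U z
    unfolding \<theta>_def using that by (auto intro: SUP_least)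
  have \<theta>_mono: "\<theta> U \<le> \<theta> V" if "U \<subseteq> V" for U V
    using that by (intro \<theta>_least \<theta>_upper) auto
  have M_lower: "M A \<le> \<theta> U" if "?op U" "A \<subseteq> U" for A U
    unfolding M_def using that by (auto intro: INF_lower)
  have M_greatest: "z \<le> M A" if "\<And>U. ?op U \<Longrightarrow> A \<subseteq> U \<Longrightarrow> z \<le> \<theta> U" for A z
    unfolding M_def using that by (auto intro: INF_greatest)
  have M_mono: "M A \<le> M B" if "A \<subseteq> B" for A B
    using that by (intro M_greatest M_lower) auto
  have M_open: "M U = \<theta> U" if "?op U" for U
    using that by (intro antisym M_lower M_greatest \<theta>_mono) auto
  have opK: "?op K" by simp
  have \<theta>K: "\<theta> K = 1"
    using \<theta>_upper[OF K order_refl] mK m_mono[of _ K] by (intro antisym \<theta>_least) auto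
  have \<theta>_Un: "\<theta> (U \<union> V) \<le> \<theta> U + \<theta> V"
    if UV: "?op U" "?op V" for U V
  proof (rule \<theta>_least)
    fix C assume C: "compact C" "C \<subseteq> U \<union> V"
    obtain U' V' where UV': "open U'" "open V'" "U = K \<inter> U'" "V = K \<inter> V'"
      using UV by (auto simp: openin_open)
    obtain C1 C2 where C12: "compact C1" "compact C2" "C = C1 \<union> C2" "C1 \<subseteq> U'" "C2 \<subseteq> V'"
      using compact_split_open_cover[OF haus C(1) UV'(1,2)] C(2) UV' by (metis Int_Un_distrib le_inf_iff)
    have "ennreal (m C) \<le> ennreal (m C1) + ennreal (m C2)"
      using m_sub[of C1 C2] C12(3) nn by (simp flip: ennreal_plus)
    also have "\<dots> \<le> \<theta> U + \<theta> V"
      using C12 C(2) UV' by (intro add_mono \<theta>_upper) auto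
    finally show "ennreal (m C) \<le> \<theta> U + \<theta> V" .
  qed
  have \<theta>_empty: "\<theta> {} = 0"
    using m0 \<theta>_least[of "{}" 0] by (simp add: subset_empty)
  have \<theta>_fin: "\<theta> (\<Union>i\<in>I. U i) \<le> (\<Sum>i\<in>I. \<theta> (U i))"
    if "finite I" "\<And>i. i \<in> I \<Longrightarrow> ?op (U i)" for I :: "nat set" and U
    using that
  proof (induction I rule: finite_induct)
    case (insert i I)
    have "\<theta> (U i \<union> (\<Union>i\<in>I. U i)) \<le> \<theta> (U i) + \<theta> (\<Union>i\<in>I. U i)"
      using insert.prems by (intro \<theta>_Un openin_Union) auto
    also have "\<dots> \<le> \<theta> (U i) + (\<Sum>i\<in>I. \<theta> (U i))"
      using insert by (intro add_left_mono) auto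
    finally show ?case using insert by simp
  qed (simp add: \<theta>_empty)
  have \<theta>_csub: "\<theta> (\<Union>i::nat. U i) \<le> (\<Sum>i. \<theta> (U i))"
    if U: "\<And>i. ?op (U i)" for U
  proof (rule \<theta>_least)
    fix C assume C: "compact C" "C \<subseteq> (\<Union>i. U i)"
    obtain O' where O': "\<And>i. open (O' i)" "\<And>i. U i = K \<inter> O' i"
      using U unfolding openin_open by metis
    obtain I where I: "finite I" "C \<subseteq> (\<Union>i\<in>I. O' i)"
    proof (rule compactE_image[OF C(1), of UNIV O'])
      show "C \<subseteq> (\<Union>i. O' i)" using C(2) by (auto simp: O'(2))
    qed (use O' in auto)
    have "C \<subseteq> (\<Union>i\<in>I. U i)" using I C(2) by (auto simp: O'(2))
    then have "ennreal (m C) \<le> \<theta> (\<Union>i\<in>I. U i)" using C(1) \<theta>_upper by blast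
    also have "\<dots> \<le> (\<Sum>i\<in>I. \<theta> (U i))" using I(1) U by (intro \<theta>_fin)
    also have "\<dots> \<le> (\<Sum>i. \<theta> (U i))" using I(1) by (intro sum_le_suminf) auto
    finally show "ennreal (m C) \<le> (\<Sum>i. \<theta> (U i))" .
  qed
  have M_csub: "M (\<Union>i. A i) \<le> (\<Sum>i. M (A i))" if A: "\<And>i::nat. A i \<subseteq> K" for A
  proof (rule ennreal_le_epsilon)
    fix e :: real assume e: "0 < e"
    have MA: "M (A i) < Orderings.top" for i
      using M_lower[OF opK A[of i]] \<theta>K by (simp add: order_le_less_trans)
    have "\<exists>U. ?op U \<and> A i \<subseteq> U \<and> \<theta> U < M (A i) + ennreal (e * (1/2)^Suc i)" for i
    proof -
      have "M (A i) < M (A i) + ennreal (e * (1/2)^Suc i)"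
        using MA[of i] e by (simp add: ennreal_add_left_cancel_less[of _ 0, simplified] ennreal_zero_less_mult_iff less_top)
      then show ?thesis
        unfolding M_def[of "A i"] INF_less_iff by (auto simp: M_def)
    qed
    then obtain U where U: "\<And>i. ?op (U i)" "\<And>i. A i \<subseteq> U i"
      "\<And>i. \<theta> (U i) < M (A i) + ennreal (e * (1/2)^Suc i)" by metis
    have "M (\<Union>i. A i) \<le> \<theta> (\<Union>i. U i)"
      using U by (intro M_lower openin_Union) auto
    also have "\<dots> \<le> (\<Sum>i. \<theta> (U i))" using U by (intro \<theta>_csub)
    also have "\<dots> \<le> (\<Sum>i. M (A i) + ennreal (e * (1/2)^Suc i))"
      using U by (intro suminf_le) (auto simp: less_imp_le)
    also have "\<dots> = (\<Sum>i. M (A i)) + (\<Sum>i. ennreal (e * (1/2)^Suc i))"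
      by (intro suminf_add[symmetric]) auto
    also have "(\<Sum>i. ennreal (e * (1/2)^Suc i)) = ennreal e"
    proof -
      have "(\<lambda>i. e * (1/2)^Suc i) sums (e * 1)"
        using power_half_series by (intro sums_mult)
      then show ?thesis using e by (intro suminf_ennreal_eq) auto
    qed
    finally show "M (\<Union>i. A i) \<le> (\<Sum>i. M (A i)) + ennreal e" .
  qed
  have M0: "M {} = 0" using M_open[of "{}"] \<theta>_empty by simp
  have oms: "outer_measure_space (Pow K) M"
    unfolding outer_measure_space_def positive_def increasing_def countably_subadditive_def
    using M0 M_mono M_csub by (auto simp: Pow_def image_subset_iff)
  interpret P: sigma_algebra K "Pow K" by (rule sigma_algebra_Pow)
  define L where "L = lambda_system K (Pow K) M"
  have ms: "measure_space K L M"
    unfolding L_def by (rule P.caratheodory_lemma[OF oms])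
  have open_L: "U \<in> L" if U: "?op U" for U
  proof -
    have UK: "U \<subseteq> K" using U openin_imp_subset by blast
    \<comment> \<open>Caratheodory's criterion: if \<open>W\<close> is open and contains
      \<open>A\<close>, then compact sets \<open>C\<close> in \<open>W \<inter> U\<close> and
      \<open>D\<close> in \<open>W - C\<close> are disjoint, so additivity of \<open>m\<close>
      bounds \<open>m C + m D\<close> by \<open>\<theta> W\<close>. The supremum over
      \<open>D\<close> is taken first, for fixed \<open>C\<close>, because \<open>W - C\<close> is
      an open set containing \<open>A - U\<close>.\<close>
    have ge: "M (A \<inter> U) + M (A - U) \<le> M A" for A
    proof (rule M_greatest)
      fix W assume W: "?op W" "A \<subseteq> W"
      have "M (A \<inter> U) + M (A - U) \<le> \<theta> (W \<inter> U) + M (A - U)"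
        using U W by (intro add_right_mono M_lower openin_Int) auto
      also have "\<dots> = (SUP C\<in>{C. compact C \<and> C \<subseteq> W \<inter> U}. ennreal (m C) + M (A - U))"
        unfolding \<theta>_def by (intro ennreal_SUP_add_left[symmetric]) (auto intro: exI[of _ "{}"])
      also have "\<dots> \<le> \<theta> W"
      proof (rule SUP_least, clarify)
        fix C assume C: "compact C" "C \<subseteq> W \<inter> U"
        have op: "?op (W - C)"
        proof -
          have "closedin (top_of_set K) C"
            using C W openin_imp_subset[OF W(1)] by (intro closed_subset cc) auto
          then show ?thesis using W(1) by (rule openin_diff[rotated])
        qed
        have "ennreal (m C) + M (A - U) \<le> ennreal (m C) + \<theta> (W - C)"
          using op W C by (intro add_left_mono M_lower) auto
        also have "\<dots> = (SUP D\<in>{D. compact D \<and> D \<subseteq> W - C}. ennreal (m C) + ennreal (m D))"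
          unfolding \<theta>_def by (rule ennreal_SUP_add_right) (auto intro: exI[of _ "{}"])
        also have "\<dots> \<le> \<theta> W"
        proof (rule SUP_least, clarify)
          fix D assume D: "compact D" "D \<subseteq> W - C"
          have "C \<inter> D = {}" using D(2) by blast
          then have "ennreal (m C) + ennreal (m D) = ennreal (m (C \<union> D))"
            using nn by (simp add: add)
          also have "\<dots> \<le> \<theta> W" using C D by (intro \<theta>_upper) auto
          finally show "ennreal (m C) + ennreal (m D) \<le> \<theta> W" .
        qed
        finally show "ennreal (m C) + M (A - U) \<le> \<theta> W" .
      qed
      finally show "M (A \<inter> U) + M (A - U) \<le> \<theta> W" .
    qed
    have le: "M A \<le> M (A \<inter> U) + M (A - U)" if "A \<subseteq> K" for A
    proof -
      have "subadditive (Pow K) M"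
        using oms by (auto simp: outer_measure_space_def intro: P.countably_subadditive_subadditive)
      then have "M ((A \<inter> U) \<union> (A - U)) \<le> M (A \<inter> U) + M (A - U)"
        using that by (intro subadditiveD) auto
      then show ?thesis by (simp add: Int_Diff_Un)
    qed
    show ?thesis
      unfolding L_def P.lambda_system_eq using UK ge le by (auto intro: antisym)
  qed
  interpret L: sigma_algebra K L using ms by (simp add: measure_space_def)
  have "K \<inter> A \<in> L" if "A \<in> sets borel" for A
  proof -
    have "A \<in> sigma_sets UNIV {S. open S}" using that by (simp add: borel_def)
    then show ?thesis
    proof induction
      case (Basic a)
      then show ?case by (intro open_L) (auto simp: openin_open)
    next
      case (Compl a)
      have "K \<inter> (UNIV - a) = K - (K \<inter> a)" by blast
      then show ?case using Compl by auto
    next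
      case (Union a)
      have "(\<Union>i. K \<inter> a i) \<in> L" using Union by (intro L.countable_UN) auto
      moreover have "K \<inter> (\<Union>i. a i) = (\<Union>i. K \<inter> a i)" by blast
      ultimately show ?case by (simp only:)
    qed auto
  qed
  then have SL: "sets (restrict_space borel K) \<subseteq> L"
    by (auto simp: sets_restrict_space)
  define \<mu> where "\<mu> = measure_of K (sets (restrict_space borel K)) M"
  have sp: "space (restrict_space borel K) = K" by (simp add: space_restrict_space)
  have sa: "sigma_algebra K (sets (restrict_space borel K))"
    using sets.sigma_algebra_axioms[of "restrict_space borel K"] sp by simp
  have sets: "sets \<mu> = sets (restrict_space borel K)"
    unfolding \<mu>_def using sigma_algebra.sets_measure_of_eq[OF sa] .
  have spm: "space \<mu> = K"
    unfolding \<mu>_def using sigma_algebra.space_measure_of_eq[OF sa] .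
  have em: "emeasure \<mu> A = M A" if "A \<in> sets \<mu>" for A
    unfolding \<mu>_def
  proof (rule emeasure_measure_of_sigma[OF sa])
    show "positive (sets (restrict_space borel K)) M"
      using M0 by (simp add: positive_def)
    show "countably_additive (sets (restrict_space borel K)) M"
      using ms SL unfolding measure_space_def countably_additive_def by blast
    show "A \<in> sets (restrict_space borel K)" using that sets by simp
  qed
  have in_sets: "K \<inter> B \<in> sets \<mu>" if "B \<in> sets borel" for B
    unfolding sets sets_restrict_space using that by auto
  have open_sets: "U \<in> sets \<mu>" if "?op U" for U
    using that in_sets by (auto simp: openin_open)
  have compact_sets: "C \<in> sets \<mu>" if "compact C" "C \<subseteq> K" for C
    using in_sets[of C] that cc[OF that(1)] by (simp add: Int_absorb1)
  have e1: "emeasure \<mu> (space \<mu>) = 1"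
    using em[of K] open_sets[OF opK] M_open[OF opK] \<theta>K spm by simp
  interpret fm: finite_measure \<mu> by (rule finite_measureI) (simp add: e1)
  show ?thesis
  proof (rule that[of \<mu>])
    show "sets \<mu> = sets (restrict_space borel K)" by (fact sets)
    show "emeasure \<mu> (space \<mu>) = 1" by (fact e1)
    show outer: "emeasure \<mu> A = (INF U\<in>{U. ?op U \<and> A \<subseteq> U}. emeasure \<mu> U)"
      if "A \<in> sets \<mu>" for A
      using that em open_sets M_open unfolding M_def by (auto intro!: INF_cong simp: M_def)
    show "m C \<le> measure \<mu> C" if C: "compact C" "C \<subseteq> K" for C
    proof -
      have "ennreal (m C) \<le> M C" using \<theta>_upper C by (intro M_greatest) auto
      also have "\<dots> = ennreal (measure \<mu> C)"
        using em[OF compact_sets[OF C]] fm.emeasure_eq_measure by simp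
      finally show ?thesis by simp
    qed
    show "emeasure \<mu> A = (SUP C\<in>{C. compact C \<and> C \<subseteq> A}. emeasure \<mu> C)" if A: "A \<in> sets \<mu>" for A
    proof (rule antisym)
      have AK: "A \<subseteq> K" using sets.sets_into_space[OF A] spm by simp
      show "(SUP C\<in>{C. compact C \<and> C \<subseteq> A}. emeasure \<mu> C) \<le> emeasure \<mu> A"
        using A by (auto intro!: SUP_least emeasure_mono)
      show "emeasure \<mu> A \<le> (SUP C\<in>{C. compact C \<and> C \<subseteq> A}. emeasure \<mu> C)"
      proof (rule ennreal_le_epsilon)
        fix e :: real assume e: "0 < e"
        \<comment> \<open>Inner regularity of \<open>A\<close> is outer regularity of its
          complement: an open \<open>U\<close> slightly larger than \<open>?B\<close> leaves the
          compact set \<open>K - U\<close> inside \<open>A\<close>.\<close>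
        let ?B = "K - A"
        have B: "?B \<in> sets \<mu>" using A spm sets.compl_sets by metis
        have "emeasure \<mu> ?B < emeasure \<mu> ?B + ennreal e"
          using e by (simp add: ennreal_add_left_cancel_less[of _ 0, simplified] less_top[symmetric])
        then obtain U where U: "?op U" "?B \<subseteq> U"
          "emeasure \<mu> U < emeasure \<mu> ?B + ennreal e"
          using outer[OF B] by (smt (verit) INF_less_iff mem_Collect_eq)
        define C where "C = K - U"
        have C: "compact C" "C \<subseteq> A" "C \<subseteq> K"
        proof -
          obtain U' where "open U'" "U = K \<inter> U'" using U(1) by (auto simp: openin_open)
          then show "compact C" using K compact_diff[of K U'] by (simp add: C_def Diff_Int)
        qed (use U(2) AK in \<open>auto simp: C_def\<close>)
        have Us: "U \<in> sets \<mu>" using open_sets U(1) by simp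
        have "measure \<mu> U < measure \<mu> ?B + e"
          using U(3) e by (simp add: fm.emeasure_eq_measure ennreal_less_iff flip: ennreal_plus)
        moreover have "measure \<mu> (U - ?B) = measure \<mu> U - measure \<mu> ?B"
          using Us B U(2) by (intro fm.finite_measure_Diff)
        moreover have "measure \<mu> A \<le> measure \<mu> C + measure \<mu> (U - ?B)"
        proof -
          have "measure \<mu> A \<le> measure \<mu> (C \<union> (U - ?B))"
            using compact_sets[OF C(1,3)] Us B AK by (intro fm.finite_measure_mono) (auto simp: C_def)
          also have "\<dots> \<le> measure \<mu> C + measure \<mu> (U - ?B)"
            using compact_sets[OF C(1,3)] Us B by (intro measure_Un_le) auto
          finally show ?thesis .
        qed
        ultimately have "measure \<mu> A \<le> measure \<mu> C + e" by linarith
        then have "emeasure \<mu> A \<le> emeasure \<mu> C + ennreal e"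
          using e by (simp add: fm.emeasure_eq_measure flip: ennreal_plus)
        also have "\<dots> \<le> (SUP C\<in>{C. compact C \<and> C \<subseteq> A}. emeasure \<mu> C) + ennreal e"
          using C by (intro add_right_mono SUP_upper) auto
        finally show "emeasure \<mu> A \<le> (SUP C\<in>{C. compact C \<and> C \<subseteq> A}. emeasure \<mu> C) + ennreal e" .
      qed
    qed
  qed
qed

text \<open>The sum equals e * floor (v / e): a layer-cake formula with step \<open>e\<close>, in
  which \<open>N\<close> only caps the number of layers. It reduces an integral to finitely many
  values of a set function on superlevel sets. These are defined with \<le>, hence closed for
  continuous integrands.\<close>

lemma layer_sum_bounds:
  fixes v e :: real
  assumes v: "0 \<le> v" and e: "0 < e" and N: "v \<le> real N * e"
  shows "(\<Sum>k\<in>{1..N}. e * of_bool (real k * e \<le> v)) \<le> v"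
    and "v \<le> e + (\<Sum>k\<in>{1..N}. e * of_bool (real k * e \<le> v))"
proof -
  define n where "n = nat \<lfloor>v / e\<rfloor>"
  have ve: "0 \<le> v / e" using v e by simp
  have n: "real n \<le> v / e" "v / e < real n + 1"
    using ve unfolding n_def by linarith+
  have nv: "real n * e \<le> v" "v < real n * e + e"
    using n e by (simp_all add: field_simps)
  have "n \<le> N"
  proof -
    have "real n * e \<le> real N * e" using nv N by linarith
    then show ?thesis using e by simp
  qed
  have iff: "real k * e \<le> v \<longleftrightarrow> k \<le> n" for k
  proof
    assume "real k * e \<le> v"
    then have "real k * e < real (Suc n) * e" using nv by (simp add: algebra_simps)
    then show "k \<le> n" using e by (simp only: mult_less_cancel_right_disj of_nat_less_iff) auto
  next
    assume "k \<le> n"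
    then have "real k * e \<le> real n * e" using e by simp
    then show "real k * e \<le> v" using nv by linarith
  qed
  have "(\<Sum>k\<in>{1..N}. e * of_bool (real k * e \<le> v)) = (\<Sum>k\<in>{1..n}. e)"
    unfolding iff using \<open>n \<le> N\<close> by (intro sum.mono_neutral_cong_right) auto
  then have "(\<Sum>k\<in>{1..N}. e * of_bool (real k * e \<le> v)) = real n * e" by simp
  then show "(\<Sum>k\<in>{1..N}. e * of_bool (real k * e \<le> v)) \<le> v"
    and "v \<le> e + (\<Sum>k\<in>{1..N}. e * of_bool (real k * e \<le> v))"
    using nv by linarith+
qed

section \<open>Contents as limits of averages of point masses\<close>

lemma compact_bounded_functions:
  "compact {g :: 'a \<Rightarrow> real. \<forall>x. g x \<in> {0..1}}"
proof -
  have "compactin (product_topology (\<lambda>_. euclidean) (UNIV :: 'a set))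
          (\<Pi>\<^sub>E x\<in>(UNIV :: 'a set). {0..1::real})"
    by (subst compactin_PiE) auto
  moreover have "(\<Pi>\<^sub>E x\<in>(UNIV :: 'a set). {0..1::real}) = {g. \<forall>x. g x \<in> {0..1}}"
    by (auto simp: PiE_def Pi_def)
  ultimately show ?thesis
    by (simp add: euclidean_product_topology)
qed

text \<open>A cluster point of the empirical measures, as set functions in \<open>[0, 1]\<close> to the power of all sets,
  is finitely additive; the layer sums express domination through finitely many of its values.\<close>

lemma empirical_cluster_content:
  fixes f :: "'j \<Rightarrow> 'a \<Rightarrow> real" and h :: "'j \<Rightarrow> real"
  assumes fnn: "\<And>j \<phi>. \<phi> \<in> K \<Longrightarrow> 0 \<le> f j \<phi>"
    and fb: "\<And>j \<phi>. \<phi> \<in> K \<Longrightarrow> f j \<phi> \<le> b j"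
    and emp: "\<And>Y. finite Y \<Longrightarrow> \<exists>T>0. \<exists>t :: nat \<Rightarrow> 'a. (\<forall>i<T. t i \<in> K) \<and>
            (\<forall>j\<in>Y. h j \<le> (\<Sum>i<T. f j (t i)) / real T)"
  obtains m :: "'a set \<Rightarrow> real" where "\<And>A. 0 \<le> m A"
    "\<And>A B. A \<inter> B = {} \<Longrightarrow> m (A \<union> B) = m A + m B" "m K = 1"
    "\<And>j e N. 0 < e \<Longrightarrow> b j \<le> real N * e \<Longrightarrow>
       h j \<le> e + (\<Sum>k\<in>{1..N}. e * m {\<phi>\<in>K. real k * e \<le> f j \<phi>})"
proof -
  obtain T t where T: "\<And>Y. finite Y \<Longrightarrow> 0 < (T Y :: nat)"
    and t: "\<And>Y i. finite Y \<Longrightarrow> i < T Y \<Longrightarrow> t Y i \<in> K"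
    and ht: "\<And>Y j. finite Y \<Longrightarrow> j \<in> Y \<Longrightarrow> h j \<le> (\<Sum>i<T Y. f j (t Y i)) / real (T Y)"
    using emp by metis
  define \<nu> where "\<nu> Y A = (\<Sum>i<T Y. of_bool (t Y i \<in> A)) / real (T Y)" for Y A
  define F where "F = filtermap \<nu> (finite_subsets_at_top UNIV)"
  have evI: "eventually P F"
    if "\<And>Y. finite Y \<Longrightarrow> Y0 \<subseteq> Y \<Longrightarrow> P (\<nu> Y)" "finite Y0" for P Y0
    unfolding F_def eventually_filtermap eventually_finite_subsets_at_top
    using that by blast
  have Fb: "F \<noteq> bot" by (simp add: F_def filtermap_bot_iff)
  have evS: "eventually (\<lambda>g. g \<in> {g. \<forall>A. g A \<in> {0..1}}) F"
  proof (rule evI[of "{}"])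
    fix Y :: "'j set" assume Y: "finite Y"
    have "(\<Sum>i<T Y. of_bool (t Y i \<in> A)) \<le> (\<Sum>i<T Y. 1::real)" for A
      by (intro sum_mono) auto
    then show "\<nu> Y \<in> {g. \<forall>A. g A \<in> {0..1}}"
      using T[OF Y] by (auto simp: \<nu>_def sum_nonneg)
  qed simp
  obtain m where m: "m \<in> {g. \<forall>A. g A \<in> {0..1}}" "inf (nhds m) F \<noteq> bot"
    using compact_bounded_functions[unfolded compact_filter, rule_format, OF Fb evS] by auto
  \<comment> \<open>A cluster point of \<open>F\<close> need not be its limit. Refining
    \<open>F\<close> by the neighbourhoods of \<open>m\<close> makes it one and keeps everything
    that holds eventually along \<open>F\<close>.\<close>
  define G where "G = inf (nhds m) F"
  have lim: "((\<lambda>g. g A) \<longlongrightarrow> m A) G" for A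
  proof -
    have "open {g :: 'a set \<Rightarrow> real. g A \<in> S}" if "open S" for S
      using open_vimage[OF that, of "\<lambda>g :: 'a set \<Rightarrow> real. g A"] by (simp add: vimage_def)
    then have "((\<lambda>g. g A) \<longlongrightarrow> m A) (nhds m)"
      unfolding tendsto_def eventually_nhds by blast
    then show ?thesis unfolding G_def by (rule tendsto_mono[rotated]) simp
  qed
  have evG: "eventually P G" if "eventually P F" for P
    using that unfolding G_def by (rule filter_leD[rotated]) simp
  have Gb: "G \<noteq> bot" using m(2) by (simp add: G_def)
  show ?thesis
  proof (rule that[of m])
    show "0 \<le> m A" for A using m(1) by auto
    show "m (A \<union> B) = m A + m B" if "A \<inter> B = {}" for A B
    proof (rule tendsto_unique[OF Gb lim])
      have "eventually (\<lambda>g. g (A \<union> B) = g A + g B) G"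
      proof (intro evG evI[of "{}"])
        fix Y :: "'j set"
        have "of_bool (x \<in> A \<union> B) = of_bool (x \<in> A) + (of_bool (x \<in> B) :: real)" for x
          using that by auto
        then show "\<nu> Y (A \<union> B) = \<nu> Y A + \<nu> Y B"
          by (simp only: \<nu>_def sum.distrib add_divide_distrib)
      qed simp
      then show "((\<lambda>g. g (A \<union> B)) \<longlongrightarrow> m A + m B) G"
        using tendsto_add[OF lim[of A] lim[of B]] by (rule tendsto_cong[THEN iffD2])
    qed
    show "m K = 1"
    proof (rule tendsto_unique[OF Gb lim])
      have "eventually (\<lambda>g. g K = 1) G"
      proof (intro evG evI[of "{}"])
        fix Y :: "'j set" assume Y: "finite Y"
        have "(\<Sum>i<T Y. of_bool (t Y i \<in> K)) = (\<Sum>i<T Y. 1::real)"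
          using t[OF Y] by (intro sum.cong) auto
        then show "\<nu> Y K = 1" using T[OF Y] by (simp add: \<nu>_def)
      qed simp
      then show "((\<lambda>g. g K) \<longlongrightarrow> 1) G" by (rule tendsto_eventually)
    qed
    show "h j \<le> e + (\<Sum>k\<in>{1..N}. e * m {\<phi>\<in>K. real k * e \<le> f j \<phi>})"
      if e: "0 < e" and N: "b j \<le> real N * e" for j e N
    proof (rule tendsto_lowerbound[OF _ _ Gb])
      show "((\<lambda>g. e + (\<Sum>k\<in>{1..N}. e * g {\<phi>\<in>K. real k * e \<le> f j \<phi>}))
              \<longlongrightarrow> e + (\<Sum>k\<in>{1..N}. e * m {\<phi>\<in>K. real k * e \<le> f j \<phi>})) G"
        by (intro tendsto_intros lim)
      show "eventually (\<lambda>g. h j \<le> e + (\<Sum>k\<in>{1..N}. e * g {\<phi>\<in>K. real k * e \<le> f j \<phi>})) G"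
      proof (intro evG evI[of "{j}"])
        fix Y assume Y: "finite Y" "{j} \<subseteq> Y"
        have T': "0 < real (T Y)" using T Y by simp
        have "h j \<le> (\<Sum>i<T Y. f j (t Y i)) / real (T Y)" using ht Y by simp
        also have "\<dots> \<le> (\<Sum>i<T Y. e + (\<Sum>k\<in>{1..N}. e * of_bool (real k * e \<le> f j (t Y i)))) / real (T Y)"
          using T' by (intro divide_right_mono sum_mono layer_sum_bounds(2) e)
            (use t[OF Y(1)] fnn order_trans[OF fb N] in auto)
        also have "\<dots> = e + (\<Sum>k\<in>{1..N}. e * ((\<Sum>i<T Y. of_bool (real k * e \<le> f j (t Y i))) / real (T Y)))"
          using T' by (simp add: sum.distrib add_divide_distrib
              sum_divide_distrib sum_distrib_left del: sum_of_bool_eq sum_mult_of_bool_eq) (rule sum.swap)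
        also have "\<dots> = e + (\<Sum>k\<in>{1..N}. e * \<nu> Y {\<phi>\<in>K. real k * e \<le> f j \<phi>})"
          unfolding \<nu>_def using t[OF Y(1)] by (intro arg_cong2[of _ _ _ _ "(+)"] sum.cong refl
              arg_cong2[of _ _ _ _ "(*)"] arg_cong2[of _ _ _ _ "(/)"]) auto
        finally show "h j \<le> e + (\<Sum>k\<in>{1..N}. e * \<nu> Y {\<phi>\<in>K. real k * e \<le> f j \<phi>})" .
      qed simp
    qed
  qed
qed

text \<open>Blackwell's approachability argument: always answering the accumulated deficit keeps its
  square norm linear in time, so the averages approach the nonnegative orthant.\<close>

lemma empirical_domination:
  fixes f :: "'j \<Rightarrow> 'a \<Rightarrow> real" and h :: "'j \<Rightarrow> real"
  assumes Y: "finite Y"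
    and bd: "\<And>j \<phi>. j \<in> Y \<Longrightarrow> \<phi> \<in> K \<Longrightarrow> \<bar>f j \<phi> - h j\<bar> \<le> R"
    and hyp: "\<And>s. (\<And>j. j \<in> Y \<Longrightarrow> 0 \<le> s j) \<Longrightarrow>
        \<exists>\<phi>\<in>K. (\<Sum>j\<in>Y. s j * h j) \<le> (\<Sum>j\<in>Y. s j * f j \<phi>) + 1"
    and e: "0 < e"
  obtains T t where "0 < T" "\<And>i. i < T \<Longrightarrow> t i \<in> K"
    "\<And>j. j \<in> Y \<Longrightarrow> h j - e \<le> (\<Sum>i<T. f j (t i)) / real T"
proof -
  \<comment> \<open>The growth of the squared deficit per step: \<open>R\<close> squared for each
    coordinate, and 2 for twice the slack 1 in \<open>hyp\<close>.\<close>
  define C where "C = real (card Y) * R\<^sup>2 + 2"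
  have C2: "2 \<le> C" by (simp add: C_def)
  have ex: "\<exists>t. (\<forall>i<n. t i \<in> K) \<and> (\<Sum>j\<in>Y. (min 0 (\<Sum>i<n. f j (t i) - h j))\<^sup>2) \<le> real n * C" for n
  proof (induction n)
    case (Suc n)
    then obtain t where t: "\<forall>i<n. t i \<in> K"
      and D: "(\<Sum>j\<in>Y. (min 0 (\<Sum>i<n. f j (t i) - h j))\<^sup>2) \<le> real n * C" by blast
    define S where "S j = (\<Sum>i<n. f j (t i) - h j)" for j
    obtain \<phi> where \<phi>: "\<phi> \<in> K"
      "(\<Sum>j\<in>Y. - min 0 (S j) * h j) \<le> (\<Sum>j\<in>Y. - min 0 (S j) * f j \<phi>) + 1"
      using hyp[of "\<lambda>j. - min 0 (S j)"] by auto
    have step: "(min 0 (S j + (f j \<phi> - h j)))\<^sup>2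
        \<le> (min 0 (S j))\<^sup>2 + 2 * (min 0 (S j) * (f j \<phi> - h j)) + R\<^sup>2" if "j \<in> Y" for j
    proof -
      have "(f j \<phi> - h j)\<^sup>2 \<le> R\<^sup>2"
        using bd[OF that \<phi>(1)] by (metis abs_ge_zero power2_abs power_mono)
      moreover have "(min 0 (S j + (f j \<phi> - h j)))\<^sup>2 \<le> (min 0 (S j) + (f j \<phi> - h j))\<^sup>2"
        by (rule abs_le_square_iff[THEN iffD1]) (auto simp: min_def)
      ultimately show ?thesis by (simp add: power2_sum)
    qed
    let ?t = "t(n := \<phi>)"
    have eq: "(\<Sum>i<Suc n. f j (?t i) - h j) = S j + (f j \<phi> - h j)" for j
      by (simp add: S_def)
    have "(\<Sum>j\<in>Y. (min 0 (\<Sum>i<Suc n. f j (?t i) - h j))\<^sup>2)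
        \<le> (\<Sum>j\<in>Y. (min 0 (S j))\<^sup>2 + 2 * (min 0 (S j) * (f j \<phi> - h j)) + R\<^sup>2)"
      unfolding eq by (intro sum_mono step)
    also have "\<dots> = (\<Sum>j\<in>Y. (min 0 (S j))\<^sup>2) + 2 * (\<Sum>j\<in>Y. min 0 (S j) * (f j \<phi> - h j)) + real (card Y) * R\<^sup>2"
      by (simp add: sum.distrib sum_distrib_left)
    also have "(\<Sum>j\<in>Y. min 0 (S j) * (f j \<phi> - h j)) \<le> 1"
      using \<phi>(2) by (simp add: right_diff_distrib sum_subtractf sum_negf)
    also have "(\<Sum>j\<in>Y. (min 0 (S j))\<^sup>2) \<le> real n * C"
      using D by (simp add: S_def)
    finally have "(\<Sum>j\<in>Y. (min 0 (\<Sum>i<Suc n. f j (?t i) - h j))\<^sup>2) \<le> real (Suc n) * C"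
      by (simp add: C_def algebra_simps)
    moreover have "\<forall>i<Suc n. ?t i \<in> K" using t \<phi> by (auto simp: less_Suc_eq)
    ultimately show ?case by blast
  qed simp
  obtain t where t': "\<forall>n. (\<forall>i<n. t n i \<in> K) \<and>
      (\<Sum>j\<in>Y. (min 0 (\<Sum>i<n. f j (t n i) - h j))\<^sup>2) \<le> real n * C"
    using choice[OF allI[of "\<lambda>n. \<exists>t. (\<forall>i<n. t i \<in> K) \<and>
      (\<Sum>j\<in>Y. (min 0 (\<Sum>i<n. f j (t i) - h j))\<^sup>2) \<le> real n * C"], OF ex] by blast
  then have t: "\<And>n i. i < n \<Longrightarrow> t n i \<in> K"
    and D: "\<And>n. (\<Sum>j\<in>Y. (min 0 (\<Sum>i<n. f j (t n i) - h j))\<^sup>2) \<le> real n * C"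
    by blast+
  \<comment> \<open>Each single deficit is at most sqrt (T * C), which is at most T * e as soon as T
    is at least C divided by the square of e.\<close>
  obtain T :: nat where T: "C / e\<^sup>2 < real T" using reals_Archimedean2 by blast
  have T0: "0 < real T" using T C2 e by (smt (verit) divide_nonneg_pos zero_less_power)
  show ?thesis
  proof (rule that[of T "t T"])
    show "0 < T" using T0 by simp
    show "t T i \<in> K" if "i < T" for i using t that .
    show "h j - e \<le> (\<Sum>i<T. f j (t T i)) / real T" if j: "j \<in> Y" for j
    proof -
      have "(min 0 (\<Sum>i<T. f j (t T i) - h j))\<^sup>2 \<le> (\<Sum>j\<in>Y. (min 0 (\<Sum>i<T. f j (t T i) - h j))\<^sup>2)"
        using Y j by (intro member_le_sum) auto
      also have "\<dots> \<le> real T * C" using D .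
      also have "\<dots> \<le> real T * (real T * e\<^sup>2)"
        using T T0 e by (intro mult_left_mono) (auto simp: field_simps)
      finally have "(min 0 (\<Sum>i<T. f j (t T i) - h j))\<^sup>2 \<le> (real T * e)\<^sup>2"
        by (simp add: power2_eq_square ac_simps)
      then have "\<bar>min 0 (\<Sum>i<T. f j (t T i) - h j)\<bar> \<le> real T * e"
        using e T0 abs_le_square_iff[of "min 0 (\<Sum>i<T. f j (t T i) - h j)" "real T * e"] by simp
      then have "- (real T * e) \<le> (\<Sum>i<T. f j (t T i) - h j)" by linarith
      then have "real T * h j - real T * e \<le> (\<Sum>i<T. f j (t T i))"
        by (simp add: sum_subtractf)
      then show ?thesis using T0 by (simp add: field_simps)
    qed
  qed
qed

section \<open>Interpolation of integrals and a recursive inequality\<close>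

lemma weighted_geometric_mean_le:
  fixes x y s :: real
  assumes "0 \<le> x" "0 \<le> y" and s: "0 < s" "s < 1"
  shows "x powr s * y powr (1 - s) \<le> s * x + (1 - s) * y"
proof (cases "x = 0 \<or> y = 0")
  case True
  then show ?thesis using assms by auto
next
  case False
  then have xy: "0 < x" "0 < y" using assms by auto
  have "exp (s * ln x + (1 - s) * ln y) \<le> s * exp (ln x) + (1 - s) * exp (ln y)"
    using convex_onD[OF exp_convex, of "1 - s" "ln x" "ln y"] s by simp
  then show ?thesis using xy by (simp add: powr_def exp_add)
qed

text \<open>Hoelder's inequality: normalize \<open>u\<close> and \<open>v\<close> by their integrals
  and integrate the weighted inequality between geometric and arithmetic mean. An integral may
  vanish, so both normalizing constants are shifted by \<open>e\<close>, which then tends to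
  0.\<close>

lemma integral_interpolation:
  fixes u v w :: "'a \<Rightarrow> real"
  assumes int: "integrable M u" "integrable M v" "integrable M w"
    and nn: "\<And>x. x \<in> space M \<Longrightarrow> 0 \<le> u x" "\<And>x. x \<in> space M \<Longrightarrow> 0 \<le> v x"
    and w: "\<And>x. x \<in> space M \<Longrightarrow> w x \<le> u x powr s * v x powr (1 - s)"
    and s: "0 < s" "s < 1"
  shows "integral\<^sup>L M w \<le> integral\<^sup>L M u powr s * integral\<^sup>L M v powr (1 - s)"
proof -
  let ?U = "integral\<^sup>L M u" and ?V = "integral\<^sup>L M v"
  have U0: "0 \<le> ?U" and V0: "0 \<le> ?V" using nn by (auto intro: Bochner_Integration.integral_nonneg)
  have le: "integral\<^sup>L M w \<le> (?U + e) powr s * (?V + e) powr (1 - s)" if e: "0 < e" for e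
  proof -
    define U V where "U = ?U + e" and "V = ?V + e"
    have UV: "0 < U" "0 < V" using U0 V0 e by (auto simp: U_def V_def)
    define c where "c = U powr s * V powr (1 - s)"
    have c: "0 \<le> c" by (simp add: c_def)
    have "w x \<le> c * (s * (u x / U) + (1 - s) * (v x / V))" if x: "x \<in> space M" for x
    proof -
      have "u x powr s * v x powr (1 - s) = c * ((u x / U) powr s * (v x / V) powr (1 - s))"
        using UV nn[OF x] by (simp add: c_def powr_divide)
      also have "\<dots> \<le> c * (s * (u x / U) + (1 - s) * (v x / V))"
        using UV nn[OF x] s c by (intro mult_left_mono weighted_geometric_mean_le) auto
      finally show ?thesis using w[OF x] by linarith
    qed
    then have "integral\<^sup>L M w \<le> integral\<^sup>L M (\<lambda>x. c * (s * (u x / U) + (1 - s) * (v x / V)))"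
      using int by (intro integral_mono) auto
    also have "\<dots> = c * (s * (?U / U) + (1 - s) * (?V / V))" using int by simp
    also have "\<dots> \<le> c * (s * 1 + (1 - s) * 1)"
      using c s UV e by (intro mult_left_mono add_mono) (auto simp: U_def V_def)
    finally show ?thesis by (simp add: c_def U_def V_def)
  qed
  have "((\<lambda>e. (?U + e) powr s * (?V + e) powr (1 - s)) \<longlongrightarrow> (?U + 0) powr s * (?V + 0) powr (1 - s)) (at_right 0)"
    using s U0 V0
    by (intro tendsto_intros tendsto_powr') (auto simp: eventually_at_right_less intro!: eventually_mono[OF eventually_at_right_less[of 0]])
  moreover have "eventually (\<lambda>e. integral\<^sup>L M w \<le> (?U + e) powr s * (?V + e) powr (1 - s)) (at_right 0)"
    using le by (intro eventually_mono[OF eventually_at_right_less[of 0]]) auto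
  ultimately have "integral\<^sup>L M w \<le> (?U + 0) powr s * (?V + 0) powr (1 - s)"
    by (intro tendsto_lowerbound[where F = "at_right 0"]) auto
  then show ?thesis by simp
qed

text \<open>The weights \<open>R ^ i\<close> turn the pointwise recursion into a self-bounding inequality for the
  supremum, which can be solved because its exponent \<open>1 - t\<close> is less than one.\<close>

lemma self_improving_sequence:
  fixes a :: "nat \<Rightarrow> real"
  assumes a: "\<And>i. 0 \<le> a i" "\<And>i. a i \<le> A"
    and t: "0 < t" "t < 1" and R: "0 < R" "R \<le> 1" and c: "0 \<le> c" and Q: "0 \<le> Q"
    and rec: "\<And>i. a i \<le> c * (Q / R ^ Suc i) powr t * a (Suc i) powr (1 - t)"
  shows "a 0 \<le> (c / R) powr (1 / t) * Q"
proof -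
  define S where "S = (SUP i. R ^ i * a i)"
  \<comment> \<open>The bound \<open>A\<close> enters only here: finiteness of \<open>S\<close> is
    what later allows \<open>S powr (1 - t)\<close> to be cancelled, and the conclusion no longer
    depends on \<open>A\<close>.\<close>
  have bdd: "bdd_above (range (\<lambda>i. R ^ i * a i))"
  proof (rule bdd_aboveI2)
    fix i
    have "R ^ i * a i \<le> 1 * A" using a R by (intro mult_mono power_le_one) auto
    then show "R ^ i * a i \<le> A" by simp
  qed
  have up: "R ^ i * a i \<le> S" for i
    unfolding S_def by (intro cSUP_upper bdd) simp
  have a0S: "a 0 \<le> S" using up[of 0] by simp
  have S0: "0 \<le> S" using a0S a(1)[of 0] by linarith
  have "R ^ i * a i \<le> c / R * Q powr t * S powr (1 - t)" for i
  proof -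
    \<comment> \<open>The powers \<open>t\<close> and \<open>1 - t\<close> of
      \<open>R ^ Suc i\<close> recombine to \<open>R ^ Suc i\<close>; against the weight
      \<open>R ^ i\<close> there remains the factor 1 / R, the same for all
      \<open>i\<close>.\<close>
    have Rp: "0 < R ^ Suc i" using R by simp
    have e1: "a (Suc i) powr (1 - t) = (R ^ Suc i * a (Suc i)) powr (1 - t) / (R ^ Suc i) powr (1 - t)"
      using Rp R a by (simp add: powr_mult del: power_Suc)
    have e2: "(Q / R ^ Suc i) powr t = Q powr t / (R ^ Suc i) powr t"
      using Rp Q by (simp add: powr_divide del: power_Suc)
    have e3: "(R ^ Suc i) powr t * (R ^ Suc i) powr (1 - t) = R ^ Suc i"
      using Rp by (simp add: powr_add[symmetric] del: power_Suc)
    have "c * (Q / R ^ Suc i) powr t * a (Suc i) powr (1 - t)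
        = c * Q powr t * (R ^ Suc i * a (Suc i)) powr (1 - t) / ((R ^ Suc i) powr t * (R ^ Suc i) powr (1 - t))"
      by (simp only: e1 e2 times_divide_eq_left times_divide_eq_right divide_divide_eq_left)
    also have "\<dots> = c * Q powr t * (R ^ Suc i * a (Suc i)) powr (1 - t) / R ^ Suc i"
      by (simp only: e3)
    finally have "c * (Q / R ^ Suc i) powr t * a (Suc i) powr (1 - t)
        = c * Q powr t * (R ^ Suc i * a (Suc i)) powr (1 - t) / R ^ Suc i" .
    then have "R ^ i * a i \<le> R ^ i * (c * Q powr t * (R ^ Suc i * a (Suc i)) powr (1 - t) / R ^ Suc i)"
      using rec[of i] R by (intro mult_left_mono) auto
    also have "\<dots> = c / R * Q powr t * (R ^ Suc i * a (Suc i)) powr (1 - t)"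
      using R by simp
    also have "\<dots> \<le> c / R * Q powr t * S powr (1 - t)"
      using up[of "Suc i"] R a t c by (intro mult_left_mono powr_mono2) (auto simp del: power_Suc)
    finally show ?thesis .
  qed
  then have SS: "S \<le> c / R * Q powr t * S powr (1 - t)"
    unfolding S_def[of] by (intro cSUP_least) (auto simp: S_def)
  show ?thesis
  proof (cases "S = 0")
    case True
    then show ?thesis using a0S Q by (smt (verit) mult_nonneg_nonneg powr_ge_zero)
  next
    case False
    then have Sp: "0 < S" using S0 by simp
    have "S powr t * S powr (1 - t) = S" using Sp by (simp add: powr_add[symmetric])
    then have "S powr t * S powr (1 - t) \<le> c / R * Q powr t * S powr (1 - t)" using SS by simp
    then have "S powr t \<le> c / R * Q powr t"
      by (rule mult_right_le_imp_le) (use Sp in simp)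
    then have "(S powr t) powr (1 / t) \<le> (c / R * Q powr t) powr (1 / t)"
      using t by (intro powr_mono2) auto
    also have "(c / R * Q powr t) powr (1 / t) = (c / R) powr (1 / t) * Q"
      using t Q c R by (subst powr_mult) (auto simp: powr_powr)
    finally have "S \<le> (c / R) powr (1 / t) * Q"
      using Sp t by (simp add: powr_powr)
    then show ?thesis using a0S by linarith
  qed
qed

section \<open>The dual ball and Pietsch domination\<close>

lemma real_or_complex_embedding:
  obtains g :: "'k::real_or_complex \<Rightarrow> complex" where
    "\<And>x y. g (x - y) = g x - g y" "\<And>x. norm (g x) = norm x" "closed (range g)"
proof -
  obtain g :: "'k \<Rightarrow> complex" where add: "\<And>x y. g (x + y) = g x + g y"
    and nrm: "\<And>x. norm (g x) = norm x" and rng: "range g = \<real> \<or> range g = UNIV"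
    using real_or_complex[where 'a='k] by blast
  have "g (x - y) = g x - g y" for x y
    using add[of "x - y" y] by simp
  moreover have "closed (range g)" using rng closed_complex_Reals by auto
  ultimately show ?thesis using that nrm by blast
qed

text \<open>The scalars are known only up to an isometric embedding into the complex numbers with
  closed range, so compactness of balls is carried back along it; its inverse is continuous because
  distances are preserved.\<close>

lemma compact_cball_scalars: "compact (cball (0::'k::real_or_complex) r)"
proof -
  obtain g :: "'k \<Rightarrow> complex" where diff: "\<And>x y. g (x - y) = g x - g y"
    and nrm: "\<And>x. norm (g x) = norm x" and cl: "closed (range g)"
    by (rule real_or_complex_embedding) blast
  have dg: "dist (g x) (g y) = dist x y" for x y
    by (simp add: dist_norm nrm flip: diff)
  have inj: "inj g" using dg by (metis dist_eq_0_iff injI)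
  have cont: "continuous_on (range g) (inv_into UNIV g)"
    unfolding continuous_on_iff
  proof safe
    fix x e assume "0 < (e::real)"
    then show "\<exists>d>0. \<forall>x'\<in>range g. dist x' (g x) < d \<longrightarrow> dist (inv_into UNIV g x') (inv_into UNIV g (g x)) < e"
      using dg inj by (intro exI[of _ e]) auto
  qed
  have "compact (cball 0 r \<inter> range g)" using cl by (simp add: compact_Int_closed)
  then have "compact (inv_into UNIV g ` (cball 0 r \<inter> range g))"
    using cont by (intro compact_continuous_image continuous_on_subset[OF cont]) auto
  moreover have "inv_into UNIV g ` (cball 0 r \<inter> range g) = cball 0 r"
  proof -
    have "cball 0 r \<inter> range g = g ` cball 0 r" using nrm by auto
    then show ?thesis using inj by (simp add: image_image)
  qed
  ultimately show ?thesis by simp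
qed

lemma Cauchy_convergent_scalars:
  fixes X :: "nat \<Rightarrow> 'k::real_or_complex"
  assumes "Cauchy X"
  shows "convergent X"
proof -
  obtain B where B: "\<And>n. norm (X n) \<le> B"
    using Bseq_def cauchy_imp_bounded[OF assms] by (auto simp: bounded_iff)
  then have "\<forall>n. X n \<in> cball 0 B" by simp
  then obtain l r where "strict_mono (r :: nat \<Rightarrow> nat)" "(X \<circ> r) \<longlonglongrightarrow> l"
    using compact_cball_scalars[of B, unfolded compact_eq_seq_compact_metric seq_compact_def] by blast
  then show ?thesis
    using Cauchy_converges_subseq[OF assms] by (auto simp: convergent_def)
qed

locale scaled_banach =
  fixes sE :: "'k::real_or_complex \<Rightarrow> 'e::banach \<Rightarrow> 'e"
  assumes scaling: "banach_scaling sE"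
begin

lemma vs: "vector_space sE" and sE_of_real: "sE (of_real r) x = r *\<^sub>R x"
  and norm_sE: "norm (sE c x) = norm c * norm x"
  using scaling by (auto simp: banach_scaling_def)

lemma linear_functional_iff:
  "Vector_Spaces.linear sE (*) \<phi> \<longleftrightarrow>
     (\<forall>x y. \<phi> (x + y) = \<phi> x + \<phi> y) \<and> (\<forall>c x. \<phi> (sE c x) = c * \<phi> x)"
proof -
  have "vector_space ((*) :: 'k \<Rightarrow> 'k \<Rightarrow> 'k)"
    by standard (auto simp: algebra_simps)
  then show ?thesis using vs by (simp add: Vector_Spaces.linear_iff)
qed

text \<open>Continuity and the operator norm are traded for pointwise conditions, each closed under
  pointwise convergence. Since \<open>onorm\<close> is a supremum of reals, it yields pointwise
  bounds only after continuity at 0 has shown that the functional is bounded.\<close>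

lemma mem_dual_ball_iff:
  "\<phi> \<in> dual_ball sE \<longleftrightarrow> (\<forall>x y. \<phi> (x + y) = \<phi> x + \<phi> y) \<and> (\<forall>c x. \<phi> (sE c x) = c * \<phi> x) \<and>
     (\<forall>x. norm (\<phi> x) \<le> norm x)" (is "?L \<longleftrightarrow> ?R")
proof
  assume L: ?L
  then have add: "\<And>x y. \<phi> (x + y) = \<phi> x + \<phi> y" and sc: "\<And>c x. \<phi> (sE c x) = c * \<phi> x"
    and cont: "continuous_on UNIV \<phi>" and on: "onorm \<phi> \<le> 1"
    by (auto simp: dual_ball_def linear_functional_iff)
  have scR: "\<phi> (r *\<^sub>R x) = r *\<^sub>R \<phi> x" for r x
    using sc[of "of_real r" x] by (simp add: sE_of_real scaleR_conv_of_real)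
  have \<phi>0: "\<phi> 0 = 0" using add[of 0 0] by simp
  obtain d where d: "d > 0" "\<And>x. norm x < d \<Longrightarrow> norm (\<phi> x) < 1"
    using cont[unfolded continuous_on_iff, rule_format, of 0 1] by (auto simp: \<phi>0)
  have "bounded_linear \<phi>"
  proof (rule bounded_linear_intro[where K = "2 / d"])
    fix x
    show "norm (\<phi> x) \<le> norm x * (2 / d)"
    proof (cases "x = 0")
      case False
      have "norm (\<phi> ((d / (2 * norm x)) *\<^sub>R x)) < 1"
        using d(1) False by (intro d(2)) simp
      then show ?thesis using d(1) False by (simp add: scR field_simps)
    qed (simp add: \<phi>0)
  qed (auto simp: add scR)
  then have "norm (\<phi> x) \<le> norm x" for x
    using order_trans[OF onorm[of \<phi> x] mult_right_mono[OF on norm_ge_zero]] by simp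
  then show ?R using add sc by blast
next
  assume R: ?R
  have scR: "\<phi> (r *\<^sub>R x) = r *\<^sub>R \<phi> x" for r x
    using R sE_of_real[of r x] by (metis scaleR_conv_of_real)
  have bl: "bounded_linear \<phi>"
    using R scR by (intro bounded_linear_intro[where K = 1]) auto
  then have "onorm \<phi> \<le> 1" using R by (intro onorm_bound) auto
  then show ?L using R bl
    by (simp add: dual_ball_def linear_functional_iff linear_continuous_on)
qed

lemma norm_dual_ball_le: "\<phi> \<in> dual_ball sE \<Longrightarrow> norm (\<phi> x) \<le> norm x"
  by (simp add: mem_dual_ball_iff)

lemma zero_in_dual_ball: "(\<lambda>_. 0) \<in> dual_ball sE"
  by (simp add: mem_dual_ball_iff)

lemma Hausdorff_functionals: "Hausdorff_space (euclidean :: ('e \<Rightarrow> 'k) topology)"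
  unfolding euclidean_product_topology[symmetric] Hausdorff_space_product_topology by simp

text \<open>Banach-Alaoglu: additivity and homogeneity cut a closed set out of a product of balls,
  which is compact by Tychonoff.\<close>

lemma compact_dual_ball: "compact (dual_ball sE)"
proof -
  have ev: "continuous_on UNIV (\<lambda>\<phi> :: 'e \<Rightarrow> 'k. \<phi> x)" for x by simp
  have "compactin (product_topology (\<lambda>_. euclidean) (UNIV :: 'e set))
          (\<Pi>\<^sub>E x\<in>(UNIV :: 'e set). cball (0::'k) (norm x))"
    by (subst compactin_PiE) (auto simp: compact_cball_scalars)
  then have "compact (\<Pi>\<^sub>E x\<in>(UNIV :: 'e set). cball (0::'k) (norm x))"
    by (simp add: euclidean_product_topology)
  moreover have "closed (\<Inter>x y. {\<phi> :: 'e \<Rightarrow> 'k. \<phi> (x + y) = \<phi> x + \<phi> y})"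
    by (intro closed_INT ballI closed_Collect_eq continuous_on_add ev)
  moreover have "closed (\<Inter>c x. {\<phi> :: 'e \<Rightarrow> 'k. \<phi> (sE c x) = c * \<phi> x})"
    by (intro closed_INT ballI closed_Collect_eq continuous_on_mult_left ev)
  ultimately have "compact ((\<Pi>\<^sub>E x\<in>(UNIV :: 'e set). cball (0::'k) (norm x)) \<inter>
      ((\<Inter>x y. {\<phi> :: 'e \<Rightarrow> 'k. \<phi> (x + y) = \<phi> x + \<phi> y}) \<inter> (\<Inter>c x. {\<phi> :: 'e \<Rightarrow> 'k. \<phi> (sE c x) = c * \<phi> x})))"
    by (intro compact_Int_closed closed_Int)
  also have "\<dots> = dual_ball sE"
    by (auto simp: mem_dual_ball_iff PiE_def Pi_def)
  finally show ?thesis .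
qed

text \<open>A form of \<open>h x \<le> \<integral> |\<phi> x|^p d\<mu>\<close> that mentions no measure: every weighted sum of values of \<open>h\<close> is
  at most the supremum over the dual ball of the same sum of the \<open>|\<phi> x|^p\<close>. The equivalence is
  \<open>dual_dominated_integral\<close> and \<open>dual_dominated_measure\<close>.\<close>

definition dual_dominated :: "real \<Rightarrow> ('e \<Rightarrow> real) \<Rightarrow> bool" where
  "dual_dominated p h \<longleftrightarrow>
     (\<forall>k (x :: nat \<Rightarrow> 'e) (s :: nat \<Rightarrow> real) B. (\<forall>j<k. 0 \<le> s j) \<longrightarrow>
        (\<forall>\<phi>\<in>dual_ball sE. (\<Sum>j<k. s j * norm (\<phi> (x j)) powr p) \<le> B) \<longrightarrow>
        (\<Sum>j<k. s j * h (x j)) \<le> B)"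

text \<open>The zero functional lies in the dual ball, so every admissible bound \<open>B\<close> is
  nonnegative; this comes as an extra premise.\<close>

lemma dual_dominatedI:
  assumes "\<And>k (x :: nat \<Rightarrow> 'e) (s :: nat \<Rightarrow> real) B. (\<And>j. j < k \<Longrightarrow> 0 \<le> s j) \<Longrightarrow>
     (\<And>\<phi>. \<phi> \<in> dual_ball sE \<Longrightarrow> (\<Sum>j<k. s j * norm (\<phi> (x j)) powr p) \<le> B) \<Longrightarrow> 0 \<le> B \<Longrightarrow>
        (\<Sum>j<k. s j * h (x j)) \<le> B"
  shows "dual_dominated p h"
  unfolding dual_dominated_def
proof (intro allI impI)
  fix k and x :: "nat \<Rightarrow> 'e" and s :: "nat \<Rightarrow> real" and B
  assume s: "\<forall>j<k. 0 \<le> s j"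
    and B: "\<forall>\<phi>\<in>dual_ball sE. (\<Sum>j<k. s j * norm (\<phi> (x j)) powr p) \<le> B"
  have "0 \<le> B"
    using s by (intro order_trans[OF sum_nonneg B[rule_format, OF zero_in_dual_ball]]) auto
  then show "(\<Sum>j<k. s j * h (x j)) \<le> B" using s B by (intro assms) auto
qed

lemma dual_dominatedD:
  fixes k :: nat
  assumes "dual_dominated p h" "\<And>j. j < k \<Longrightarrow> 0 \<le> s j"
    "\<And>\<phi>. \<phi> \<in> dual_ball sE \<Longrightarrow> (\<Sum>j<k. s j * norm (\<phi> (x j)) powr p) \<le> B"
  shows "(\<Sum>j<k. s j * h (x j)) \<le> B"
  using assms(1)[unfolded dual_dominated_def, rule_format, of k s x B] assms(2,3) by simp

lemma dual_dominated_mono: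
  assumes h: "dual_dominated p h" and le: "\<And>x. h' x \<le> h x"
  shows "dual_dominated p h'"
proof (rule dual_dominatedI)
  fix k and x :: "nat \<Rightarrow> 'e" and s :: "nat \<Rightarrow> real" and B
  assume s: "\<And>j. j < k \<Longrightarrow> 0 \<le> s j"
    and B: "\<And>\<phi>. \<phi> \<in> dual_ball sE \<Longrightarrow> (\<Sum>j<k. s j * norm (\<phi> (x j)) powr p) \<le> B"
  have "(\<Sum>j<k. s j * h' (x j)) \<le> (\<Sum>j<k. s j * h (x j))"
    using s le by (intro sum_mono mult_left_mono) auto
  also have "\<dots> \<le> B" using dual_dominatedD[OF h s B] .
  finally show "(\<Sum>j<k. s j * h' (x j)) \<le> B" .
qed

text \<open>One vector with weight 1 is enough. The a priori bound makes the series and the suprema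
  of the extrapolation finite.\<close>

lemma dual_dominated_le:
  assumes h: "dual_dominated p h" and p: "0 < p"
  shows "h x \<le> norm x powr p"
proof -
  have "(\<Sum>j<(1::nat). 1 * h x) \<le> norm x powr p"
    using p by (intro dual_dominatedD[OF h]) (auto intro!: powr_mono2 norm_dual_ball_le)
  then show ?thesis by simp
qed

lemma weighted_functionals_le:
  assumes p: "0 < p" and w: "\<And>i. 0 \<le> w i" "\<And>I. finite I \<Longrightarrow> sum w I \<le> 1"
    and \<psi>: "\<And>i :: nat. \<psi> i \<in> dual_ball sE"
  shows "(\<Sum>i<N. w i * norm (\<psi> i a) powr p) \<le> norm a powr p"
proof -
  have "(\<Sum>i<N. w i * norm (\<psi> i a) powr p) \<le> sum w {..<N} * norm a powr p"
    unfolding sum_distrib_right using p w(1) norm_dual_ball_le[OF \<psi>]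
    by (intro sum_mono mult_left_mono powr_mono2) auto
  also have "\<dots> \<le> 1 * norm a powr p" using w(2) by (intro mult_right_mono) auto
  finally show ?thesis by simp
qed

lemma dual_dominated_zero: "dual_dominated p (\<lambda>_. 0)"
  by (rule dual_dominatedI) simp

lemma dual_dominated_functional:
  assumes "\<psi> \<in> dual_ball sE"
  shows "dual_dominated p (\<lambda>x. norm (\<psi> x) powr p)"
  using assms by (intro dual_dominatedI) blast

text \<open>Weights of total at most 1 keep a family of sums below \<open>B\<close>, because
  \<open>B\<close> is nonnegative. The exhaustion \<open>I N\<close> covers series as well as, when
  it is constant, finite averages.\<close>

lemma dual_dominated_suminf:
  fixes w :: "'i \<Rightarrow> real"
  assumes h: "\<And>i. dual_dominated p (h i)"
    and w: "\<And>i. 0 \<le> w i" "\<And>I. finite I \<Longrightarrow> sum w I \<le> 1"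
    and lim: "\<And>x. (\<lambda>N. \<Sum>i\<in>I N. w i * h i x) \<longlonglongrightarrow> H x" and fin: "\<And>N. finite (I N)"
  shows "dual_dominated p H"
proof (rule dual_dominatedI)
  fix k and x :: "nat \<Rightarrow> 'e" and s :: "nat \<Rightarrow> real" and B :: real
  assume s: "\<And>j. j < k \<Longrightarrow> 0 \<le> s j" and B0: "0 \<le> B"
    and B: "\<And>\<phi>. \<phi> \<in> dual_ball sE \<Longrightarrow> (\<Sum>j<k. s j * norm (\<phi> (x j)) powr p) \<le> B"
  have "(\<Sum>j<k. s j * (\<Sum>i\<in>I N. w i * h i (x j))) \<le> B" for N
  proof -
    have "(\<Sum>j<k. s j * (\<Sum>i\<in>I N. w i * h i (x j))) = (\<Sum>i\<in>I N. w i * (\<Sum>j<k. s j * h i (x j)))"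
      by (simp add: sum_distrib_left ac_simps sum.swap[of _ "{..<k}"])
    also have "\<dots> \<le> (\<Sum>i\<in>I N. w i * B)"
      using w(1) dual_dominatedD[OF h s B] by (intro sum_mono mult_left_mono) auto
    also have "\<dots> = sum w (I N) * B" by (simp add: sum_distrib_right)
    also have "\<dots> \<le> 1 * B" using w(2) fin B0 by (intro mult_right_mono) auto
    finally show ?thesis by simp
  qed
  moreover have "(\<lambda>N. \<Sum>j<k. s j * (\<Sum>i\<in>I N. w i * h i (x j))) \<longlonglongrightarrow> (\<Sum>j<k. s j * H (x j))"
    by (intro tendsto_intros lim)
  ultimately show "(\<Sum>j<k. s j * H (x j)) \<le> B"
    by (intro LIMSEQ_le_const2) auto
qed

lemma dual_dominated_average:
  assumes "dual_dominated p h" "dual_dominated p g"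
  shows "dual_dominated p (\<lambda>x. (h x + g x) / 2)"
proof -
  have "dual_dominated p (\<lambda>x. \<Sum>i\<in>UNIV. 1/2 * (if i then h x else g x))"
  proof (rule dual_dominated_suminf[where w = "\<lambda>_::bool. 1/2" and h = "\<lambda>i. if i then h else g" and I = "\<lambda>_. UNIV"])
    fix I :: "bool set"
    have "card I \<le> card (UNIV :: bool set)" by (intro card_mono) auto
    then show "(\<Sum>i\<in>I. 1 / 2 :: real) \<le> 1" by simp
  qed (use assms in \<open>auto simp: if_distrib[of "\<lambda>f. f _"]\<close>)
  then show ?thesis by (simp add: UNIV_bool add_divide_distrib add.commute)
qed

text \<open>If no functional met the requirement of \<open>empirical_domination\<close> for weights
  \<open>s\<close>, then the weighted sum of \<open>h\<close> minus 1 would be an admissible bound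
  \<open>B\<close>, and the sum would be at most itself minus 1. Thanks to the slack 1, the supremum
  over the dual ball need not be attained.\<close>

lemma dual_dominated_empirical:
  assumes h: "dual_dominated p h" and p: "0 < p" and X: "finite X" and e: "0 < e"
  obtains T and t :: "nat \<Rightarrow> 'e \<Rightarrow> 'k" where "0 < T" "\<And>i. i < T \<Longrightarrow> t i \<in> dual_ball sE"
    "\<And>x. x \<in> X \<Longrightarrow> h x - e \<le> (\<Sum>i<T. norm (t i x) powr p) / real T"
proof (rule empirical_domination[of X "dual_ball sE" "\<lambda>x \<phi>. norm (\<phi> x) powr p" h
      "\<Sum>x\<in>X. norm x powr p + \<bar>h x\<bar>" e])
  show "finite X" by fact
  show "\<bar>norm (\<phi> x) powr p - h x\<bar> \<le> (\<Sum>x\<in>X. norm x powr p + \<bar>h x\<bar>)"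
    if "x \<in> X" "\<phi> \<in> dual_ball sE" for x \<phi>
  proof -
    have "norm (\<phi> x) powr p \<le> norm x powr p"
      using p norm_dual_ball_le[OF that(2)] by (intro powr_mono2) auto
    then have "\<bar>norm (\<phi> x) powr p - h x\<bar> \<le> norm x powr p + \<bar>h x\<bar>"
      by (smt (verit) powr_ge_zero)
    also have "\<dots> \<le> (\<Sum>x\<in>X. norm x powr p + \<bar>h x\<bar>)"
      using X that by (intro member_le_sum) auto
    finally show ?thesis .
  qed
  show "\<exists>\<phi>\<in>dual_ball sE. (\<Sum>x\<in>X. s x * h x) \<le> (\<Sum>x\<in>X. s x * norm (\<phi> x) powr p) + 1"
    if s: "\<And>x. x \<in> X \<Longrightarrow> 0 \<le> s x" for s
  proof (rule ccontr)
    assume "\<not> ?thesis"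
    then have lt: "(\<Sum>x\<in>X. s x * norm (\<phi> x) powr p) \<le> (\<Sum>x\<in>X. s x * h x) - 1"
      if "\<phi> \<in> dual_ball sE" for \<phi> using that by fastforce
    obtain b where b: "bij_betw b {..<card X} X"
      using ex_bij_betw_nat_finite[OF X] by (auto simp: atLeast0LessThan)
    have re: "(\<Sum>j<card X. F (b j)) = sum F X" for F :: "'e \<Rightarrow> real"
      by (rule sum.reindex_bij_betw[OF b])
    have "(\<Sum>j<card X. s (b j) * h (b j)) \<le> (\<Sum>x\<in>X. s x * h x) - 1"
    proof (rule dual_dominatedD[OF h])
      show "0 \<le> s (b j)" if "j < card X" for j
        using that b s by (auto simp: bij_betw_def)
      show "(\<Sum>j<card X. s (b j) * norm (\<phi> (b j)) powr p) \<le> (\<Sum>x\<in>X. s x * h x) - 1"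
        if "\<phi> \<in> dual_ball sE" for \<phi>
        using lt[OF that] re[of "\<lambda>x. s x * norm (\<phi> x) powr p"] by simp
    qed
    then show False using re[of "\<lambda>x. s x * h x"] by simp
  qed
qed (use e that in auto)

section \<open>Moments of measures on the dual ball and Pietsch domination\<close>

lemma continuous_on_evaluation_powr:
  "0 < p \<Longrightarrow> continuous_on A (\<lambda>\<phi> :: 'e \<Rightarrow> 'k. norm (\<phi> x) powr p)"
  by (intro continuous_on_powr' continuous_on_norm continuous_on_const
      continuous_on_subset[OF continuous_on_product_coordinates]) auto

lemma regular_prob_measure_space:
  assumes "regular_prob_measure sE \<mu>"
  shows "space \<mu> = dual_ball sE" "finite_measure \<mu>" "measure \<mu> (dual_ball sE) = 1"
proof -
  have "sets \<mu> = sets (restrict_space borel (dual_ball sE))"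
    using assms by (simp add: regular_prob_measure_def)
  then show sp: "space \<mu> = dual_ball sE"
    using sets_eq_imp_space_eq[of \<mu>] by (fastforce simp: space_restrict_space)
  have em: "emeasure \<mu> (space \<mu>) = 1" using assms by (simp add: regular_prob_measure_def)
  then show "finite_measure \<mu>" by (intro finite_measureI) simp
  show "measure \<mu> (dual_ball sE) = 1" using em sp by (simp add: measure_def)
qed

lemma integrable_evaluation_powr:
  assumes \<mu>: "regular_prob_measure sE \<mu>" and p: "0 < p"
  shows "integrable \<mu> (\<lambda>\<phi>. norm (\<phi> x) powr p)"
proof -
  interpret finite_measure \<mu> using regular_prob_measure_space[OF \<mu>] by simp
  have "(\<lambda>\<phi>. norm (\<phi> x) powr p) \<in> borel_measurable (restrict_space borel (dual_ball sE))"
    using p by (intro borel_measurable_continuous_on_restrict continuous_on_evaluation_powr)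
  then have "(\<lambda>\<phi>. norm (\<phi> x) powr p) \<in> borel_measurable \<mu>"
    using \<mu> measurable_cong_sets[of \<mu>] by (metis regular_prob_measure_def)
  moreover have "AE \<phi> in \<mu>. norm (norm (\<phi> x) powr p) \<le> norm x powr p"
    using p regular_prob_measure_space[OF \<mu>]
    by (intro AE_I2) (auto intro!: powr_mono2 norm_dual_ball_le)
  ultimately show ?thesis by (intro integrable_const_bound)
qed

abbreviation moment :: "('e \<Rightarrow> 'k) measure \<Rightarrow> real \<Rightarrow> 'e \<Rightarrow> real" where
  "moment \<mu> p x \<equiv> (\<integral>\<phi>. norm (\<phi> x) powr p \<partial>\<mu>)"

lemma dual_dominated_integral:
  assumes \<mu>: "regular_prob_measure sE \<mu>" and p: "0 < p"
  shows "dual_dominated p (moment \<mu> p)"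
proof (rule dual_dominatedI)
  fix k and x :: "nat \<Rightarrow> 'e" and s :: "nat \<Rightarrow> real" and B :: real
  assume B: "\<And>\<phi>. \<phi> \<in> dual_ball sE \<Longrightarrow> (\<Sum>j<k. s j * norm (\<phi> (x j)) powr p) \<le> B"
  interpret finite_measure \<mu> using regular_prob_measure_space[OF \<mu>] by simp
  have "(\<Sum>j<k. s j * (\<integral>\<phi>. norm (\<phi> (x j)) powr p \<partial>\<mu>)) = (\<integral>\<phi>. (\<Sum>j<k. s j * norm (\<phi> (x j)) powr p) \<partial>\<mu>)"
    using integrable_evaluation_powr[OF \<mu> p] by simp
  also have "\<dots> \<le> (\<integral>\<phi>. B \<partial>\<mu>)"
    using integrable_evaluation_powr[OF \<mu> p] B regular_prob_measure_space[OF \<mu>]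
    by (intro integral_mono) auto
  finally show "(\<Sum>j<k. s j * (\<integral>\<phi>. norm (\<phi> (x j)) powr p \<partial>\<mu>)) \<le> B"
    using regular_prob_measure_space[OF \<mu>] by simp
qed

text \<open>Pietsch's domination theorem. Averages of point masses dominate \<open>h\<close> only up
  to an error, so an index is a vector together with a number that fixes the error allowed for it. A
  finite set of indices thus carries its own accuracy, and the error disappears only after the
  measure has been found.\<close>

lemma dual_dominated_measure:
  assumes h: "dual_dominated p h" and p: "0 < p"
  obtains \<mu> where "regular_prob_measure sE \<mu>" "\<And>x. h x \<le> moment \<mu> p x"
proof -
  let ?K = "dual_ball sE"
  define f where "f j \<phi> = norm (\<phi> (fst j)) powr p" for j :: "'e \<times> nat" and \<phi> :: "'e \<Rightarrow> 'k"
  define h' where "h' j = h (fst j) - 1 / real (Suc (snd j))" for j :: "'e \<times> nat"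
  define b where "b j = norm (fst j) powr p" for j :: "'e \<times> nat"
  have fnn: "0 \<le> f j \<phi>" for j \<phi> by (simp add: f_def)
  have fb: "f j \<phi> \<le> b j" if "\<phi> \<in> ?K" for j \<phi>
    using p norm_dual_ball_le[OF that] by (auto simp: f_def b_def intro!: powr_mono2)
  have emp: "\<exists>T>0. \<exists>t :: nat \<Rightarrow> 'e \<Rightarrow> 'k. (\<forall>i<T. t i \<in> ?K) \<and>
      (\<forall>j\<in>Y. h' j \<le> (\<Sum>i<T. f j (t i)) / real T)" if Y: "finite Y" for Y
  proof -
    \<comment> \<open>The sum bounds the second component of every index in \<open>Y\<close>, so the
      accuracy 1 / (N + 1) serves them all.\<close>
    define N where "N = (\<Sum>j\<in>Y. snd j)"
    obtain T t where T: "0 < T" "\<And>i. i < T \<Longrightarrow> t i \<in> ?K"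
      and t: "\<And>x. x \<in> fst ` Y \<Longrightarrow> h x - 1 / real (Suc N) \<le> (\<Sum>i<T. norm (t i x) powr p) / real T"
      using dual_dominated_empirical[OF h p, of "fst ` Y" "1 / real (Suc N)"] Y by auto
    have "h' j \<le> (\<Sum>i<T. f j (t i)) / real T" if j: "j \<in> Y" for j
    proof -
      have "snd j \<le> N" unfolding N_def using Y j by (intro member_le_sum) auto
      then have "1 / real (Suc N) \<le> 1 / real (Suc (snd j))" by (simp add: field_simps)
      then show ?thesis using t[of "fst j"] j by (simp add: h'_def f_def)
    qed
    then show ?thesis using T by blast
  qed
  obtain m :: "('e \<Rightarrow> 'k) set \<Rightarrow> real" where m: "\<And>A. 0 \<le> m A"
    "\<And>A B. A \<inter> B = {} \<Longrightarrow> m (A \<union> B) = m A + m B" "m ?K = 1"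
    "\<And>j e N. 0 < e \<Longrightarrow> b j \<le> real N * e \<Longrightarrow>
       h' j \<le> e + (\<Sum>k\<in>{1..N}. e * m {\<phi>\<in>?K. real k * e \<le> f j \<phi>})"
    using empirical_cluster_content[of ?K f b h', OF fnn fb emp] by blast
  obtain \<mu> where \<mu>: "sets \<mu> = sets (restrict_space borel ?K)" "emeasure \<mu> (space \<mu>) = 1"
    "\<And>A. A \<in> sets \<mu> \<Longrightarrow> emeasure \<mu> A = (SUP C\<in>{C. compact C \<and> C \<subseteq> A}. emeasure \<mu> C)"
    "\<And>A. A \<in> sets \<mu> \<Longrightarrow>
       emeasure \<mu> A = (INF U\<in>{U. openin (top_of_set ?K) U \<and> A \<subseteq> U}. emeasure \<mu> U)"
    "\<And>C. compact C \<Longrightarrow> C \<subseteq> ?K \<Longrightarrow> m C \<le> measure \<mu> C"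
    using regular_measure_from_content[OF Hausdorff_functionals compact_dual_ball m(1,2,3)] by blast
  have reg: "regular_prob_measure sE \<mu>"
    unfolding regular_prob_measure_def using \<mu>(1,2,3,4) by blast
  note sp = regular_prob_measure_space[OF reg]
  interpret finite_measure \<mu> using sp by simp
  have hf: "h' j \<le> (\<integral>\<phi>. f j \<phi> \<partial>\<mu>)" for j
  proof (rule field_le_epsilon)
    fix e :: real assume e: "0 < e"
    define N where "N = nat \<lceil>b j / e\<rceil>"
    have "b j / e \<le> real N" unfolding N_def by linarith
    then have N: "b j \<le> real N * e" using e by (simp add: field_simps)
    let ?A = "\<lambda>k. {\<phi>\<in>?K. real k * e \<le> f j \<phi>}"
    have comp: "compact (?A k)" for k
    proof -
      have "closed {\<phi>. real k * e \<le> f j \<phi>}"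
        unfolding f_def using p by (intro closed_Collect_le continuous_on_const continuous_on_evaluation_powr)
      then have "compact (?K \<inter> {\<phi>. real k * e \<le> f j \<phi>})"
        by (intro compact_Int_closed compact_dual_ball)
      moreover have "?A k = ?K \<inter> {\<phi>. real k * e \<le> f j \<phi>}" by blast
      ultimately show ?thesis by (simp only:)
    qed
    have meas: "?A k \<in> sets \<mu>" for k
    proof -
      have "?A k = ?K \<inter> {\<phi>. real k * e \<le> f j \<phi>}" by blast
      moreover have "closed {\<phi>. real k * e \<le> f j \<phi>}"
        unfolding f_def using p by (intro closed_Collect_le continuous_on_const continuous_on_evaluation_powr)
      ultimately show ?thesis unfolding \<mu>(1) sets_restrict_space by (metis borel_closed image_eqI)
    qed
    have "h' j \<le> e + (\<Sum>k\<in>{1..N}. e * m (?A k))" using m(4)[OF e N] .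
    \<comment> \<open>The content is at most the measure on compact sets, and only this direction is
      needed.\<close>
    also have "\<dots> \<le> e + (\<Sum>k\<in>{1..N}. e * measure \<mu> (?A k))"
      using e comp by (intro add_left_mono sum_mono mult_left_mono \<mu>(5)) auto
    also have "(\<Sum>k\<in>{1..N}. e * measure \<mu> (?A k)) = (\<integral>\<phi>. (\<Sum>k\<in>{1..N}. e * indicator (?A k) \<phi>) \<partial>\<mu>)"
      using meas by (subst Bochner_Integration.integral_sum) (auto simp: emeasure_eq_measure)
    also have "\<dots> \<le> (\<integral>\<phi>. f j \<phi> \<partial>\<mu>)"
    proof (rule integral_mono)
      show "integrable \<mu> (\<lambda>\<phi>. \<Sum>k\<in>{1..N}. e * indicator (?A k) \<phi> :: real)"
        using meas by (intro Bochner_Integration.integrable_sum integrable_mult_right)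
          (auto simp: emeasure_eq_measure)
      show "integrable \<mu> (f j)"
        unfolding f_def using integrable_evaluation_powr[OF reg p] .
      fix \<phi> assume "\<phi> \<in> space \<mu>"
      then have \<phi>: "\<phi> \<in> ?K" using sp by simp
      have "(\<Sum>k\<in>{1..N}. e * indicator (?A k) \<phi>) = (\<Sum>k\<in>{1..N}. e * of_bool (real k * e \<le> f j \<phi>))"
        using \<phi> by (intro sum.cong) (auto simp: indicator_def)
      also have "\<dots> \<le> f j \<phi>"
        using fnn fb[OF \<phi>, of j] N e by (intro layer_sum_bounds(1)) auto
      finally show "(\<Sum>k\<in>{1..N}. e * indicator (?A k) \<phi>) \<le> f j \<phi>" .
    qed
    finally show "h' j \<le> (\<integral>\<phi>. f j \<phi> \<partial>\<mu>) + e" by simp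
  qed
  show ?thesis
  proof (rule that[OF reg])
    fix x
    show "h x \<le> moment \<mu> p x"
    proof (rule LIMSEQ_le_const2)
      show "(\<lambda>n. h x - 1 / real (Suc n)) \<longlonglongrightarrow> h x"
        using tendsto_diff[OF tendsto_const LIMSEQ_inverse_real_of_nat, of "h x"]
        by (simp add: inverse_eq_divide)
      show "\<exists>N. \<forall>n\<ge>N. h x - 1 / real (Suc n) \<le> moment \<mu> p x"
        using hf[of "(x, _)"] by (simp add: h'_def f_def)
    qed
  qed
qed

lemma integral_powr_interpolation:
  assumes \<mu>: "regular_prob_measure sE \<mu>" and p: "0 < p" "p < r" "r < q"
  shows "moment \<mu> r x \<le>
     moment \<mu> p x powr ((q - r) / (q - p)) *
     moment \<mu> q x powr (1 - (q - r) / (q - p))"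
proof (rule integral_interpolation)
  \<comment> \<open>The weight is determined by r = p * s + q * (1 - s).\<close>
  define s where "s = (q - r) / (q - p)"
  have "s * (q - p) = q - r" using p by (simp add: s_def)
  then have "p * s + q * (1 - s) = r" by (simp add: algebra_simps)
  then show "norm (\<phi> x) powr r \<le> (norm (\<phi> x) powr p) powr ((q - r) / (q - p)) *
      (norm (\<phi> x) powr q) powr (1 - (q - r) / (q - p))" for \<phi> :: "'e \<Rightarrow> 'k"
    by (simp add: powr_powr flip: powr_add s_def)
qed (use p integrable_evaluation_powr[OF \<mu>] in \<open>auto simp: field_simps\<close>)

lemma integral_powr_mono_exponent:
  assumes \<mu>: "regular_prob_measure sE \<mu>" and p: "0 < p" "p \<le> q"
  shows "moment \<mu> p x \<le> moment \<mu> q x powr (p / q)"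
proof (cases "p = q")
  case True
  then show ?thesis using p by simp
next
  case False
  interpret finite_measure \<mu> using regular_prob_measure_space[OF \<mu>] by simp
  have "moment \<mu> p x \<le>
     moment \<mu> q x powr (p / q) * (\<integral>\<phi>. 1 \<partial>\<mu>) powr (1 - p / q)"
    by (rule integral_interpolation)
      (use p False integrable_evaluation_powr[OF \<mu>] in \<open>auto simp: powr_powr\<close>)
  then show ?thesis using regular_prob_measure_space[OF \<mu>] by simp
qed

text \<open>The inclusion of r-summing in p-summing mappings: on a probability space, moments grow
  with the exponent. A representing measure for \<open>g\<close> serves for the power too, and no
  constant is lost.\<close>

lemma dual_dominated_powr:
  assumes g: "dual_dominated r g" "\<And>x. 0 \<le> g x" and r: "0 < r" "r \<le> p"
  shows "dual_dominated p (\<lambda>x. g x powr (p / r))"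
proof -
  obtain \<mu> where \<mu>: "regular_prob_measure sE \<mu>" "\<And>x. g x \<le> moment \<mu> r x"
    using dual_dominated_measure[OF g(1) r(1)] by blast
  have p: "0 < p" using r by simp
  show ?thesis
  proof (rule dual_dominated_mono[OF dual_dominated_integral[OF \<mu>(1) p]])
    fix x
    have "g x powr (p / r) \<le> (moment \<mu> p x powr (r / p)) powr (p / r)"
      using r g(2) by (intro powr_mono2 order_trans[OF \<mu>(2) integral_powr_mono_exponent[OF \<mu>(1)]]) auto
    then show "g x powr (p / r) \<le> moment \<mu> p x"
      using r by (simp add: powr_powr)
  qed
qed

end

section \<open>Extrapolation\<close>

lemma half_powers_sum_le: "finite I \<Longrightarrow> (\<Sum>i\<in>I. (1/2::real) ^ Suc i) \<le> 1"
  using sum_le_suminf[OF sums_summable[OF power_half_series], of I] sums_unique[OF power_half_series]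
  by simp

context scaled_banach
begin

text \<open>The constant is fixed before \<open>h\<close>. Only this uniformity allows the estimate
  to be iterated.\<close>

abbreviation transfers :: "real \<Rightarrow> real \<Rightarrow> real \<Rightarrow> bool" where
  "transfers q p c \<equiv> (\<forall>h. (\<forall>x. 0 \<le> h x) \<longrightarrow> dual_dominated q h \<longrightarrow>
     dual_dominated p (\<lambda>x. h x powr (p / q) / c))"

text \<open>Domination of the r-th power yields a measure; its r-moment is interpolated between its
  p-moment \<open>b\<close> and its q-moment \<open>h'\<close>. The latter is again q-dominated, so
  the step can be repeated with \<open>h'\<close> for \<open>h\<close>. Since
  \<open>b powr (q / p)\<close> has the same degree of homogeneity as \<open>h'\<close> and
  \<open>h\<close>, the two exponents add up to 1.\<close>

lemma extrapolation_step:
  assumes H: "transfers q r c"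
    and p: "0 < p" "p < r" "r < q" and c: "0 < c"
    and h: "\<And>x. 0 \<le> h x" "dual_dominated q h"
  obtains h' b where "\<And>x. 0 \<le> h' x" "dual_dominated q h'" "\<And>x. 0 \<le> b x" "dual_dominated p b"
    "\<And>x. h x \<le> c powr (q / r) * (b x powr (q / p)) powr ((q - r) / (q - p) * p / r) *
       h' x powr (1 - (q - r) / (q - p) * p / r)"
proof -
  define s where "s = (q - r) / (q - p)"
  have s: "0 < s" "s < 1" using p by (auto simp: s_def)
  obtain \<mu> where \<mu>: "regular_prob_measure sE \<mu>"
    "\<And>x. h x powr (r / q) / c \<le> moment \<mu> r x"
    using dual_dominated_measure[OF H[rule_format, OF h]] p by auto
  define h' where "h' x = moment \<mu> q x" for x
  define b where "b x = moment \<mu> p x" for x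
  have nn: "0 \<le> h' x" "0 \<le> b x" for x by (simp_all add: h'_def b_def)
  show ?thesis
  proof (rule that[of h' b])
    show "dual_dominated q h'" "dual_dominated p b"
      unfolding h'_def b_def using \<mu>(1) p by (auto intro: dual_dominated_integral)
    fix x
    have "h x powr (r / q) / c \<le> b x powr s * h' x powr (1 - s)"
      unfolding b_def h'_def s_def
      by (rule order_trans[OF \<mu>(2) integral_powr_interpolation[OF \<mu>(1) p]])
    then have "h x powr (r / q) \<le> c * (b x powr s * h' x powr (1 - s))"
      using c by (simp add: field_simps)
    then have "(h x powr (r / q)) powr (q / r) \<le> (c * (b x powr s * h' x powr (1 - s))) powr (q / r)"
      using p by (intro powr_mono2) auto
    also have "(h x powr (r / q)) powr (q / r) = h x"
      using p h(1)[of x] by (simp add: powr_powr)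
    also have "(c * (b x powr s * h' x powr (1 - s))) powr (q / r)
        = c powr (q / r) * (b x powr (s * (q / r)) * h' x powr ((1 - s) * (q / r)))"
      using c by (simp add: powr_mult powr_powr)
    also have "s * (q / r) = (q / p) * (s * p / r)" using p by simp
    also have "(1 - s) * (q / r) = 1 - s * p / r"
    proof -
      have "s * (q - p) = q - r" using p by (simp add: s_def)
      then have "(1 - s) * q = r - s * p" by (simp add: algebra_simps)
      then show ?thesis using p by (simp add: field_simps)
    qed
    finally show "h x \<le> c powr (q / r) * (b x powr (q / p)) powr ((q - r) / (q - p) * p / r) *
       h' x powr (1 - (q - r) / (q - p) * p / r)"
      by (simp add: powr_powr mult.assoc flip: s_def)
  qed (use nn in auto)
qed

text \<open>The p-moments \<open>b n\<close> arising in all the steps must be replaced by a single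
  p-dominated function. Their series \<open>B\<close> with weights (1/2) ^ (n + 1) is one, at the
  cost that \<open>b n\<close> is only bounded by 2 ^ (n + 1) times \<open>B\<close>. This geometric
  loss is what \<open>self_improving_sequence\<close> tolerates.\<close>

lemma extrapolation_below:
  assumes H: "transfers q r c"
    and p: "0 < p" "p < r" "r < q" and c: "0 < c"
  shows "\<exists>d>0. transfers q p d"
proof -
  define \<theta> where "\<theta> = (q - r) / (q - p) * p / r"
  define c1 where "c1 = c powr (q / r)"
  \<comment> \<open>In step i, \<open>b (Suc i)\<close> is at most 2 ^ (i + 2) * B; raised to q / p
    the factor becomes 1 / R ^ (i + 2). One power of \<open>R\<close> is absorbed in
    \<open>Q\<close>, which explains the last division in \<open>c2\<close>.\<close>
  define R where "R = (1/2) powr (q / p)"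
  define c2 where "c2 = (c1 / R) powr (1 / \<theta>) / R"
  have qr: "(q - r) / (q - p) < 1" "0 < (q - r) / (q - p)" using p by auto
  have \<theta>: "0 < \<theta>" "\<theta> < 1"
  proof -
    show "0 < \<theta>" using p qr by (simp add: \<theta>_def)
    have "(q - r) / (q - p) * (p / r) < 1 * 1"
      using p qr by (intro mult_strict_mono) auto
    then show "\<theta> < 1" by (simp add: \<theta>_def)
  qed
  have R: "0 < R" "R \<le> 1" using p by (auto simp: R_def intro: powr_le1)
  have c1: "0 < c1" using c by (simp add: c1_def)
  have c2: "0 < c2" using c1 R by (simp add: c2_def)
  have "dual_dominated p (\<lambda>x. h x powr (p / q) / (c2 powr (p / q)))"
    if h0: "\<And>x. 0 \<le> h x" and hD: "dual_dominated q h" for h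
  proof -
    define good where "good g \<longleftrightarrow> (\<forall>x. 0 \<le> fst g x) \<and> dual_dominated q (fst g) \<and>
        (\<forall>x. 0 \<le> snd g x) \<and> dual_dominated p (snd g)" for g :: "('e \<Rightarrow> real) \<times> ('e \<Rightarrow> real)"
    \<comment> \<open>First components are the q-dominated functions, second ones the p-dominated.
      Only the second component of the successor occurs, so the zero function paired with
      \<open>h\<close> is a mere start value.\<close>
    define rel where "rel g g' \<longleftrightarrow> (\<forall>x. fst g x \<le> c1 * (snd g' x powr (q / p)) powr \<theta> *
        fst g' x powr (1 - \<theta>))" for g g' :: "('e \<Rightarrow> real) \<times> ('e \<Rightarrow> real)"
    have "\<exists>f. f 0 = (h, \<lambda>_. 0) \<and> (\<forall>n. good (f n) \<and> rel (f n) (f (Suc n)))"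
    proof -
      have "\<exists>g'. good g' \<and> rel g g'" if "good g" for g
      proof -
        obtain h' b where "\<And>x. 0 \<le> h' x" "dual_dominated q h'" "\<And>x. 0 \<le> b x" "dual_dominated p b"
          "\<And>x. fst g x \<le> c1 * (b x powr (q / p)) powr \<theta> * h' x powr (1 - \<theta>)"
          using extrapolation_step[OF H p c, of "fst g"] \<open>good g\<close>
          unfolding \<theta>_def c1_def good_def by metis
        then show ?thesis by (intro exI[of _ "(h', b)"]) (simp add: good_def rel_def)
      qed
      moreover have "good (h, \<lambda>_. 0)"
        using h0 hD by (simp add: good_def dual_dominated_zero)
      ultimately have "\<exists>f. \<forall>n. (good (f n) \<and> (n = 0 \<longrightarrow> f n = (h, \<lambda>_. 0))) \<and> rel (f n) (f (Suc n))"
        by (intro dependent_nat_choice) auto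
      then show ?thesis by metis
    qed
    then obtain f where f0: "f 0 = (h, \<lambda>_. 0)" and good: "\<And>n. good (f n)"
      and rel: "\<And>n. rel (f n) (f (Suc n))" by blast
    define a where "a n = fst (f n)" for n
    define b where "b n = snd (f n)" for n
    have a: "\<And>n x. 0 \<le> a n x" "\<And>n. dual_dominated q (a n)"
      and b: "\<And>n x. 0 \<le> b n x" "\<And>n. dual_dominated p (b n)"
      using good by (auto simp: a_def b_def good_def)
    have bsum: "summable (\<lambda>n. (1/2) ^ Suc n * b n x)" for x
    proof (rule summable_comparison_test')
      show "summable (\<lambda>n. (1/2) ^ Suc n * norm x powr p)"
        using sums_summable[OF power_half_series] by (rule summable_mult2)
      show "norm ((1/2) ^ Suc n * b n x) \<le> (1/2) ^ Suc n * norm x powr p" for n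
        using b(1)[of n x] dual_dominated_le[OF b(2) p(1), of n x]
        by (auto simp: abs_mult intro!: mult_left_mono)
    qed
    define B where "B x = (\<Sum>n. (1/2) ^ Suc n * b n x)" for x
    have BD: "dual_dominated p B"
    proof (rule dual_dominated_suminf[where h = b and w = "\<lambda>n. (1/2) ^ Suc n" and I = "\<lambda>N. {..<N}"])
      show "(\<lambda>N. \<Sum>n\<in>{..<N}. (1/2) ^ Suc n * b n x) \<longlonglongrightarrow> B x" for x
        unfolding B_def by (rule summable_LIMSEQ[OF bsum])
    qed (use b half_powers_sum_le in auto)
    have B0: "0 \<le> B x" for x unfolding B_def using b by (intro suminf_nonneg bsum) auto
    have bB: "b n x \<le> 2 ^ Suc n * B x" for n x
    proof -
      have "(\<Sum>n\<in>{n}. (1/2) ^ Suc n * b n x) \<le> B x"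
        unfolding B_def using b by (intro sum_le_suminf bsum) auto
      then show ?thesis by (simp add: field_simps)
    qed
    have main: "h x \<le> c2 * B x powr (q / p)" for x
    proof -
      define Q where "Q = B x powr (q / p) / R"
      have Q0: "0 \<le> Q" using R by (simp add: Q_def)
      have "a 0 x \<le> (c1 / R) powr (1 / \<theta>) * Q"
      proof (rule self_improving_sequence[where A = "norm x powr q"])
        show "a i x \<le> norm x powr q" for i using dual_dominated_le[OF a(2)] p by simp
        fix i
        have "b (Suc i) x powr (q / p) \<le> (2 ^ Suc (Suc i) * B x) powr (q / p)"
          using b bB[of "Suc i" x] p by (intro powr_mono2) auto
        also have "\<dots> = Q / R ^ Suc i"
        proof -
          have "R ^ Suc (Suc i) = ((1/2) ^ Suc (Suc i)) powr (q / p)"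
            unfolding R_def by (simp add: powr_power powr_realpow[symmetric] powr_powr mult.commute del: power_Suc)
          then have "(2 ^ Suc (Suc i)) powr (q / p) = 1 / R ^ Suc (Suc i)"
            by (simp add: powr_divide power_divide del: power_Suc)
          then show ?thesis using R B0[of x] by (simp add: powr_mult Q_def)
        qed
        finally have "b (Suc i) x powr (q / p) \<le> Q / R ^ Suc i" .
        then have "c1 * (b (Suc i) x powr (q / p)) powr \<theta> * a (Suc i) x powr (1 - \<theta>)
            \<le> c1 * (Q / R ^ Suc i) powr \<theta> * a (Suc i) x powr (1 - \<theta>)"
          using c1 \<theta> by (intro mult_right_mono mult_left_mono powr_mono2) auto
        moreover have "a i x \<le> c1 * (b (Suc i) x powr (q / p)) powr \<theta> * a (Suc i) x powr (1 - \<theta>)"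
          using rel[of i] by (simp add: rel_def a_def b_def)
        ultimately show "a i x \<le> c1 * (Q / R ^ Suc i) powr \<theta> * a (Suc i) x powr (1 - \<theta>)" by linarith
      qed (use a \<theta> R c1 Q0 in auto)
      then show ?thesis by (simp add: a_def f0 c2_def Q_def)
    qed
    show ?thesis
    proof (rule dual_dominated_mono[OF BD])
      fix x
      have "h x powr (p / q) \<le> (c2 * B x powr (q / p)) powr (p / q)"
        using h0 main p by (intro powr_mono2) auto
      also have "\<dots> = c2 powr (p / q) * B x"
        using c2 B0[of x] p by (simp add: powr_mult powr_powr)
      finally show "h x powr (p / q) / c2 powr (p / q) \<le> B x"
        using c2 by (simp add: field_simps)
    qed
  qed
  then show ?thesis using c2 by (intro exI[of _ "c2 powr (p / q)"]) auto
qed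

text \<open>Only exponents below \<open>r\<close> need the iteration; from \<open>r\<close> upwards,
  the r-dominated function is raised to the power p / r.\<close>

lemma extrapolation:
  assumes H: "transfers q r c"
    and r: "0 < r" "r < q" and c: "0 < c" and p: "0 < p" "p < q"
  shows "\<exists>d>0. transfers q p d"
proof (cases "p < r")
  case True
  then show ?thesis using extrapolation_below[OF H p(1) _ r(2) c] by blast
next
  case False
  have "dual_dominated p (\<lambda>x. h x powr (p / q) / c powr (p / r))"
    if h: "\<And>x. 0 \<le> h x" "dual_dominated q h" for h
  proof -
    have "dual_dominated p (\<lambda>x. (h x powr (r / q) / c) powr (p / r))"
      using H[rule_format, OF h] c False r by (intro dual_dominated_powr) auto
    moreover have "(h x powr (r / q) / c) powr (p / r) = h x powr (p / q) / c powr (p / r)" for x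
      using c r by (simp add: powr_divide powr_powr)
    ultimately show ?thesis by simp
  qed
  then show ?thesis using c by (intro exI[of _ "c powr (p / r)"]) auto
qed

section \<open>Summing operators and dominated polynomials in terms of domination\<close>

lemma bdd_above_weak_norm:
  "0 < p \<Longrightarrow> bdd_above ((\<lambda>\<phi>. (\<Sum>j<k. norm (\<phi> (x j)) powr p) powr (1 / p)) ` dual_ball sE)"
  by (rule bdd_aboveI2[where M = "(\<Sum>j<k. norm (x j) powr p) powr (1 / p)"])
    (auto intro!: powr_mono2 sum_mono norm_dual_ball_le sum_nonneg)

abbreviation summing_bound :: "real \<Rightarrow> ('e \<Rightarrow> real) \<Rightarrow> real \<Rightarrow> bool" where
  "summing_bound p N C \<equiv> (\<forall>k. \<forall>x :: nat \<Rightarrow> 'e. (\<Sum>j<k. N (x j) powr p) powr (1 / p)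
     \<le> C * (SUP \<phi>\<in>dual_ball sE. (\<Sum>j<k. norm (\<phi> (x j)) powr p) powr (1 / p)))"

text \<open>The summing inequality carries no weights, but homogeneity lets the weight
  \<open>s j\<close> be absorbed by scaling \<open>x j\<close> with \<open>s j powr (1 / p)\<close>.
  Dividing by \<open>C + 1\<close> is safe also for C = 0.\<close>

lemma dual_dominated_of_summing:
  assumes p: "0 < p" and N: "\<And>x. 0 \<le> N x" "\<And>r x. 0 \<le> r \<Longrightarrow> N (sE (of_real r) x) = r * N x"
    and C: "0 \<le> C" and ineq: "summing_bound p N C"
  shows "dual_dominated p (\<lambda>x. (N x / (C + 1)) powr p)"
proof (rule dual_dominatedI)
  fix k and x :: "nat \<Rightarrow> 'e" and s :: "nat \<Rightarrow> real" and B :: real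
  assume s: "\<And>j. j < k \<Longrightarrow> 0 \<le> s j" and B0: "0 \<le> B"
    and B: "\<And>\<phi>. \<phi> \<in> dual_ball sE \<Longrightarrow> (\<Sum>j<k. s j * norm (\<phi> (x j)) powr p) \<le> B"
  define y where "y j = sE (of_real (s j powr (1 / p))) (x j)" for j
  have Ny: "N (y j) powr p = s j * N (x j) powr p" if "j < k" for j
    using s[OF that] p N by (simp add: y_def powr_mult powr_powr)
  have \<phi>y: "norm (\<phi> (y j)) powr p = s j * norm (\<phi> (x j)) powr p" if "j < k" "\<phi> \<in> dual_ball sE" for j \<phi>
    using s[OF that(1)] p that(2) by (simp add: y_def mem_dual_ball_iff norm_mult powr_mult powr_powr)
  have "(\<Sum>j<k. s j * N (x j) powr p) powr (1 / p) = (\<Sum>j<k. N (y j) powr p) powr (1 / p)"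
    using Ny by simp
  also have "\<dots> \<le> C * (SUP \<phi>\<in>dual_ball sE. (\<Sum>j<k. norm (\<phi> (y j)) powr p) powr (1 / p))"
    by (rule ineq[rule_format])
  also have "\<dots> \<le> C * B powr (1 / p)"
  proof (intro mult_left_mono C cSUP_least)
    show "dual_ball sE \<noteq> {}" using zero_in_dual_ball by blast
    show "(\<Sum>j<k. norm (\<phi> (y j)) powr p) powr (1 / p) \<le> B powr (1 / p)" if "\<phi> \<in> dual_ball sE" for \<phi>
      using B[OF that] \<phi>y[OF _ that] s p by (intro powr_mono2) (auto intro!: sum_nonneg)
  qed
  also have "\<dots> \<le> (C + 1) * B powr (1 / p)" by (intro mult_right_mono) auto
  finally have "((\<Sum>j<k. s j * N (x j) powr p) powr (1 / p)) powr p \<le> ((C + 1) * B powr (1 / p)) powr p"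
    using p by (intro powr_mono2) auto
  moreover have "0 \<le> (\<Sum>j<k. s j * N (x j) powr p)" using s by (intro sum_nonneg) auto
  ultimately have "(\<Sum>j<k. s j * N (x j) powr p) \<le> (C + 1) powr p * B"
    using p C B0 by (simp add: powr_powr powr_mult)
  moreover have "(\<Sum>j<k. s j * (N (x j) / (C + 1)) powr p) = (\<Sum>j<k. s j * N (x j) powr p) / (C + 1) powr p"
    using N C by (simp add: powr_divide sum_divide_distrib)
  ultimately show "(\<Sum>j<k. s j * (N (x j) / (C + 1)) powr p) \<le> B"
    using C by (simp add: divide_le_eq mult.commute)
qed

lemma summing_of_dual_dominated:
  assumes p: "0 < p" and c: "0 \<le> c" and N: "\<And>x. 0 \<le> N x" "\<And>x. N x powr p \<le> c * h x"
    and h: "dual_dominated p h"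
  shows "\<exists>C\<ge>0. summing_bound p N C"
proof (intro exI[of _ "c powr (1 / p)"] conjI allI)
  fix k and x :: "nat \<Rightarrow> 'e"
  define S where "S = (SUP \<phi>\<in>dual_ball sE. (\<Sum>j<k. norm (\<phi> (x j)) powr p) powr (1 / p))"
  have up: "(\<Sum>j<k. norm (\<phi> (x j)) powr p) powr (1 / p) \<le> S" if "\<phi> \<in> dual_ball sE" for \<phi>
    unfolding S_def using that p by (intro cSUP_upper bdd_above_weak_norm)
  have S0: "0 \<le> S" using up[OF zero_in_dual_ball] by (smt (verit) powr_ge_zero)
  have "(\<Sum>j<k. 1 * h (x j)) \<le> S powr p"
  proof (rule dual_dominatedD[OF h])
    fix \<phi> assume \<phi>: "\<phi> \<in> dual_ball sE"
    have "((\<Sum>j<k. norm (\<phi> (x j)) powr p) powr (1 / p)) powr p \<le> S powr p"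
      using up[OF \<phi>] p by (intro powr_mono2) auto
    then show "(\<Sum>j<k. 1 * norm (\<phi> (x j)) powr p) \<le> S powr p"
      using p by (simp add: powr_powr sum_nonneg)
  qed simp
  then have "c * (\<Sum>j<k. h (x j)) \<le> c * S powr p" using c by (simp add: mult_left_mono)
  then have "(\<Sum>j<k. N (x j) powr p) \<le> c * S powr p"
    using sum_mono[of "{..<k}" "\<lambda>j. N (x j) powr p" "\<lambda>j. c * h (x j)"] N
    by (simp add: sum_distrib_left)
  then have "(\<Sum>j<k. N (x j) powr p) powr (1 / p) \<le> (c * S powr p) powr (1 / p)"
    using p by (intro powr_mono2) (auto intro!: sum_nonneg)
  also have "\<dots> = c powr (1 / p) * S"
    using p c S0 by (simp add: powr_mult powr_powr)
  finally show "(\<Sum>j<k. N (x j) powr p) powr (1 / p) \<le> c powr (1 / p) *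
      (SUP \<phi>\<in>dual_ball sE. (\<Sum>j<k. norm (\<phi> (x j)) powr p) powr (1 / p))"
    by (simp add: S_def)
qed auto

text \<open>The degree is only an exponent outside the integral, so both inclusions compare moments:
  upwards by monotonicity in the exponent with the same measure, downwards by transferring the
  q-moment function to a p-dominated one and taking a measure for it.\<close>

lemma dominated_polynomials_eq:
  assumes p: "0 < p" "p < q" and m: "1 \<le> m" and d: "0 < d"
    and H: "transfers q p d"
  shows "dominated_polynomials p m sE F = dominated_polynomials q m sE F"
proof (intro equalityI subsetI)
  fix P assume "P \<in> dominated_polynomials p m sE F"
  then obtain C \<mu> where P: "P \<in> polynomials m sE F" and C: "0 \<le> C" and \<mu>: "regular_prob_measure sE \<mu>"
    and le: "\<And>x. vnorm F (P x) \<le> C * moment \<mu> p x powr (real m / p)"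
    unfolding dominated_polynomials_def by blast
  have "vnorm F (P x) \<le> C * moment \<mu> q x powr (real m / q)" for x
  proof -
    have "moment \<mu> p x powr (real m / p)
        \<le> (moment \<mu> q x powr (p / q)) powr (real m / p)"
      using p integral_powr_mono_exponent[OF \<mu>, of p q x] by (intro powr_mono2) auto
    also have "\<dots> = moment \<mu> q x powr (real m / q)"
      using p by (simp add: powr_powr)
    finally show ?thesis using le[of x] C by (meson mult_left_mono order_trans)
  qed
  then show "P \<in> dominated_polynomials q m sE F"
    unfolding dominated_polynomials_def using P C \<mu> by blast
next
  fix P assume "P \<in> dominated_polynomials q m sE F"
  then obtain C \<mu> where P: "P \<in> polynomials m sE F" and C: "0 \<le> C" and \<mu>: "regular_prob_measure sE \<mu>"
    and le: "\<And>x. vnorm F (P x) \<le> C * moment \<mu> q x powr (real m / q)"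
    unfolding dominated_polynomials_def by blast
  define h where "h x = moment \<mu> q x" for x
  have h: "\<And>x. 0 \<le> h x" "dual_dominated q h"
    using p dual_dominated_integral[OF \<mu>] by (auto simp: h_def[abs_def])
  obtain \<nu> where \<nu>: "regular_prob_measure sE \<nu>"
    "\<And>x. h x powr (p / q) / d \<le> moment \<nu> p x"
    using dual_dominated_measure[OF H[rule_format, OF h] p(1)] by blast
  have "vnorm F (P x) \<le> C * d powr (real m / p) * moment \<nu> p x powr (real m / p)" for x
  proof -
    have "h x powr (real m / q) = (h x powr (p / q)) powr (real m / p)"
      using p by (simp add: powr_powr)
    also have "\<dots> \<le> (d * moment \<nu> p x) powr (real m / p)"
      using p d \<nu>(2)[of x] by (intro powr_mono2) (auto simp: field_simps)
    also have "\<dots> = d powr (real m / p) * moment \<nu> p x powr (real m / p)"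
      using d by (simp add: powr_mult)
    finally have "C * h x powr (real m / q) \<le> C * (d powr (real m / p) * moment \<nu> p x powr (real m / p))"
      using C by (rule mult_left_mono)
    then show ?thesis using le[of x] by (simp add: h_def mult.assoc)
  qed
  moreover have "0 \<le> C * d powr (real m / p)" using C by simp
  ultimately show "P \<in> dominated_polynomials p m sE F"
    unfolding dominated_polynomials_def using P \<nu>(1) by blast
qed

end

section \<open>Multilinear mappings into normed spaces\<close>

lemma
  assumes F: "normed_space F" and x: "x \<in> carrier F"
  shows vnorm_smult: "vnorm F (c \<odot>\<^bsub>F\<^esub> x) = norm c * vnorm F x"
    and vnorm_zero_iff: "vnorm F x = 0 \<longleftrightarrow> x = \<zero>\<^bsub>F\<^esub>"
    and vdist_zero: "vdist F \<zero>\<^bsub>F\<^esub> x = vnorm F x"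
    and vnorm_nonneg: "0 \<le> vnorm F x"
proof -
  interpret Module.module scalars F using F by (simp add: normed_space_def)
  interpret d: Metric_space "carrier F" "vdist F" by (rule Metric_space_vdist[OF F])
  show "vnorm F (c \<odot>\<^bsub>F\<^esub> x) = norm c * vnorm F x" "vnorm F x = 0 \<longleftrightarrow> x = \<zero>\<^bsub>F\<^esub>"
    using F x by (auto simp: normed_space_def)
  show dz: "vdist F \<zero>\<^bsub>F\<^esub> x = vnorm F x"
  proof -
    have z: "\<ominus>\<^bsub>F\<^esub> \<zero>\<^bsub>F\<^esub> = \<zero>\<^bsub>F\<^esub>"
      using M.r_neg[OF M.zero_closed] M.l_zero[OF M.a_inv_closed[OF M.zero_closed]] by simp
    show ?thesis
      unfolding d.commute[of "\<zero>\<^bsub>F\<^esub>"] using x by (simp add: vdist_def M.minus_eq z)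
  qed
  show "0 \<le> vnorm F x" using d.nonneg unfolding dz[symmetric] .
qed

lemma multilinear_vnorm_scale:
  assumes F: "normed_space F" and A: "multilinear n sE F A"
  shows "vnorm F (A (\<lambda>i. sE c (x i))) = norm c ^ n * vnorm F (A x)"
proof -
  have "vnorm F (A (\<lambda>i. if i < k then sE c (x i) else x i)) = norm c ^ k * vnorm F (A x)" if "k \<le> n" for k
    using that
  proof (induction k)
    case (Suc k)
    let ?y = "\<lambda>i. if i < k then sE c (x i) else x i"
    have "(\<lambda>i. if i < Suc k then sE c (x i) else x i) = ?y(k := sE c (x k))"
      by (auto simp: fun_eq_iff less_Suc_eq)
    then have "vnorm F (A (\<lambda>i. if i < Suc k then sE c (x i) else x i)) = vnorm F (A (?y(k := sE c (x k))))"
      by (simp only:)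
    also have "\<dots> = vnorm F (c \<odot>\<^bsub>F\<^esub> A (?y(k := x k)))"
      using A Suc.prems by (simp add: multilinear_def)
    also have "\<dots> = norm c * vnorm F (A (?y(k := x k)))"
      using A by (intro vnorm_smult[OF F]) (simp add: multilinear_def)
    also have "?y(k := x k) = ?y" by auto
    finally show ?case using Suc by simp
  qed simp
  from this[of n] have "vnorm F (A (\<lambda>i. if i < n then sE c (x i) else x i)) = norm c ^ n * vnorm F (A x)" by simp
  moreover have "A (\<lambda>i. if i < n then sE c (x i) else x i) = A (\<lambda>i. sE c (x i))"
    using A unfolding multilinear_def by simp
  ultimately show ?thesis by simp
qed

lemma continuous_multilinearD:
  assumes "A \<in> continuous_multilinear n sE F"
  shows "A x \<in> carrier F" "(\<And>i. i < n \<Longrightarrow> x i = y i) \<Longrightarrow> A x = A y"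
    "i < n \<Longrightarrow> A (x(i := a + b)) = A (x(i := a)) \<oplus>\<^bsub>F\<^esub> A (x(i := b))"
    "i < n \<Longrightarrow> A (x(i := sE c a)) = c \<odot>\<^bsub>F\<^esub> A (x(i := a))"
    "continuous_map euclidean (vtopology F) A"
  using assms by (simp_all add: continuous_multilinear_def multilinear_def)

text \<open>Coordinates from \<open>n\<close> on are frozen, so only finitely many radii have to be
  compared and a common one exists.\<close>

lemma open_fun_box:
  fixes x :: "nat \<Rightarrow> 'e::real_normed_vector"
  assumes "open U" "x \<in> U"
  obtains d where "0 < d" "\<And>y. (\<And>i. i < n \<Longrightarrow> norm (y i - x i) < d) \<Longrightarrow> (\<And>i. n \<le> i \<Longrightarrow> y i = x i) \<Longrightarrow> y \<in> U"
proof -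
  obtain X where X: "x \<in> (\<Pi>\<^sub>E i\<in>UNIV. X i)" "\<And>i. open (X i)" "(\<Pi>\<^sub>E i\<in>UNIV. X i) \<subseteq> U"
    using product_topology_open_contains_basis[of "\<lambda>_. euclidean" UNIV U x] assms
    by (auto simp: euclidean_product_topology)
  have "\<exists>d>0. \<forall>z. norm (z - x i) < d \<longrightarrow> z \<in> X i" for i
    using X(1) X(2)[of i] by (auto simp: open_dist dist_norm PiE_def Pi_def)
  then obtain d where d: "\<And>i. 0 < d i" "\<And>i z. norm (z - x i) < d i \<Longrightarrow> z \<in> X i" by metis
  define D where "D = Min (insert 1 (d ` {..<n}))"
  have D: "0 < D" "\<And>i. i < n \<Longrightarrow> D \<le> d i" using d(1) by (auto simp: D_def)
  show ?thesis
  proof (rule that[OF D(1)])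
    fix y assume y: "\<And>i. i < n \<Longrightarrow> norm (y i - x i) < D" "\<And>i. n \<le> i \<Longrightarrow> y i = x i"
    have "y i \<in> X i" for i
      using d(1)[of i] y[of i] D(2)[of i] by (cases "i < n") (auto intro!: d(2))
    then show "y \<in> U" using X(3) by (auto simp: PiE_def)
  qed
qed

text \<open>Continuity at the origin bounds the values on a small box, and homogeneity in the
  \<open>n\<close> variables carries this to the unit box. For n = 0 the mapping is constant and
  need not vanish at the origin.\<close>

lemma continuous_multilinear_bounded:
  fixes F :: "('k::real_or_complex,'f) nspace" and sE :: "'k \<Rightarrow> 'e::banach \<Rightarrow> 'e"
  assumes sE: "banach_scaling sE" and F: "normed_space F" and A: "A \<in> continuous_multilinear n sE F"
  obtains M where "\<And>x :: nat \<Rightarrow> 'e. (\<And>i. i < n \<Longrightarrow> norm (x i) \<le> 1) \<Longrightarrow> vnorm F (A x) \<le> M"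
proof (cases "n = 0")
  case True
  then have "A x = A (\<lambda>_. 0)" for x using A by (simp add: continuous_multilinear_def multilinear_def)
  then have "vnorm F (A x) = vnorm F (A (\<lambda>_. 0))" for x by (rule arg_cong)
  then show ?thesis by (metis order_refl that)
next
  case False
  have ml: "multilinear n sE F A" and cont: "continuous_map euclidean (vtopology F) A"
    using A by (auto simp: continuous_multilinear_def)
  have car: "A x \<in> carrier F" for x using ml by (simp add: multilinear_def)
  interpret Metric_space "carrier F" "vdist F" by (rule Metric_space_vdist[OF F])
  have A0: "A (\<lambda>_. 0) = \<zero>\<^bsub>F\<^esub>"
  proof -
    have "vnorm F (A (\<lambda>i. sE 0 0)) = 0"
      using multilinear_vnorm_scale[OF F ml, of 0 "\<lambda>_. 0"] False by (simp add: power_0_left)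
    moreover have "sE 0 0 = 0" using sE unfolding banach_scaling_def by (metis norm_eq_zero norm_zero mult_zero_left)
    ultimately show ?thesis using vnorm_zero_iff[OF F car] by simp
  qed
  obtain U where U: "open U" "(\<lambda>_. 0) \<in> U" "\<And>y. y \<in> U \<Longrightarrow> A y \<in> mball (A (\<lambda>_. 0)) 1"
    using cont[unfolded vtopology_def continuous_map_to_metric, rule_format, of "\<lambda>_. 0" 1] by auto
  obtain d where d: "0 < d" "\<And>y. (\<And>i. i < n \<Longrightarrow> norm (y i - 0 :: 'e) < d) \<Longrightarrow> (\<And>i. n \<le> i \<Longrightarrow> y i = 0) \<Longrightarrow> y \<in> U"
    using open_fun_box[OF U(1,2), of n] by blast
  show ?thesis
  proof (rule that[of "(2 / d) ^ n"])
    fix x :: "nat \<Rightarrow> 'e" assume x: "\<And>i. i < n \<Longrightarrow> norm (x i) \<le> 1"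
    define y where "y i = (if i < n then sE (of_real (d / 2)) (x i) else 0)" for i
    have "y \<in> U"
    proof (rule d(2))
      show "norm (y i - 0) < d" if "i < n" for i
      proof -
        have "norm (y i) = d / 2 * norm (x i)"
          using that sE d(1) by (simp add: y_def banach_scaling_def)
        also have "\<dots> \<le> d / 2 * 1" using x[OF that] d(1) by (intro mult_left_mono) auto
        finally show ?thesis using d(1) by simp
      qed
    qed (simp add: y_def)
    then have "vnorm F (A y) < 1"
      using U(3)[of y] car vdist_zero[OF F car] by (simp add: A0)
    moreover have "A y = A (\<lambda>i. sE (of_real (d / 2)) (x i))"
      using ml unfolding multilinear_def y_def by simp
    ultimately have "(d / 2) ^ n * vnorm F (A x) < 1"
      using multilinear_vnorm_scale[OF F ml, of "of_real (d/2)" x] d(1) by simp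
    then show "vnorm F (A x) \<le> (2 / d) ^ n"
      using d(1) by (simp add: power_divide field_simps)
  qed
qed

abbreviation unit_box :: "nat \<Rightarrow> (nat \<Rightarrow> 'e::real_normed_vector) set" where
  "unit_box n \<equiv> {x. \<forall>i<n. norm (x i) \<le> 1}"

lemma multilinear_space_simps [simp]:
  "carrier (multilinear_space n sE F) = continuous_multilinear n sE F"
  "\<zero>\<^bsub>multilinear_space n sE F\<^esub> = (\<lambda>x. \<zero>\<^bsub>F\<^esub>)"
  "A \<oplus>\<^bsub>multilinear_space n sE F\<^esub> B = (\<lambda>x. A x \<oplus>\<^bsub>F\<^esub> B x)"
  "c \<odot>\<^bsub>multilinear_space n sE F\<^esub> A = (\<lambda>x. c \<odot>\<^bsub>F\<^esub> A x)"
  "vnorm (multilinear_space n sE F) A = (SUP x\<in>unit_box n. vnorm F (A x))"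
  by (simp_all add: multilinear_space_def)

lemma multilinear_space_bdd:
  assumes "banach_scaling sE" "normed_space F" "A \<in> continuous_multilinear n sE F"
  shows "bdd_above ((\<lambda>x. vnorm F (A x)) ` unit_box n)"
  using continuous_multilinear_bounded[OF assms] by (metis (mono_tags, lifting) bdd_aboveI2 mem_Collect_eq)

lemma vnorm_multilinear_space_ge:
  assumes "banach_scaling sE" "normed_space F" "A \<in> continuous_multilinear n sE F"
    and "\<And>i. i < n \<Longrightarrow> norm (x i) \<le> 1"
  shows "vnorm F (A x) \<le> vnorm (multilinear_space n sE F) A"
  unfolding multilinear_space_simps using assms
  by (intro cSUP_upper multilinear_space_bdd) auto

lemma vnorm_multilinear_space_nonneg:
  assumes sE: "banach_scaling sE" and F: "normed_space F" and A: "A \<in> continuous_multilinear n sE F"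
  shows "0 \<le> vnorm (multilinear_space n sE F) A"
proof -
  have "0 \<le> vnorm F (A (\<lambda>_. 0))"
    using A by (intro vnorm_nonneg[OF F]) (simp add: continuous_multilinear_def multilinear_def)
  then show ?thesis
    using vnorm_multilinear_space_ge[OF assms, of "\<lambda>_. 0"] by simp
qed

lemma vnorm_multilinear_space_smult:
  fixes F :: "('k::real_or_complex,'f) nspace" and sE :: "'k \<Rightarrow> 'e::banach \<Rightarrow> 'e"
  assumes sE: "banach_scaling sE" and F: "normed_space F" and A: "A \<in> continuous_multilinear n sE F"
  shows "vnorm (multilinear_space n sE F) (c \<odot>\<^bsub>multilinear_space n sE F\<^esub> A) =
    norm c * vnorm (multilinear_space n sE F) A"
proof -
  have ne: "(unit_box n :: (nat \<Rightarrow> 'e) set) \<noteq> {}"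
    by (auto intro!: exI[of _ "\<lambda>_. 0"])
  have car: "A x \<in> carrier F" for x using A by (simp add: continuous_multilinear_def multilinear_def)
  let ?S = "SUP x\<in>unit_box n. vnorm F (A x)"
  have "(SUP x\<in>unit_box n. norm c * vnorm F (A x)) = norm c * ?S"
  proof (cases "c = 0")
    case True
    then show ?thesis using ne by simp
  next
    case False
    have up: "vnorm F (A x) \<le> ?S" if "\<forall>i<n. norm (x i) \<le> 1" for x
      using that multilinear_space_bdd[OF assms] by (intro cSUP_upper) auto
    have bdd: "bdd_above ((\<lambda>x. norm c * vnorm F (A x)) ` unit_box n)"
      using up by (intro bdd_aboveI2[where M = "norm c * ?S"]) (auto intro: mult_left_mono)
    show ?thesis
    proof (rule antisym)
      show "(SUP x\<in>unit_box n. norm c * vnorm F (A x)) \<le> norm c * ?S"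
        using up ne by (intro cSUP_least) (auto intro: mult_left_mono)
      have "?S \<le> (SUP x\<in>unit_box n. norm c * vnorm F (A x)) / norm c"
      proof (rule cSUP_least[OF ne])
        fix x :: "nat \<Rightarrow> 'e" assume "x \<in> unit_box n"
        then have "norm c * vnorm F (A x) \<le> (SUP x\<in>unit_box n. norm c * vnorm F (A x))"
          using bdd by (intro cSUP_upper)
        then show "vnorm F (A x) \<le> (SUP x\<in>unit_box n. norm c * vnorm F (A x)) / norm c"
          using False by (simp add: field_simps)
      qed
      then show "norm c * ?S \<le> (SUP x\<in>unit_box n. norm c * vnorm F (A x))"
        using False by (simp add: field_simps)
    qed
  qed
  then show ?thesis by (simp add: vnorm_smult[OF F car])
qed

section \<open>The normed space of continuous multilinear mappings\<close>

lemma vdist_add_le: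
  assumes F: "normed_space F" and car: "a \<in> carrier F" "b \<in> carrier F" "c \<in> carrier F" "d \<in> carrier F"
  shows "vdist F (a \<oplus>\<^bsub>F\<^esub> b) (c \<oplus>\<^bsub>F\<^esub> d) \<le> vdist F a c + vdist F b d"
proof -
  interpret Module.module scalars F using F by (simp add: normed_space_def)
  have "(a \<oplus>\<^bsub>F\<^esub> b) \<ominus>\<^bsub>F\<^esub> (c \<oplus>\<^bsub>F\<^esub> d) = (a \<ominus>\<^bsub>F\<^esub> c) \<oplus>\<^bsub>F\<^esub> (b \<ominus>\<^bsub>F\<^esub> d)"
    using car by (simp add: M.minus_eq M.minus_add M.a_ac)
  then show ?thesis
    using F car by (simp add: vdist_def normed_space_def)
qed

lemma vdist_smult:
  assumes F: "normed_space F" and car: "a \<in> carrier F" "b \<in> carrier F"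
  shows "vdist F (c \<odot>\<^bsub>F\<^esub> a) (c \<odot>\<^bsub>F\<^esub> b) = norm c * vdist F a b"
proof -
  interpret Module.module scalars F using F by (simp add: normed_space_def)
  have c: "c \<in> carrier scalars" by (simp add: scalars_def)
  have "(c \<odot>\<^bsub>F\<^esub> a) \<ominus>\<^bsub>F\<^esub> (c \<odot>\<^bsub>F\<^esub> b) = c \<odot>\<^bsub>F\<^esub> (a \<ominus>\<^bsub>F\<^esub> b)"
    using car c by (simp add: M.minus_eq smult_r_distr smult_r_minus)
  then show ?thesis
    using F car c by (simp add: vdist_def normed_space_def)
qed

lemma continuous_map_vtopology_iff:
  assumes F: "normed_space F" and car: "\<And>x. f x \<in> carrier F"
  shows "continuous_map euclidean (vtopology F) f \<longleftrightarrow>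
    (\<forall>x. \<forall>e>0. \<exists>U. open U \<and> x \<in> U \<and> (\<forall>y\<in>U. vdist F (f x) (f y) < e))"
proof -
  interpret Metric_space "carrier F" "vdist F" by (rule Metric_space_vdist[OF F])
  show ?thesis using car by (simp add: vtopology_def continuous_map_to_metric)
qed

lemma continuous_map_vtopology_add:
  assumes F: "normed_space F" and car: "\<And>x. f x \<in> carrier F" "\<And>x. g x \<in> carrier F"
    and cont: "continuous_map euclidean (vtopology F) f" "continuous_map euclidean (vtopology F) g"
  shows "continuous_map euclidean (vtopology F) (\<lambda>x. f x \<oplus>\<^bsub>F\<^esub> g x)"
proof -
  interpret Module.module scalars F using F by (simp add: normed_space_def)
  have "\<exists>U. open U \<and> x \<in> U \<and> (\<forall>y\<in>U. vdist F (f x \<oplus>\<^bsub>F\<^esub> g x) (f y \<oplus>\<^bsub>F\<^esub> g y) < e)" if e: "0 < e" for x e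
  proof -
    obtain U where U: "open U" "x \<in> U" "\<And>y. y \<in> U \<Longrightarrow> vdist F (f x) (f y) < e / 2"
      using cont(1)[unfolded continuous_map_vtopology_iff[OF F, of f, OF car(1)], rule_format, of "e / 2" x] e by auto
    obtain V where V: "open V" "x \<in> V" "\<And>y. y \<in> V \<Longrightarrow> vdist F (g x) (g y) < e / 2"
      using cont(2)[unfolded continuous_map_vtopology_iff[OF F, of g, OF car(2)], rule_format, of "e / 2" x] e by auto
    have "vdist F (f x \<oplus>\<^bsub>F\<^esub> g x) (f y \<oplus>\<^bsub>F\<^esub> g y) < e" if "y \<in> U \<inter> V" for y
      using vdist_add_le[OF F car(1) car(2) car(1) car(2), of x x y y] U(3)[of y] V(3)[of y] that by simp
    then show ?thesis using U V by (intro exI[of _ "U \<inter> V"]) auto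
  qed
  then show ?thesis using car by (subst continuous_map_vtopology_iff[OF F]) auto
qed

lemma continuous_map_vtopology_smult:
  assumes F: "normed_space F" and car: "\<And>x. f x \<in> carrier F"
    and cont: "continuous_map euclidean (vtopology F) f"
  shows "continuous_map euclidean (vtopology F) (\<lambda>x. c \<odot>\<^bsub>F\<^esub> f x)"
proof -
  interpret Module.module scalars F using F by (simp add: normed_space_def)
  have c: "c \<odot>\<^bsub>F\<^esub> f x \<in> carrier F" for x using car by (simp add: scalars_def)
  have "\<exists>U. open U \<and> x \<in> U \<and> (\<forall>y\<in>U. vdist F (c \<odot>\<^bsub>F\<^esub> f x) (c \<odot>\<^bsub>F\<^esub> f y) < e)" if e: "0 < e" for x e
  proof -
    have "0 < e / (norm c + 1)" using e by (intro divide_pos_pos add_nonneg_pos) auto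
    then obtain U where U: "open U" "x \<in> U" "\<And>y. y \<in> U \<Longrightarrow> vdist F (f x) (f y) < e / (norm c + 1)"
      using cont[unfolded continuous_map_vtopology_iff[OF F, of f, OF car], rule_format, of "e / (norm c + 1)" x] by auto
    have "norm c * vdist F (f x) (f y) < e" if "y \<in> U" for y
    proof -
      have "norm c * vdist F (f x) (f y) \<le> norm c * (e / (norm c + 1))"
        using U(3)[OF that] by (intro mult_left_mono) auto
      also have "\<dots> < e"
      proof -
        have "0 < norm c + 1" by (simp add: add_nonneg_pos)
        then show ?thesis using e by (simp add: pos_divide_less_eq algebra_simps)
      qed
      finally show ?thesis .
    qed
    then show ?thesis using U by (intro exI[of _ U]) (simp add: vdist_smult[OF F car car])
  qed
  then show ?thesis using c by (subst continuous_map_vtopology_iff[OF F]) auto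
qed

lemma normed_space_multilinear_space:
  fixes F :: "('k::real_or_complex,'f) nspace" and sE :: "'k \<Rightarrow> 'e::banach \<Rightarrow> 'e"
  assumes sE: "banach_scaling sE" and F: "normed_space F"
  shows "normed_space (multilinear_space n sE F)"
proof -
  interpret F: Module.module scalars F using F by (simp add: normed_space_def)
  let ?L = "multilinear_space n sE F"
  let ?C = "continuous_multilinear n sE F"
  have sc: "(c::'k) \<in> carrier scalars" for c by (simp add: scalars_def)
  have car: "A x \<in> carrier F" if "A \<in> ?C" for A x
    using that by (simp add: continuous_multilinear_def multilinear_def)
  have add_closed: "(\<lambda>x. A x \<oplus>\<^bsub>F\<^esub> B x) \<in> ?C"
    if A: "A \<in> ?C" and B: "B \<in> ?C" for A B
  proof -
    have "multilinear n sE F (\<lambda>x. A x \<oplus>\<^bsub>F\<^esub> B x)"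
      unfolding multilinear_def
    proof (intro conjI allI impI)
      fix x y :: "nat \<Rightarrow> 'e" assume "\<forall>i<n. x i = y i"
      then have "A x = A y" "B x = B y"
        using continuous_multilinearD(2)[OF A, of x y] continuous_multilinearD(2)[OF B, of x y] by simp_all
      then show "A x \<oplus>\<^bsub>F\<^esub> B x = A y \<oplus>\<^bsub>F\<^esub> B y" by simp
    next
      fix i and x :: "nat \<Rightarrow> 'e" and a b assume "i < n"
      then have "A (x(i := a + b)) = A (x(i := a)) \<oplus>\<^bsub>F\<^esub> A (x(i := b))"
        "B (x(i := a + b)) = B (x(i := a)) \<oplus>\<^bsub>F\<^esub> B (x(i := b))"
        by (simp_all add: continuous_multilinearD(3,4)[OF A] continuous_multilinearD(3,4)[OF B])
      then show "A (x(i := a + b)) \<oplus>\<^bsub>F\<^esub> B (x(i := a + b)) =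
          A (x(i := a)) \<oplus>\<^bsub>F\<^esub> B (x(i := a)) \<oplus>\<^bsub>F\<^esub> (A (x(i := b)) \<oplus>\<^bsub>F\<^esub> B (x(i := b)))"
        using car[OF A] car[OF B] by (simp add: F.M.a_ac)
    next
      fix i and x :: "nat \<Rightarrow> 'e" and c a assume "i < n"
      then have "A (x(i := sE c a)) = c \<odot>\<^bsub>F\<^esub> A (x(i := a))" "B (x(i := sE c a)) = c \<odot>\<^bsub>F\<^esub> B (x(i := a))"
        by (simp_all add: continuous_multilinearD(3,4)[OF A] continuous_multilinearD(3,4)[OF B])
      then show "A (x(i := sE c a)) \<oplus>\<^bsub>F\<^esub> B (x(i := sE c a)) = c \<odot>\<^bsub>F\<^esub> (A (x(i := a)) \<oplus>\<^bsub>F\<^esub> B (x(i := a)))"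
        using car[OF A] car[OF B] by (simp add: F.smult_r_distr sc)
    qed (use car A B in auto)
    then show ?thesis
      using A B car[OF A] car[OF B] continuous_map_vtopology_add[OF F, of A B]
      by (simp add: continuous_multilinear_def)
  qed
  have smult_closed: "(\<lambda>x. c \<odot>\<^bsub>F\<^esub> A x) \<in> ?C"
    if A: "A \<in> ?C" for A c
  proof -
    have "multilinear n sE F (\<lambda>x. c \<odot>\<^bsub>F\<^esub> A x)"
      unfolding multilinear_def
    proof (intro conjI allI impI)
      fix x y :: "nat \<Rightarrow> 'e" assume "\<forall>i<n. x i = y i"
      then have "A x = A y"
        using continuous_multilinearD(2)[OF A, of x y] by simp
      then show "c \<odot>\<^bsub>F\<^esub> A x = c \<odot>\<^bsub>F\<^esub> A y" by simp
    next
      fix i and x :: "nat \<Rightarrow> 'e" and a b assume "i < n"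
      then have "A (x(i := a + b)) = A (x(i := a)) \<oplus>\<^bsub>F\<^esub> A (x(i := b))"
        by (simp add: continuous_multilinearD(3,4)[OF A])
      then show "c \<odot>\<^bsub>F\<^esub> A (x(i := a + b)) = c \<odot>\<^bsub>F\<^esub> A (x(i := a)) \<oplus>\<^bsub>F\<^esub> c \<odot>\<^bsub>F\<^esub> A (x(i := b))"
        using car[OF A] by (simp add: F.smult_r_distr sc)
    next
      fix i and x :: "nat \<Rightarrow> 'e" and d a assume "i < n"
      then have "A (x(i := sE d a)) = d \<odot>\<^bsub>F\<^esub> A (x(i := a))"
        by (simp add: continuous_multilinearD(3,4)[OF A])
      moreover have "c \<odot>\<^bsub>F\<^esub> (d \<odot>\<^bsub>F\<^esub> A (x(i := a))) = d \<odot>\<^bsub>F\<^esub> (c \<odot>\<^bsub>F\<^esub> A (x(i := a)))"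
        using F.smult_assoc1[OF sc sc car[OF A], of c d "x(i := a)"] F.smult_assoc1[OF sc sc car[OF A], of d c "x(i := a)"]
        by (simp add: scalars_def mult.commute)
      ultimately show "c \<odot>\<^bsub>F\<^esub> A (x(i := sE d a)) = d \<odot>\<^bsub>F\<^esub> (c \<odot>\<^bsub>F\<^esub> A (x(i := a)))" by simp
    qed (use car A sc in auto)
    then show ?thesis
      using A car[OF A] continuous_map_vtopology_smult[OF F, of A c]
      by (simp add: continuous_multilinear_def)
  qed
  have zero_closed: "(\<lambda>x. \<zero>\<^bsub>F\<^esub>) \<in> ?C"
  proof -
    interpret Metric_space "carrier F" "vdist F" by (rule Metric_space_vdist[OF F])
    show ?thesis
      using F.smult_r_null[OF sc] by (simp add: continuous_multilinear_def multilinear_def vtopology_def)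
  qed
  have grp: "abelian_group ?L"
  proof (rule abelian_groupI)
    fix A assume "A \<in> carrier ?L"
    then have A: "A \<in> ?C" by simp
    have "(-1) \<odot>\<^bsub>F\<^esub> A x \<oplus>\<^bsub>F\<^esub> A x = \<zero>\<^bsub>F\<^esub>" for x
      using F.smult_l_distr[OF sc sc car[OF A], of "-1" 1 x] F.smult_one[OF car[OF A], of x]
        F.smult_l_null[OF car[OF A], of x] by (simp add: scalars_def)
    then show "\<exists>B\<in>carrier ?L. B \<oplus>\<^bsub>?L\<^esub> A = \<zero>\<^bsub>?L\<^esub>"
      using smult_closed[OF A, of "-1"] by (intro bexI[of _ "\<lambda>x. (-1) \<odot>\<^bsub>F\<^esub> A x"]) auto
  qed (use car in \<open>auto intro!: add_closed zero_closed simp: F.M.a_ac\<close>)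
  have mod: "Module.module scalars ?L"
  proof (rule moduleI[OF F.R.cring_axioms grp])
    fix a b :: 'k and A assume "A \<in> carrier ?L"
    then have A: "A \<in> ?C" by simp
    show "(a \<oplus>\<^bsub>scalars\<^esub> b) \<odot>\<^bsub>?L\<^esub> A = a \<odot>\<^bsub>?L\<^esub> A \<oplus>\<^bsub>?L\<^esub> b \<odot>\<^bsub>?L\<^esub> A"
      using F.smult_l_distr[OF sc sc car[OF A], of a b] by (simp add: fun_eq_iff)
    show "(a \<otimes>\<^bsub>scalars\<^esub> b) \<odot>\<^bsub>?L\<^esub> A = a \<odot>\<^bsub>?L\<^esub> (b \<odot>\<^bsub>?L\<^esub> A)"
      using F.smult_assoc1[OF sc sc car[OF A], of a b] by (simp add: fun_eq_iff)
    show "\<one>\<^bsub>scalars\<^esub> \<odot>\<^bsub>?L\<^esub> A = A"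
      using F.smult_one[OF car[OF A]] by (simp add: fun_eq_iff)
    fix B assume "B \<in> carrier ?L"
    then show "a \<odot>\<^bsub>?L\<^esub> (A \<oplus>\<^bsub>?L\<^esub> B) = a \<odot>\<^bsub>?L\<^esub> A \<oplus>\<^bsub>?L\<^esub> a \<odot>\<^bsub>?L\<^esub> B"
      using F.smult_r_distr[OF sc car[OF A] car[of B], of a] by (simp add: fun_eq_iff)
  qed (auto intro: smult_closed)
  show ?thesis
    unfolding normed_space_def
  proof (intro conjI ballI allI mod)
    fix A assume "A \<in> carrier ?L"
    then have A: "A \<in> ?C" by simp
    show "vnorm ?L (c \<odot>\<^bsub>?L\<^esub> A) = norm c * vnorm ?L A" for c
      by (rule vnorm_multilinear_space_smult[OF sE F A])
    show "vnorm ?L A = 0 \<longleftrightarrow> A = \<zero>\<^bsub>?L\<^esub>"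
    proof
      assume N0: "vnorm ?L A = 0"
      have "A x = \<zero>\<^bsub>F\<^esub>" for x
      proof -
        \<comment> \<open>A common factor that moves the first \<open>n\<close> coordinates of an
          arbitrary \<open>x\<close> into the unit box, where a vanishing norm gives
          information.\<close>
        define r where "r = 1 / (1 + (\<Sum>i<n. norm (x i)))"
        have S: "0 \<le> (\<Sum>i<n. norm (x i))" by (intro sum_nonneg) auto
        have r: "0 < r" using S by (simp add: r_def)
        have "norm (sE (of_real r) (x i)) \<le> 1" if "i < n" for i
        proof -
          have "norm (x i) \<le> (\<Sum>i<n. norm (x i))" using that by (intro member_le_sum) auto
          then have "r * norm (x i) \<le> 1" using S by (simp add: r_def)
          then show ?thesis using sE r by (simp add: banach_scaling_def)
        qed
        then have "vnorm F (A (\<lambda>i. sE (of_real r) (x i))) \<le> 0"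
          using vnorm_multilinear_space_ge[OF sE F A, of "\<lambda>i. sE (of_real r) (x i)"] N0 by simp
        moreover have "vnorm F (A (\<lambda>i. sE (of_real r) (x i))) = norm (of_real r :: 'k) ^ n * vnorm F (A x)"
          using A by (intro multilinear_vnorm_scale[OF F]) (simp add: continuous_multilinear_def)
        ultimately have "r ^ n * vnorm F (A x) \<le> 0" using r by simp
        then have "vnorm F (A x) \<le> 0"
          using zero_less_power[OF r, of n] by (simp add: mult_le_0_iff)
        then show ?thesis
          using vnorm_nonneg[OF F car[OF A], of x] vnorm_zero_iff[OF F car[OF A], of x] by simp
      qed
      then show "A = \<zero>\<^bsub>?L\<^esub>" by auto
    next
      assume "A = \<zero>\<^bsub>?L\<^esub>"
      then have "vnorm F (A x) = 0" for x
        using vnorm_zero_iff[OF F, of "\<zero>\<^bsub>F\<^esub>"] by simp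
      moreover have "(unit_box n :: (nat \<Rightarrow> 'e) set) \<noteq> {}"
        by (auto intro!: exI[of _ "\<lambda>_. 0"])
      ultimately show "vnorm ?L A = 0" by simp
    qed
    fix B assume "B \<in> carrier ?L"
    then have B: "B \<in> ?C" by simp
    have "(SUP x\<in>unit_box n. vnorm F (A x \<oplus>\<^bsub>F\<^esub> B x)) \<le> vnorm ?L A + vnorm ?L B"
    proof (rule cSUP_least)
      show "(unit_box n :: (nat \<Rightarrow> 'e) set) \<noteq> {}"
        by (auto intro!: exI[of _ "\<lambda>_. 0"])
      fix x :: "nat \<Rightarrow> 'e" assume x: "x \<in> unit_box n"
      have "vnorm F (A x \<oplus>\<^bsub>F\<^esub> B x) \<le> vnorm F (A x) + vnorm F (B x)"
        using F car[OF A] car[OF B] by (simp add: normed_space_def)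
      also have "\<dots> \<le> vnorm ?L A + vnorm ?L B"
        using x by (intro add_mono vnorm_multilinear_space_ge[OF sE F] A B) auto
      finally show "vnorm F (A x \<oplus>\<^bsub>F\<^esub> B x) \<le> vnorm ?L A + vnorm ?L B" .
    qed
    then show "vnorm ?L (A \<oplus>\<^bsub>?L\<^esub> B) \<le> vnorm ?L A + vnorm ?L B" by simp
  qed
qed

text \<open>Splitting off the variable j gives p1 + t * p2, so along the line x + t z in the
  variables of \<open>J\<close> the values form a polynomial in t, and its linear coefficient
  collects the terms with exactly one z. Over an infinite field this replaces a derivative: a
  polynomial that vanishes everywhere has vanishing coefficients.\<close>

lemma multiaffine_expansion:
  fixes B :: "(nat \<Rightarrow> 'e::ab_group_add) \<Rightarrow> 'k::field"
  assumes J: "finite J" "J \<subseteq> I"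
    and add: "\<And>i x a b. i \<in> I \<Longrightarrow> B (x(i := a + b)) = B (x(i := a)) + B (x(i := b))"
    and scale: "\<And>i x c a. i \<in> I \<Longrightarrow> B (x(i := s c a)) = c * B (x(i := a))"
  shows "\<exists>p. (\<forall>t. poly p t = B (\<lambda>i. if i \<in> J then x i + s t (z i) else x i)) \<and>
    coeff p 0 = B x \<and> coeff p 1 = (\<Sum>j\<in>J. B (x(j := z j)))"
  using J
proof (induction J arbitrary: x rule: finite_induct)
  case empty
  show ?case by (intro exI[of _ "[:B x:]"]) simp
next
  case (insert j J)
  obtain p1 where p1: "\<And>t. poly p1 t = B (\<lambda>i. if i \<in> J then x i + s t (z i) else x i)"
    "coeff p1 0 = B x" "coeff p1 1 = (\<Sum>j\<in>J. B (x(j := z j)))"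
    using insert.IH[of x] insert.prems by blast
  let ?x = "x(j := z j)"
  obtain p2 where p2: "\<And>t. poly p2 t = B (\<lambda>i. if i \<in> J then ?x i + s t (z i) else ?x i)"
    "coeff p2 0 = B ?x"
    using insert.IH[of ?x] insert.prems by blast
  show ?case
  proof (intro exI[of _ "p1 + pCons 0 p2"] conjI allI)
    fix t
    let ?y = "\<lambda>i. if i \<in> J then x i + s t (z i) else x i"
    have "(\<lambda>i. if i \<in> insert j J then x i + s t (z i) else x i) = ?y(j := x j + s t (z j))"
      by auto
    moreover have "?y(j := x j) = ?y" using insert.hyps by auto
    moreover have "?y(j := z j) = (\<lambda>i. if i \<in> J then ?x i + s t (z i) else ?x i)"
      using insert.hyps by auto
    ultimately have "B (\<lambda>i. if i \<in> insert j J then x i + s t (z i) else x i) = poly p1 t + t * poly p2 t"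
      using add[of j ?y "x j" "s t (z j)"] scale[of j ?y t "z j"] insert.prems by (simp add: p1 p2)
    then show "poly (p1 + pCons 0 p2) t = B (\<lambda>i. if i \<in> insert j J then x i + s t (z i) else x i)"
      by simp
  next
    show "coeff (p1 + pCons 0 p2) 0 = B x" using p1 by simp
    show "coeff (p1 + pCons 0 p2) 1 = (\<Sum>j\<in>insert j J. B (x(j := z j)))"
      using insert.hyps p1(3) p2(2) by simp
  qed
qed

text \<open>Freeing one variable at a time: if \<open>B\<close> vanishes whenever the arguments from \<open>k\<close> on agree,
  so does the linear coefficient of \<open>t \<mapsto> B (\<dots>, x + t z, \<dots>, x + t z)\<close>, which by symmetry is
  \<open>n - k\<close> times the value with \<open>z\<close> in position \<open>k\<close>.\<close>

lemma symmetric_multilinear_eq_zero: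
  fixes B :: "(nat \<Rightarrow> 'e::ab_group_add) \<Rightarrow> 'k::field_char_0"
  assumes dep: "\<And>x y. (\<And>i. i < n \<Longrightarrow> x i = y i) \<Longrightarrow> B x = B y"
    and add: "\<And>i x a b. i < n \<Longrightarrow> B (x(i := a + b)) = B (x(i := a)) + B (x(i := b))"
    and scale: "\<And>i x c a. i < n \<Longrightarrow> B (x(i := s c a)) = c * B (x(i := a))"
    and sym: "\<And>\<pi> x. \<pi> permutes {..<n} \<Longrightarrow> B (x \<circ> \<pi>) = B x"
    and diag: "\<And>x. B (\<lambda>_. x) = 0"
  shows "B x = 0"
proof -
  have "B (\<lambda>i. if i < k then y i else x) = 0" if "k \<le> n" for k y x
    using that
  proof (induction k arbitrary: y x)
    case 0
    then show ?case using diag by simp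
  next
    case (Suc k)
    define w where "w i = (if i < k then y i else x)" for i
    define z where "z = y k"
    have sub: "{k..<n} \<subseteq> {..<n}" by auto
    obtain p where p: "\<And>t. poly p t = B (\<lambda>i. if i \<in> {k..<n} then w i + s t z else w i)"
      and c1: "coeff p 1 = (\<Sum>j\<in>{k..<n}. B (w(j := z)))"
      using multiaffine_expansion[OF _ sub, of B s w "\<lambda>_. z"] add scale by auto
    \<comment> \<open>For each t the arguments from \<open>k\<close> on agree again, their common
      value being \<open>x + s t z\<close>, so the induction hypothesis applies.\<close>
    have "poly p t = 0" for t
    proof -
      have "poly p t = B (\<lambda>i. if i < k then y i else x + s t z)"
        unfolding p by (intro dep) (auto simp: w_def)
      then show ?thesis using Suc by simp
    qed
    then have p0: "p = 0" using poly_all_0_iff_0 by blast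
    have eqj: "B (w(j := z)) = B (w(k := z))" if "j \<in> {k..<n}" for j
    proof -
      have "w(j := z) = w(k := z) \<circ> Transposition.transpose j k"
        using that by (auto simp: fun_eq_iff w_def Transposition.transpose_def)
      moreover have "Transposition.transpose j k permutes {..<n}"
        using that by (intro permutes_swap_id) auto
      ultimately show ?thesis using sym by metis
    qed
    have "coeff p 1 = (\<Sum>j\<in>{k..<n}. B (w(k := z)))"
      unfolding c1 by (intro sum.cong refl eqj)
    then have "of_nat (n - k) * B (w(k := z)) = 0" using p0 by simp
    then have "B (w(k := z)) = 0" using Suc.prems by simp
    moreover have "w(k := z) = (\<lambda>i. if i < Suc k then y i else x)"
      by (auto simp: w_def z_def less_Suc_eq)
    ultimately show ?case by simp
  qed
  from this[of n x] have "B (\<lambda>i. if i < n then x i else undefined) = 0" by simp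
  moreover have "B (\<lambda>i. if i < n then x i else undefined) = B x" by (rule dep) simp
  ultimately show ?thesis by simp
qed

section \<open>The sequence spaces\<close>

text \<open>For positive arguments this is convexity of the power function; the cases with a zero
  rest on m powr q \<le> m for m between 0 and 1.\<close>

lemma powr_convex_combination:
  fixes x y l q :: real
  assumes "0 \<le> x" "0 \<le> y" "0 < l" "l < 1" and q: "1 \<le> q"
  shows "(l * x + (1 - l) * y) powr q \<le> l * x powr q + (1 - l) * y powr q"
proof -
  have le: "m powr q \<le> m" if "0 < m" "m < 1" for m :: real
    using powr_mono'[of 1 q m] that q by simp
  consider "x = 0" | "y = 0" | "0 < x" "0 < y" using assms by fastforce
  then show ?thesis
  proof cases
    case 1
    then show ?thesis using le[of "1 - l"] assms by (simp add: powr_mult mult_right_mono)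
  next
    case 2
    then show ?thesis using le[of l] assms by (simp add: powr_mult mult_right_mono)
  next
    case 3
    then show ?thesis
      using convex_onD[OF powr_convex[OF q], of "1 - l" x y] assms by simp
  qed
qed

definition lq_norm :: "real \<Rightarrow> (nat \<Rightarrow> 'k::real_normed_field) \<Rightarrow> real" where
  "lq_norm q a = (\<Sum>i. norm (a i) powr q) powr (1 / q)"

definition lq :: "real \<Rightarrow> (nat \<Rightarrow> 'k::real_normed_field) set" where
  "lq q = {a. summable (\<lambda>i. norm (a i) powr q)}"

lemma lq_norm_nonneg: "0 \<le> lq_norm q a"
  by (simp add: lq_norm_def)

lemma lq_norm_powr:
  assumes "a \<in> lq q" "0 < q"
  shows "lq_norm q a powr q = (\<Sum>i. norm (a i) powr q)"
  using assms suminf_nonneg[of "\<lambda>i. norm (a i) powr q"]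
  by (simp add: lq_norm_def lq_def powr_powr)

lemma lq_norm_le:
  assumes q: "0 < q" and s: "0 \<le> s" and le: "\<And>M. (\<Sum>i<M. norm (a i) powr q) \<le> s powr q"
  shows "a \<in> lq q" "lq_norm q a \<le> s"
proof -
  have sm: "summable (\<lambda>i. norm (a i) powr q)"
    using le by (intro summableI_nonneg_bounded) auto
  then show "a \<in> lq q" by (simp add: lq_def)
  have "(\<Sum>i. norm (a i) powr q) \<le> s powr q" by (rule suminf_le_const[OF sm le])
  then have "lq_norm q a \<le> (s powr q) powr (1 / q)"
    unfolding lq_norm_def using q sm by (intro powr_mono2 suminf_nonneg) auto
  then show "lq_norm q a \<le> s" using q s by (simp add: powr_powr)
qed

lemma lq_partial_le:
  assumes "a \<in> lq q" "0 < q"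
  shows "(\<Sum>i<M. norm (a i) powr q) \<le> lq_norm q a powr q"
  using assms sum_le_suminf[of "\<lambda>i. norm (a i) powr q" "{..<M}"]
  by (simp add: lq_norm_powr lq_def)

lemma lq_coord_le:
  assumes a: "a \<in> lq q" and q: "0 < q"
  shows "norm (a i) \<le> lq_norm q a"
proof -
  have "(\<Sum>j\<in>{i}. norm (a j) powr q) \<le> lq_norm q a powr q"
    using a q sum_le_suminf[of "\<lambda>i. norm (a i) powr q" "{i}"] by (simp add: lq_norm_powr lq_def)
  then show ?thesis
    using powr_less_mono2[of q "lq_norm q a" "norm (a i)"] q lq_norm_nonneg[of q a] by fastforce
qed

text \<open>Minkowski's inequality: with l = s / (s + t), the sum a + b is s + t times a convex
  combination of a / s and b / t, and convexity applies in each coordinate. Taking \<open>s\<close>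
  and \<open>t\<close> strictly above the norms keeps the divisors positive.\<close>

lemma lq_add:
  assumes q: "1 \<le> q" and a: "a \<in> lq q" and b: "b \<in> lq q"
  shows "(\<lambda>i. a i + b i) \<in> lq q" "lq_norm q (\<lambda>i. a i + b i) \<le> lq_norm q a + lq_norm q b"
proof -
  have q0: "0 < q" using q by simp
  have main: "(\<Sum>i<M. norm (a i + b i) powr q) \<le> (s + t) powr q"
    if s: "lq_norm q a < s" and t: "lq_norm q b < t" for s t M
  proof -
    have st: "0 < s" "0 < t" using s t lq_norm_nonneg by (smt (verit))+
    define l where "l = s / (s + t)"
    have l: "0 < l" "l < 1" "1 - l = t / (s + t)" using st by (auto simp: l_def field_simps)
    let ?c = "\<lambda>i. l * ((norm (a i) / s) powr q) + (1 - l) * ((norm (b i) / t) powr q)"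
    have one: "norm (a i + b i) powr q \<le>
        (s + t) powr q * ?c i" for i
    proof -
      have "norm (a i) = (s + t) * (l * (norm (a i) / s))" "norm (b i) = (s + t) * ((1 - l) * (norm (b i) / t))"
        unfolding l(3) using st by (auto simp: l_def)
      then have "norm (a i + b i) \<le> (s + t) * (l * (norm (a i) / s) + (1 - l) * (norm (b i) / t))"
        using norm_triangle_ineq[of "a i" "b i"] by (simp only: distrib_left)
      then have "norm (a i + b i) powr q \<le> ((s + t) * (l * (norm (a i) / s) + (1 - l) * (norm (b i) / t))) powr q"
        using q by (intro powr_mono2) auto
      also have "\<dots> = (s + t) powr q * (l * (norm (a i) / s) + (1 - l) * (norm (b i) / t)) powr q"
        by (rule powr_mult)
      also have "\<dots> \<le> (s + t) powr q * ?c i"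
        using st l q by (intro mult_left_mono powr_convex_combination) auto
      finally show ?thesis .
    qed
    have part: "(\<Sum>i<M. (norm (c i) / r) powr q) \<le> 1" if "lq_norm q c < r" "c \<in> lq q" for c :: "nat \<Rightarrow> 'a" and r
    proof -
      have r: "0 < r" using that lq_norm_nonneg[of q c] by simp
      have "(\<Sum>i<M. norm (c i) powr q) \<le> r powr q"
        using lq_partial_le[OF that(2) q0, of M] powr_mono2[of q "lq_norm q c" r] that(1) q lq_norm_nonneg[of q c]
        by simp
      then show ?thesis using r by (simp add: powr_divide flip: sum_divide_distrib)
    qed
    have "(\<Sum>i<M. norm (a i + b i) powr q) \<le> (\<Sum>i<M. (s + t) powr q * ?c i)"
      by (intro sum_mono one)
    also have "\<dots> = (s + t) powr q * (l * (\<Sum>i<M. (norm (a i) / s) powr q) + (1 - l) * (\<Sum>i<M. (norm (b i) / t) powr q))"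
      by (simp only: sum_distrib_left[symmetric] sum.distrib)
    also have "\<dots> \<le> (s + t) powr q * (l * 1 + (1 - l) * 1)"
      using l part[OF s a] part[OF t b] by (intro mult_left_mono add_mono) auto
    finally show ?thesis by simp
  qed
  show "(\<lambda>i. a i + b i) \<in> lq q"
    using main[of "lq_norm q a + 1" "lq_norm q b + 1"] lq_norm_nonneg[of q a] lq_norm_nonneg[of q b] q0
    by (intro lq_norm_le(1)[of q "lq_norm q a + 1 + (lq_norm q b + 1)"]) auto
  show "lq_norm q (\<lambda>i. a i + b i) \<le> lq_norm q a + lq_norm q b"
  proof (rule field_le_epsilon)
    fix e :: real assume e: "0 < e"
    show "lq_norm q (\<lambda>i. a i + b i) \<le> lq_norm q a + lq_norm q b + e"
      using main[of "lq_norm q a + e / 2" "lq_norm q b + e / 2"] e lq_norm_nonneg[of q a] lq_norm_nonneg[of q b] q0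
      by (intro lq_norm_le(2)) (auto simp: algebra_simps)
  qed
qed

lemma lq_scale:
  assumes q: "0 < q" and a: "a \<in> lq q"
  shows "(\<lambda>i. c * a i) \<in> lq q" "lq_norm q (\<lambda>i. c * a i) = norm c * lq_norm q a"
proof -
  have sm: "summable (\<lambda>i. norm (a i) powr q)" using a by (simp add: lq_def)
  have eq: "norm (c * a i) powr q = norm c powr q * norm (a i) powr q" for i
    by (simp add: norm_mult powr_mult)
  show "(\<lambda>i. c * a i) \<in> lq q" using sm by (auto simp: lq_def eq intro: summable_mult)
  show "lq_norm q (\<lambda>i. c * a i) = norm c * lq_norm q a"
    unfolding lq_norm_def eq using q suminf_nonneg[OF sm]
    by (simp add: suminf_mult[OF sm] powr_mult powr_powr)
qed

lemma lq_zero: "(\<lambda>_. 0) \<in> lq q" "lq_norm q (\<lambda>_. 0) = 0"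
  by (simp_all add: lq_def lq_norm_def)

lemma lq_norm_eq_0:
  assumes "a \<in> lq q" "0 < q" "lq_norm q a = 0"
  shows "a = (\<lambda>_. 0)"
  using lq_coord_le[OF assms(1,2)] assms(3) by (simp add: fun_eq_iff)

lemma lq_sum:
  assumes q: "1 \<le> q" and J: "finite J" and a: "\<And>j. j \<in> J \<Longrightarrow> a j \<in> lq q"
  shows "(\<lambda>i. \<Sum>j\<in>J. a j i) \<in> lq q \<and> lq_norm q (\<lambda>i. \<Sum>j\<in>J. a j i) \<le> (\<Sum>j\<in>J. lq_norm q (a j))"
  using J a
proof (induction J rule: finite_induct)
  case (insert j J)
  then have IH: "(\<lambda>i. \<Sum>j\<in>J. a j i) \<in> lq q" "lq_norm q (\<lambda>i. \<Sum>j\<in>J. a j i) \<le> (\<Sum>j\<in>J. lq_norm q (a j))"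
    by auto
  show ?case
    using lq_add[OF q insert.prems[of j] IH(1)] IH(2) insert.hyps by simp
qed (simp add: lq_zero)

text \<open>Sequences are placed in the second summand of the universe, so that for every
  \<open>'u\<close> the space is a legitimate range in the hypothesis.\<close>

definition lq_space :: "real \<Rightarrow> ('k::real_or_complex, ('k, 'u) universe) nspace" where
  "lq_space q =
     \<lparr>carrier = Inr ` lq q, monoid.mult = undefined, one = undefined,
      ring.zero = Inr (\<lambda>_. 0), add = (\<lambda>x y. Inr (\<lambda>i. projr x i + projr y i)),
      smult = (\<lambda>c x. Inr (\<lambda>i. c * projr x i)),
      vnorm = (\<lambda>x. lq_norm q (projr x))\<rparr>"

lemma lq_space_simps [simp]:
  "carrier (lq_space q) = Inr ` lq q"
  "\<zero>\<^bsub>lq_space q\<^esub> = Inr (\<lambda>_. 0)"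
  "x \<oplus>\<^bsub>lq_space q\<^esub> y = Inr (\<lambda>i. projr x i + projr y i)"
  "c \<odot>\<^bsub>lq_space q\<^esub> x = Inr (\<lambda>i. c * projr x i)"
  "vnorm (lq_space q) x = lq_norm q (projr x)"
  by (simp_all add: lq_space_def)

lemma cring_scalars: "cring (scalars :: 'k::real_or_complex ring)"
proof (rule cringI)
  show "abelian_group (scalars :: 'k ring)"
    by (rule abelian_groupI) (auto simp: scalars_def algebra_simps intro: exI[of _ "- _"])
  show "comm_monoid (scalars :: 'k ring)"
    by (rule comm_monoidI) (auto simp: scalars_def algebra_simps)
qed (auto simp: scalars_def algebra_simps)

lemma abelian_group_lq_space:
  assumes q: "1 \<le> q"
  shows "abelian_group (lq_space q :: ('k::real_or_complex, ('k, 'u) universe) nspace)"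
proof (rule abelian_groupI)
  fix x assume "x \<in> carrier (lq_space q :: ('k, ('k, 'u) universe) nspace)"
  then obtain a where a: "x = Inr a" "a \<in> lq q" by auto
  have "(\<lambda>i. - a i) \<in> lq q" using lq_scale(1)[of q a "-1"] a q by simp
  then show "\<exists>y\<in>carrier (lq_space q :: ('k, ('k, 'u) universe) nspace). y \<oplus>\<^bsub>lq_space q\<^esub> x = \<zero>\<^bsub>lq_space q\<^esub>"
    using a by (intro bexI[of _ "Inr (\<lambda>i. - a i)"]) auto
qed (use q in \<open>auto simp: add_ac lq_zero intro!: lq_add\<close>)

lemma normed_space_lq_space:
  assumes q: "1 \<le> q"
  shows "normed_space (lq_space q :: ('k::real_or_complex, ('k, 'u) universe) nspace)"
  unfolding normed_space_def
proof (intro conjI ballI allI)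
  show "Module.module scalars (lq_space q :: ('k, ('k, 'u) universe) nspace)"
    by (rule moduleI[OF cring_scalars abelian_group_lq_space[OF q]])
      (use q in \<open>auto simp: scalars_def algebra_simps intro!: lq_scale\<close>)
next
  fix x assume "x \<in> carrier (lq_space q :: ('k, ('k, 'u) universe) nspace)"
  then obtain a where a: "x = Inr a" "a \<in> lq q" by auto
  show "vnorm (lq_space q) x = 0 \<longleftrightarrow> x = \<zero>\<^bsub>lq_space q\<^esub>"
    using a q lq_norm_eq_0[of a q] by (auto simp: lq_zero)
  show "vnorm (lq_space q) (c \<odot>\<^bsub>lq_space q\<^esub> x) = norm c * vnorm (lq_space q) x" for c
    using a q by (simp add: lq_scale)
  fix y assume "y \<in> carrier (lq_space q :: ('k, ('k, 'u) universe) nspace)"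
  then show "vnorm (lq_space q) (x \<oplus>\<^bsub>lq_space q\<^esub> y) \<le> vnorm (lq_space q) x + vnorm (lq_space q) y"
    using a q by (auto intro: lq_add)
qed

lemma vdist_lq_space:
  assumes q: "1 \<le> q" and "a \<in> lq q" "b \<in> lq q"
  shows "vdist (lq_space q :: ('k::real_or_complex, ('k, 'u) universe) nspace) (Inr a) (Inr b) =
    lq_norm q (\<lambda>i. a i - b i)"
proof -
  interpret abelian_group "lq_space q :: ('k, ('k, 'u) universe) nspace"
    by (rule abelian_group_lq_space[OF q])
  have "(\<lambda>i. - b i) \<in> lq q" using lq_scale(1)[of q b "-1"] assms by simp
  then have "\<ominus>\<^bsub>lq_space q\<^esub> (Inr b) = (Inr (\<lambda>i. - b i) :: ('k, 'u) universe)"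
    using assms by (intro minus_equality) auto
  then show ?thesis using assms by (simp add: vdist_def minus_eq)
qed

lemma lq_diff:
  assumes q: "1 \<le> q" and "a \<in> lq q" "b \<in> lq q"
  shows "(\<lambda>i. a i - b i) \<in> lq q"
  using lq_add(1)[OF q assms(2) lq_scale(1)[of q b "-1"]] assms by simp

lemma banach_space_lq_space:
  assumes q: "1 \<le> q"
    and complete: "\<And>X :: nat \<Rightarrow> 'k. Cauchy X \<Longrightarrow> convergent X"
  shows "banach_space (lq_space q :: ('k::real_or_complex, ('k, 'u) universe) nspace)"
  unfolding banach_space_def
proof (rule conjI[OF normed_space_lq_space[OF q]])
  let ?F = "lq_space q :: ('k, ('k, 'u) universe) nspace"
  have q0: "0 < q" using q by simp
  interpret Metric_space "carrier ?F" "vdist ?F"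
    by (rule Metric_space_vdist[OF normed_space_lq_space[OF q]])
  show mcomplete
    unfolding mcomplete_def
  proof (intro allI impI)
    fix \<sigma> assume \<sigma>: "MCauchy \<sigma>"
    then have "\<sigma> n \<in> carrier ?F" for n unfolding MCauchy_def by blast
    then have "\<forall>n. \<exists>a. \<sigma> n = Inr a \<and> a \<in> lq q" by auto
    then obtain a where a: "\<And>n. \<sigma> n = Inr (a n)" "\<And>n. a n \<in> lq q"
      unfolding choice_iff by blast
    have cauchy: "\<exists>N. \<forall>n\<ge>N. \<forall>m\<ge>N. lq_norm q (\<lambda>i. a n i - a m i) < e" if e: "0 < e" for e
    proof -
      obtain N where "\<forall>n n'. N \<le> n \<longrightarrow> N \<le> n' \<longrightarrow> vdist ?F (\<sigma> n) (\<sigma> n') < e"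
        using conjunct2[OF \<sigma>[unfolded MCauchy_def], rule_format, OF e] by auto
      moreover have "vdist ?F (\<sigma> n) (\<sigma> m) = lq_norm q (\<lambda>i. a n i - a m i)" for n m
        unfolding a(1) by (rule vdist_lq_space[OF q a(2) a(2)])
      ultimately show ?thesis by (intro exI[of _ N]) simp
    qed
    have "convergent (\<lambda>n. a n i)" for i
    proof (rule complete, rule CauchyI)
      fix e :: real assume "0 < e"
      then obtain N where N: "\<forall>n\<ge>N. \<forall>m\<ge>N. lq_norm q (\<lambda>i. a n i - a m i) < e" using cauchy by blast
      show "\<exists>M. \<forall>m\<ge>M. \<forall>n\<ge>M. norm (a m i - a n i) < e"
      proof (intro exI[of _ N] allI impI)
        fix m n assume "N \<le> m" "N \<le> n"
        then show "norm (a m i - a n i) < e"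
          using lq_coord_le[OF lq_diff[OF q a(2)[of m] a(2)[of n]] q0, of i] N by (meson le_less_trans)
      qed
    qed
    then obtain l where l: "\<And>i. (\<lambda>n. a n i) \<longlonglongrightarrow> l i" unfolding convergent_def by metis
    \<comment> \<open>The bound on each finite partial sum survives the limit in the second index,
      which turns coordinatewise convergence into convergence in norm.\<close>
    have close: "\<exists>N. \<forall>n\<ge>N. (\<lambda>i. a n i - l i) \<in> lq q \<and> lq_norm q (\<lambda>i. a n i - l i) \<le> e" if e: "0 < e" for e
    proof -
      obtain N where N: "\<forall>n\<ge>N. \<forall>m\<ge>N. lq_norm q (\<lambda>i. a n i - a m i) < e" using cauchy e by blast
      have "(\<Sum>i<M. norm (a n i - l i) powr q) \<le> e powr q" if n: "N \<le> n" for n M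
      proof (rule LIMSEQ_le_const2)
        show "(\<lambda>m. \<Sum>i<M. norm (a n i - a m i) powr q) \<longlonglongrightarrow> (\<Sum>i<M. norm (a n i - l i) powr q)"
          using q0 by (intro tendsto_intros tendsto_powr' l) auto
        show "\<exists>K. \<forall>m\<ge>K. (\<Sum>i<M. norm (a n i - a m i) powr q) \<le> e powr q"
        proof (intro exI[of _ N] allI impI)
          fix m assume m: "N \<le> m"
          have "(\<Sum>i<M. norm (a n i - a m i) powr q) \<le> lq_norm q (\<lambda>i. a n i - a m i) powr q"
            using lq_partial_le[OF lq_diff[OF q a(2)[of n] a(2)[of m]] q0, of M] .
          also have "\<dots> \<le> e powr q"
            using N n m q0 lq_norm_nonneg by (intro powr_mono2) (auto intro: less_imp_le)
          finally show "(\<Sum>i<M. norm (a n i - a m i) powr q) \<le> e powr q" .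
        qed
      qed
      then show ?thesis using e q0 by (intro exI[of _ N]) (auto intro!: lq_norm_le[of q e])
    qed
    obtain N where "\<forall>n\<ge>N. (\<lambda>i. a n i - l i) \<in> lq q" using close[of 1] by auto
    then have lq: "l \<in> lq q"
      using lq_diff[OF q a(2)[of N], of "\<lambda>i. a N i - l i"] by simp
    have "limitin mtopology \<sigma> (Inr l) sequentially"
      unfolding limit_metric_sequentially
    proof (intro conjI allI impI)
      show "Inr l \<in> carrier ?F" using lq by simp
      fix e :: real assume e: "0 < e"
      then obtain N where "\<forall>n\<ge>N. lq_norm q (\<lambda>i. a n i - l i) \<le> e / 2" using close[of "e / 2"] by auto
      then show "\<exists>N. \<forall>n\<ge>N. \<sigma> n \<in> carrier ?F \<and> vdist ?F (\<sigma> n) (Inr l) < e"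
        using a lq e by (intro exI[of _ N]) (force simp: vdist_lq_space[OF q])
    qed
    then show "\<exists>x. limitin mtopology \<sigma> x sequentially" by blast
  qed
qed

section \<open>Test polynomials\<close>

text \<open>\<open>A\<close> is the symmetric multilinear mapping of \<open>P x = \<phi> x ^ (n - 1) *\<^sub>R u x\<close>, and \<open>Ac\<close> its sequence of
  coordinates. The parameter \<open>U\<close> only fixes the universe.\<close>

locale test_polynomial = scaled_banach sE
  for sE :: "'k::real_or_complex \<Rightarrow> 'e::banach \<Rightarrow> 'e" +
  fixes q :: real and n :: nat and w :: "nat \<Rightarrow> real" and \<psi> :: "nat \<Rightarrow> 'e \<Rightarrow> 'k"
    and \<phi> :: "'e \<Rightarrow> 'k" and x0 :: 'e
    and U :: "'u itself"
  assumes q: "1 \<le> q" and n: "1 \<le> n"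
    and w: "\<And>i. 0 \<le> w i" "\<And>I. finite I \<Longrightarrow> sum w I \<le> 1"
    and \<psi>: "\<And>i. \<psi> i \<in> dual_ball sE" and \<phi>: "\<phi> \<in> dual_ball sE" and x0: "\<phi> x0 = 1"
begin

lemma q0: "0 < q" using q by simp

definition u :: "'e \<Rightarrow> nat \<Rightarrow> 'k" where
  "u a = (\<lambda>l. of_real (w l powr (1 / q)) * \<psi> l a)"

text \<open>The q-moment of the discrete measure with mass \<open>w l\<close> at
  \<open>\<psi> l\<close>, which is the q-th power of the norm of \<open>u a\<close>.\<close>

definition h :: "'e \<Rightarrow> real" where
  "h a = (\<Sum>l. w l * norm (\<psi> l a) powr q)"

definition cf :: "nat \<Rightarrow> (nat \<Rightarrow> 'e) \<Rightarrow> 'k" where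
  "cf i x = (\<Prod>j\<in>{..<n} - {i}. \<phi> (x j))"

text \<open>All factors but one are \<phi>, so symmetrizing amounts to averaging over the
  \<open>n\<close> choices of the argument that enters \<open>u\<close>.\<close>

definition Ac :: "(nat \<Rightarrow> 'e) \<Rightarrow> nat \<Rightarrow> 'k" where
  "Ac x = (\<lambda>l. inverse (of_nat n) * (\<Sum>i<n. cf i x * u (x i) l))"

definition A :: "(nat \<Rightarrow> 'e) \<Rightarrow> ('k, 'u) universe" where
  "A x = Inr (Ac x)"

definition P :: "'e \<Rightarrow> ('k, 'u) universe" where
  "P x = A (\<lambda>_. x)"

lemma \<psi>_add: "\<psi> l (a + b) = \<psi> l a + \<psi> l b" and \<psi>_scale: "\<psi> l (sE c a) = c * \<psi> l a"
  using \<psi>[of l] by (simp_all add: mem_dual_ball_iff)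

lemma \<phi>_add: "\<phi> (a + b) = \<phi> a + \<phi> b" and \<phi>_scale: "\<phi> (sE c a) = c * \<phi> a"
  and \<phi>_le: "norm (\<phi> a) \<le> norm a"
  using \<phi> by (simp_all add: mem_dual_ball_iff)

lemma u_add: "u (a + b) l = u a l + u b l" and u_scale: "u (sE c a) l = c * u a l"
  by (simp_all add: u_def \<psi>_add \<psi>_scale algebra_simps)

lemma u_powr: "norm (u a l) powr q = w l * norm (\<psi> l a) powr q"
  using w(1)[of l] q0 by (simp add: u_def norm_mult powr_mult powr_powr)

lemma u_partial: "(\<Sum>l<M. norm (u a l) powr q) \<le> norm a powr q"
  unfolding u_powr by (rule weighted_functionals_le[OF q0 w \<psi>])

lemma u_lq: "u a \<in> lq q" and u_norm_le: "lq_norm q (u a) \<le> norm a"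
  using lq_norm_le[OF q0 norm_ge_zero u_partial] by auto

lemma u_norm_powr: "lq_norm q (u a) powr q = h a"
  using lq_norm_powr[OF u_lq q0] by (simp add: u_powr h_def)

lemma h_nonneg: "0 \<le> h a" by (metis u_norm_powr powr_ge_zero)

lemma h_summable: "summable (\<lambda>l. w l * norm (\<psi> l a) powr q)"
  using u_lq[of a] by (simp add: lq_def u_powr)

lemma h_powr: "h a powr (r / q) = lq_norm q (u a) powr r"
  using q0 by (simp add: powr_powr flip: u_norm_powr)

lemma h_dominated: "dual_dominated q h"
proof (rule dual_dominated_suminf[where h = "\<lambda>l x. norm (\<psi> l x) powr q" and w = w and I = "\<lambda>N. {..<N}"])
  show "(\<lambda>N. \<Sum>l\<in>{..<N}. w l * norm (\<psi> l x) powr q) \<longlonglongrightarrow> h x" for x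
    unfolding h_def by (rule summable_LIMSEQ[OF h_summable])
qed (use w dual_dominated_functional[OF \<psi>] in auto)

lemma u_triangle: "lq_norm q (u a) \<le> lq_norm q (u (a + b)) + lq_norm q (u b)"
proof -
  have "u a = (\<lambda>l. u (a + b) l + (- 1) * u b l)" by (simp add: u_add fun_eq_iff)
  then have "lq_norm q (u a) \<le> lq_norm q (u (a + b)) + lq_norm q (\<lambda>l. (- 1) * u b l)"
    using lq_add(2)[OF q u_lq lq_scale(1)[OF q0 u_lq]] by metis
  then show ?thesis using lq_scale(2)[OF q0 u_lq, of "-1" b] by simp
qed

lemma cf_cong: "(\<And>j. j < n \<Longrightarrow> x j = y j) \<Longrightarrow> cf i x = cf i y"
  unfolding cf_def by (rule prod.cong) auto

lemma cf_upd_same: "cf i (x(i := a)) = cf i x"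
  unfolding cf_def by (rule prod.cong) auto

lemma cf_upd_other: "i < n \<Longrightarrow> k \<noteq> i \<Longrightarrow>
  cf k (x(i := a)) = \<phi> a * (\<Prod>j\<in>{..<n} - {k} - {i}. \<phi> (x j))"
  unfolding cf_def by (subst prod.remove[of _ i]) (auto intro!: prod.cong)

lemma summand_add: "i < n \<Longrightarrow> cf k (x(i := a + b)) * u ((x(i := a + b)) k) l =
   cf k (x(i := a)) * u ((x(i := a)) k) l + cf k (x(i := b)) * u ((x(i := b)) k) l"
  by (cases "k = i") (simp_all add: cf_upd_same cf_upd_other u_add \<phi>_add algebra_simps)

lemma summand_scale: "i < n \<Longrightarrow> cf k (x(i := sE c a)) * u ((x(i := sE c a)) k) l =
   c * (cf k (x(i := a)) * u ((x(i := a)) k) l)"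
  by (cases "k = i") (simp_all add: cf_upd_same cf_upd_other u_scale \<phi>_scale)

lemma Ac_add: "i < n \<Longrightarrow> Ac (x(i := a + b)) l = Ac (x(i := a)) l + Ac (x(i := b)) l"
  unfolding Ac_def summand_add sum.distrib distrib_left ..

lemma Ac_scale: "i < n \<Longrightarrow> Ac (x(i := sE c a)) l = c * Ac (x(i := a)) l"
  unfolding Ac_def summand_scale sum_distrib_left[symmetric] by (simp only: mult.left_commute)

lemma Ac_cong: "(\<And>j. j < n \<Longrightarrow> x j = y j) \<Longrightarrow> Ac x = Ac y"
  unfolding Ac_def using cf_cong[of x y] by (auto simp: fun_eq_iff intro!: sum.cong)

lemma Ac_lq: "Ac x \<in> lq q"
  unfolding Ac_def
  by (rule lq_scale(1)[OF q0 conjunct1[OF lq_sum[OF q finite_lessThan lq_scale(1)[OF q0 u_lq]]]])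

lemma Ac_permute:
  assumes \<pi>: "\<pi> permutes {..<n}"
  shows "Ac (x \<circ> \<pi>) = Ac x"
proof -
  have cf: "cf i (x \<circ> \<pi>) = cf (\<pi> i) x" for i
  proof -
    have inj: "inj_on \<pi> ({..<n} - {i})" using permutes_inj[OF \<pi>] by (rule inj_on_subset) simp
    have "\<pi> ` ({..<n} - {i}) = {..<n} - {\<pi> i}"
      using permutes_image[OF \<pi>] permutes_inj[OF \<pi>] by (simp add: image_set_diff)
    then show ?thesis
      unfolding cf_def using prod.reindex[OF inj, of "\<lambda>j. \<phi> (x j)"] by (simp add: o_def)
  qed
  have "(\<Sum>i<n. cf i (x \<circ> \<pi>) * u ((x \<circ> \<pi>) i) l) = (\<Sum>i<n. cf i x * u (x i) l)" for l
    unfolding cf using sum.permute[OF \<pi>, of "\<lambda>i. cf i x * u (x i) l"] by (simp add: o_def)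
  then show ?thesis by (simp add: Ac_def)
qed

lemma Ac_diag: "Ac (\<lambda>_. x) l = \<phi> x ^ (n - 1) * u x l"
proof -
  have "cf i (\<lambda>_. x) = \<phi> x ^ (n - 1)" if "i < n" for i using that by (simp add: cf_def)
  then have "(\<Sum>i<n. cf i (\<lambda>_. x) * u x l) = of_nat n * (\<phi> x ^ (n - 1) * u x l)"
    by simp
  then show ?thesis using n by (simp add: Ac_def)
qed

lemma norm_P: "vnorm (lq_space q) (P x) = norm (\<phi> x) ^ (n - 1) * lq_norm q (u x)"
  using lq_scale(2)[OF q0 u_lq, of "\<phi> x ^ (n - 1)" x]
  by (simp add: P_def A_def Ac_diag[abs_def] norm_power)

lemma \<phi>_minus: "\<phi> (a - b) = \<phi> a - \<phi> b"
  using \<phi>_add[of "a - b" b] by simp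

lemma continuous_on_\<phi>: "continuous_on S \<phi>"
  using \<phi> by (auto simp: dual_ball_def intro: continuous_on_subset)

lemma continuous_on_cf: "continuous_on UNIV (cf i)"
  unfolding cf_def by (intro continuous_on_prod continuous_on_compose2[OF continuous_on_\<phi>[of UNIV]]) auto

text \<open>For fixed \<open>x\<close> the right-hand side is continuous in \<open>y\<close> and
  vanishes at y = x; continuity of \<open>A\<close> follows from this alone.\<close>

lemma Ac_dist_le: "lq_norm q (\<lambda>l. Ac x l - Ac y l) \<le>
   (\<Sum>i<n. norm (cf i y) * norm (x i - y i) + norm (cf i x - cf i y) * norm (x i))"
  (is "_ \<le> (\<Sum>i<n. ?b i)")
proof -
  have eq: "(\<lambda>l. Ac x l - Ac y l) = (\<lambda>l. inverse (of_nat n) *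
      (\<Sum>i<n. cf i y * u (x i - y i) l + (cf i x - cf i y) * u (x i) l))"
  proof
    fix l
    have "u (x i) l = u (x i - y i) l + u (y i) l" for i using u_add[of "x i - y i" "y i"] by simp
    then have "cf i x * u (x i) l - cf i y * u (y i) l
        = cf i y * u (x i - y i) l + (cf i x - cf i y) * u (x i) l" for i
      by (simp add: algebra_simps)
    then show "Ac x l - Ac y l = inverse (of_nat n) *
      (\<Sum>i<n. cf i y * u (x i - y i) l + (cf i x - cf i y) * u (x i) l)"
      by (simp add: Ac_def flip: right_diff_distrib sum_subtractf)
  qed
  let ?g = "\<lambda>i l. cf i y * u (x i - y i) l + (cf i x - cf i y) * u (x i) l"
  have g: "?g i \<in> lq q" "lq_norm q (?g i) \<le> ?b i" for i
  proof -
    note s1 = lq_scale[OF q0 u_lq, of "cf i y" "x i - y i"]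
    note s2 = lq_scale[OF q0 u_lq, of "cf i x - cf i y" "x i"]
    show "?g i \<in> lq q" using lq_add(1)[OF q s1(1) s2(1)] .
    have "lq_norm q (?g i) \<le> norm (cf i y) * lq_norm q (u (x i - y i)) + norm (cf i x - cf i y) * lq_norm q (u (x i))"
      using lq_add(2)[OF q s1(1) s2(1)] s1(2) s2(2) by simp
    also have "\<dots> \<le> ?b i"
      by (intro add_mono mult_left_mono u_norm_le) auto
    finally show "lq_norm q (?g i) \<le> ?b i" .
  qed
  note sm = lq_sum[OF q finite_lessThan[of n] g(1)]
  have "lq_norm q (\<lambda>l. Ac x l - Ac y l) = norm (inverse (of_nat n) :: 'k) * lq_norm q (\<lambda>l. \<Sum>i<n. ?g i l)"
    unfolding eq by (rule lq_scale(2)[OF q0 conjunct1[OF sm]])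
  also have "\<dots> \<le> 1 * lq_norm q (\<lambda>l. \<Sum>i<n. ?g i l)"
    using n by (intro mult_right_mono lq_norm_nonneg) (simp add: norm_inverse inverse_le_1_iff)
  also have "\<dots> \<le> (\<Sum>i<n. lq_norm q (?g i))" using sm by simp
  also have "\<dots> \<le> (\<Sum>i<n. ?b i)"
    by (intro sum_mono g(2))
  finally show ?thesis .
qed

lemma A_continuous: "continuous_map euclidean (vtopology (lq_space q)) A"
proof (subst continuous_map_vtopology_iff[OF normed_space_lq_space[OF q]])
  show "A x \<in> carrier (lq_space q)" for x by (simp add: A_def Ac_lq)
  show "\<forall>x. \<forall>e>0. \<exists>U. open U \<and> x \<in> U \<and> (\<forall>y\<in>U. vdist (lq_space q) (A x) (A y) < e)"
  proof (intro allI impI)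
    fix x :: "nat \<Rightarrow> 'e" and e :: real assume e: "0 < e"
    define G where "G y = (\<Sum>i<n. norm (cf i y) * norm (x i - y i) + norm (cf i x - cf i y) * norm (x i))" for y
    have cx: "continuous_on UNIV (\<lambda>y :: nat \<Rightarrow> 'e. y i)" for i by simp
    have "continuous_on UNIV G"
      unfolding G_def
      by (intro continuous_on_sum continuous_on_add continuous_on_mult continuous_on_norm
          continuous_on_diff continuous_on_const continuous_on_cf cx)
    then have "open {y. G y < e}" by (intro open_Collect_less continuous_on_const)
    moreover have "G x < e" using e by (simp add: G_def)
    moreover have "vdist (lq_space q) (A x) (A y) \<le> G y" for y
      unfolding A_def G_def by (simp add: vdist_lq_space[OF q Ac_lq Ac_lq] Ac_dist_le)
    ultimately show "\<exists>U. open U \<and> x \<in> U \<and> (\<forall>y\<in>U. vdist (lq_space q) (A x) (A y) < e)"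
      by (intro exI[of _ "{y. G y < e}"]) (auto intro: le_less_trans)
  qed
qed

lemma A_multilinear: "multilinear n sE (lq_space q) A"
  unfolding multilinear_def
  by (auto simp: A_def Ac_lq Ac_add Ac_scale fun_eq_iff intro!: Ac_cong fun_cong[OF Ac_cong])

lemma A_mem: "A \<in> continuous_multilinear n sE (lq_space q)"
  by (simp add: continuous_multilinear_def A_multilinear A_continuous)

lemma P_mem: "P \<in> polynomials n sE (lq_space q)"
proof -
  have "continuous_map euclidean euclidean (\<lambda>x :: 'e. (\<lambda>_ :: nat. x))"
    by (simp add: continuous_on_coordinatewise_then_product)
  from continuous_map_compose[OF this A_continuous]
  have "continuous_map euclidean (vtopology (lq_space q)) P"
    by (simp add: P_def[abs_def] o_def)
  then show ?thesis
    unfolding polynomials_def using A_multilinear by (auto simp: P_def)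
qed

lemma associated_map_P: "associated_map n sE (lq_space q) P = A"
  unfolding associated_map_def
proof (rule the_equality)
  show "A \<in> continuous_multilinear n sE (lq_space q) \<and> symmetric_map n A \<and> (\<forall>x. P x = A (\<lambda>_. x))"
    using A_mem Ac_permute by (simp add: symmetric_map_def P_def A_def)
next
  fix A' :: "(nat \<Rightarrow> 'e) \<Rightarrow> ('k, 'u) universe"
  assume A': "A' \<in> continuous_multilinear n sE (lq_space q) \<and> symmetric_map n A' \<and> (\<forall>x. P x = A' (\<lambda>_. x))"
  note D = continuous_multilinearD[OF conjunct1[OF A']]
  have "projr (A' x) l - Ac x l = 0" for x l
  proof (rule symmetric_multilinear_eq_zero[of n "\<lambda>x. projr (A' x) l - Ac x l" sE])
    show "projr (A' x) l - Ac x l = projr (A' y) l - Ac y l" if "\<And>i. i < n \<Longrightarrow> x i = y i" for x y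
      using D(2)[of x y] Ac_cong[of x y] that by simp
    show "projr (A' (x(i := a + b))) l - Ac (x(i := a + b)) l =
        projr (A' (x(i := a))) l - Ac (x(i := a)) l + (projr (A' (x(i := b))) l - Ac (x(i := b)) l)"
      if "i < n" for i x a b using D(3)[OF that] Ac_add[OF that] by simp
    show "projr (A' (x(i := sE c a))) l - Ac (x(i := sE c a)) l = c * (projr (A' (x(i := a))) l - Ac (x(i := a)) l)"
      if "i < n" for i x c a using D(4)[OF that] Ac_scale[OF that] by (simp add: right_diff_distrib)
    show "projr (A' (x \<circ> \<pi>)) l - Ac (x \<circ> \<pi>) l = projr (A' x) l - Ac x l" if "\<pi> permutes {..<n}" for \<pi> x
      using A' Ac_permute[OF that] that by (simp add: symmetric_map_def)
    show "projr (A' (\<lambda>_. x)) l - Ac (\<lambda>_. x) l = 0" for x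
    proof -
      have "A' (\<lambda>_. x) = Inr (Ac (\<lambda>_. x))" using A' by (metis P_def A_def)
      then show ?thesis by simp
    qed
  qed
  then have pr: "projr (A' x) = Ac x" for x by (simp add: fun_eq_iff)
  \<comment> \<open>Equality under \<open>projr\<close> says nothing about the summand in which a
    value lies; membership in the carrier settles it.\<close>
  have "A' x \<in> range Inr" for x using D(1)[of x] by auto
  then have "A' x = Inr (Ac x)" for x using pr[of x] by (metis rangeE sum.sel(2))
  then show "A' = A" by (simp add: A_def fun_eq_iff)
qed

end

text \<open>Comparison with twice the maximum yields one constant for exponents below and above 1
  alike.\<close>

lemma powr_add_le:
  fixes x y r :: real
  assumes "0 \<le> x" "0 \<le> y" "0 < r"
  shows "(x + y) powr r \<le> 2 powr r * (x powr r + y powr r)"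
proof -
  have "(x + y) powr r \<le> (2 * max x y) powr r" using assms by (intro powr_mono2) auto
  also have "\<dots> = 2 powr r * max x y powr r" by (rule powr_mult)
  also have "max x y powr r \<le> x powr r + y powr r" by (simp add: max_def)
  finally show ?thesis by simp
qed

lemma insert_at_upd:
  "insert_at i a (x(j := b)) = (insert_at i a x)((if j < i then j else Suc j) := b)"
  by (auto simp: insert_at_def fun_eq_iff)

lemma insert_at_eq_upd: "insert_at i a x = (insert_at i c x)(i := a)"
  by (auto simp: insert_at_def fun_eq_iff)

lemma insert_at_same: "insert_at i a x i = a"
  by (simp add: insert_at_def)

lemma continuous_map_compose_insert_at:
  assumes "continuous_map euclidean Y B"
  shows "continuous_map euclidean Y (\<lambda>x :: nat \<Rightarrow> 'e::topological_space. B (insert_at i a x))"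
proof -
  have "continuous_on UNIV (\<lambda>x :: nat \<Rightarrow> 'e. insert_at i a x)"
  proof (rule continuous_on_coordinatewise_then_product)
    fix j
    consider "j < i" | "j = i" | "i < j" by linarith
    then show "continuous_on UNIV (\<lambda>x :: nat \<Rightarrow> 'e. insert_at i a x j)"
      by cases (simp_all add: insert_at_def)
  qed
  then have "continuous_map euclidean euclidean (\<lambda>x :: nat \<Rightarrow> 'e. insert_at i a x)" by simp
  from continuous_map_compose[OF this assms] show ?thesis by (simp add: o_def)
qed

lemma insert_at_continuous_multilinear:
  assumes B: "B \<in> continuous_multilinear n sE F" and i: "i < n"
  shows "(\<lambda>x. B (insert_at i a x)) \<in> continuous_multilinear (n - 1) sE F"
proof -
  note D = continuous_multilinearD[OF B]
  have "multilinear (n - 1) sE F (\<lambda>x. B (insert_at i a x))"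
    unfolding multilinear_def
  proof (intro conjI allI impI)
    show "B (insert_at i a x) \<in> carrier F" for x by (rule D(1))
    show "B (insert_at i a x) = B (insert_at i a y)" if "\<forall>j<n - 1. x j = y j" for x y
      using that i by (intro D(2)) (auto simp: insert_at_def)
    show "B (insert_at i a (x(j := b + c))) = B (insert_at i a (x(j := b))) \<oplus>\<^bsub>F\<^esub> B (insert_at i a (x(j := c)))"
      if "j < n - 1" for j x b c
      unfolding insert_at_upd using that by (intro D(3)) auto
    show "B (insert_at i a (x(j := sE c b))) = c \<odot>\<^bsub>F\<^esub> B (insert_at i a (x(j := b)))"
      if "j < n - 1" for j x c b
      unfolding insert_at_upd using that by (intro D(4)) auto
  qed
  then show ?thesis
    using continuous_map_compose_insert_at[OF D(5)] by (simp add: continuous_multilinear_def)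
qed

section \<open>Summability of the test polynomial and recovery of the operator from it\<close>

context test_polynomial
begin

lemma cf_norm_le:
  assumes "\<And>j. j < n \<Longrightarrow> j \<noteq> i \<Longrightarrow> norm (z j) \<le> 1"
  shows "norm (cf i z) \<le> 1"
proof -
  have "norm (\<phi> (z j)) \<le> 1" if "j \<in> {..<n} - {i}" for j
    using that assms[of j] \<phi>_le[of "z j"] by auto
  then show ?thesis
    unfolding cf_def by (auto simp: prod_norm[symmetric] intro!: prod_le_1)
qed

lemma cf_norm_le_other:
  assumes z: "\<And>j. j < n \<Longrightarrow> j \<noteq> i \<Longrightarrow> norm (z j) \<le> 1" and i: "i < n" "k \<noteq> i"
  shows "norm (cf k z) \<le> norm (\<phi> (z i))"
proof -
  have le: "norm (\<phi> (z j)) \<le> 1" if "j \<in> {..<n} - {k} - {i}" for j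
    using that z[of j] \<phi>_le[of "z j"] by auto
  have "cf k z = cf k (z(i := z i))" by simp
  also have "\<dots> = \<phi> (z i) * (\<Prod>j\<in>{..<n} - {k} - {i}. \<phi> (z j))" by (rule cf_upd_other[OF i])
  finally have "norm (cf k z) = norm (\<phi> (z i)) * (\<Prod>j\<in>{..<n} - {k} - {i}. norm (\<phi> (z j)))"
    by (simp add: norm_mult prod_norm)
  also have "\<dots> \<le> norm (\<phi> (z i)) * 1"
    using le by (intro mult_left_mono prod_le_1) auto
  finally show ?thesis by simp
qed

text \<open>The terms in which the i-th argument enters only through \<phi>: the error made when
  \<open>u\<close> is read off \<open>Ac\<close>.\<close>

definition rest :: "nat \<Rightarrow> (nat \<Rightarrow> 'e) \<Rightarrow> nat \<Rightarrow> 'k" where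
  "rest i z = (\<lambda>l. \<Sum>k\<in>{..<n} - {i}. cf k z * u (z k) l)"

lemma rest_bound:
  assumes z: "\<And>j. j < n \<Longrightarrow> j \<noteq> i \<Longrightarrow> norm (z j) \<le> 1" and i: "i < n"
  shows "rest i z \<in> lq q" "lq_norm q (rest i z) \<le> real n * norm (\<phi> (z i))"
proof -
  have sm: "(\<lambda>l. \<Sum>k\<in>{..<n} - {i}. cf k z * u (z k) l) \<in> lq q \<and>
      lq_norm q (\<lambda>l. \<Sum>k\<in>{..<n} - {i}. cf k z * u (z k) l)
        \<le> (\<Sum>k\<in>{..<n} - {i}. lq_norm q (\<lambda>l. cf k z * u (z k) l))"
    by (rule lq_sum[OF q _ lq_scale(1)[OF q0 u_lq]]) simp
  show "rest i z \<in> lq q" using sm by (simp add: rest_def)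
  have "lq_norm q (rest i z) \<le> (\<Sum>k\<in>{..<n} - {i}. lq_norm q (\<lambda>l. cf k z * u (z k) l))"
    using sm by (simp add: rest_def)
  also have "\<dots> \<le> (\<Sum>k\<in>{..<n} - {i}. norm (\<phi> (z i)) * 1)"
  proof (intro sum_mono)
    fix k assume k: "k \<in> {..<n} - {i}"
    have "lq_norm q (\<lambda>l. cf k z * u (z k) l) = norm (cf k z) * lq_norm q (u (z k))"
      by (rule lq_scale(2)[OF q0 u_lq])
    also have "\<dots> \<le> norm (\<phi> (z i)) * 1"
      using k z cf_norm_le_other[OF z i] lq_norm_nonneg
      by (intro mult_mono order_trans[OF u_norm_le]) auto
    finally show "lq_norm q (\<lambda>l. cf k z * u (z k) l) \<le> norm (\<phi> (z i)) * 1" .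
  qed
  also have "\<dots> = real (n - 1) * norm (\<phi> (z i))" using i by simp
  also have "\<dots> \<le> real n * norm (\<phi> (z i))" by (intro mult_right_mono) auto
  finally show "lq_norm q (rest i z) \<le> real n * norm (\<phi> (z i))" .
qed

lemma Ac_split: "i < n \<Longrightarrow> of_nat n * Ac z l = cf i z * u (z i) l + rest i z l"
  using n by (simp add: Ac_def rest_def sum.remove[of "{..<n}" i])

lemma Ac_upper:
  assumes z: "\<And>j. j < n \<Longrightarrow> j \<noteq> i \<Longrightarrow> norm (z j) \<le> 1" and i: "i < n"
  shows "lq_norm q (Ac z) \<le> lq_norm q (u (z i)) + norm (\<phi> (z i))"
proof -
  note s = lq_scale[OF q0 u_lq, of "cf i z" "z i"]
  have n1: "1 \<le> real n" using n by simp
  have "real n * lq_norm q (Ac z) = lq_norm q (\<lambda>l. of_nat n * Ac z l)"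
    using lq_scale(2)[OF q0 Ac_lq, of "of_nat n" z] by simp
  also have "\<dots> \<le> lq_norm q (\<lambda>l. cf i z * u (z i) l) + lq_norm q (rest i z)"
    unfolding Ac_split[OF i] by (rule lq_add(2)[OF q s(1) rest_bound(1)[OF z i]])
  also have "\<dots> \<le> 1 * lq_norm q (u (z i)) + real n * norm (\<phi> (z i))"
    unfolding s(2) using cf_norm_le[OF z] rest_bound(2)[OF z i]
    by (intro add_mono mult_right_mono lq_norm_nonneg) auto
  also have "\<dots> \<le> real n * lq_norm q (u (z i)) + real n * norm (\<phi> (z i))"
    using n1 by (intro add_mono mult_right_mono lq_norm_nonneg) auto
  finally have "real n * lq_norm q (Ac z) \<le> real n * (lq_norm q (u (z i)) + norm (\<phi> (z i)))"
    by (simp add: distrib_left)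
  then show ?thesis using n1 by simp
qed

text \<open>Since \<open>rest\<close> is bounded by a multiple of |\<phi> (z i)|, the mapping
  determines \<open>u (z i)\<close> up to such an error wherever the coefficient
  \<open>cf i z\<close> is bounded away from 0.\<close>

lemma Ac_lower:
  assumes z: "\<And>j. j < n \<Longrightarrow> j \<noteq> i \<Longrightarrow> norm (z j) \<le> 1" and i: "i < n"
  shows "norm (cf i z) * lq_norm q (u (z i)) \<le> real n * (lq_norm q (Ac z) + norm (\<phi> (z i)))"
proof -
  note s1 = lq_scale[OF q0 Ac_lq, of "of_nat n" z]
  have rest: "rest i z \<in> lq q" by (rule rest_bound(1)[OF z i])
  note s2 = lq_scale[OF q0 rest, where c = "-1"]
  have "norm (cf i z) * lq_norm q (u (z i)) = lq_norm q (\<lambda>l. cf i z * u (z i) l)"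
    by (rule lq_scale(2)[OF q0 u_lq, symmetric])
  also have "(\<lambda>l. cf i z * u (z i) l) = (\<lambda>l. of_nat n * Ac z l + (-1) * rest i z l)"
    by (simp add: Ac_split[OF i])
  also have "lq_norm q \<dots> \<le> lq_norm q (\<lambda>l. of_nat n * Ac z l) + lq_norm q (\<lambda>l. (-1) * rest i z l)"
    by (rule lq_add(2)[OF q s1(1) s2(1)])
  also have "\<dots> = real n * lq_norm q (Ac z) + lq_norm q (rest i z)"
    unfolding s1(2) s2(2) by simp
  also have "\<dots> \<le> real n * lq_norm q (Ac z) + real n * norm (\<phi> (z i))"
    using rest_bound(2)[OF z i] by simp
  finally show ?thesis by (simp add: distrib_left)
qed

abbreviation L :: "('k, (nat \<Rightarrow> 'e) \<Rightarrow> ('k, 'u) universe) nspace" where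
  "L \<equiv> multilinear_space (n - 1) sE (lq_space q)"

definition slice :: "nat \<Rightarrow> 'e \<Rightarrow> (nat \<Rightarrow> 'e) \<Rightarrow> ('k, 'u) universe" where
  "slice i a = (\<lambda>x. A (insert_at i a x))"

lemma slice_mem: "i < n \<Longrightarrow> slice i a \<in> continuous_multilinear (n - 1) sE (lq_space q)"
  unfolding slice_def by (rule insert_at_continuous_multilinear[OF A_mem])

lemma slice_norm_le:
  assumes i: "i < n"
  shows "vnorm L (slice i a) \<le> lq_norm q (u a) + norm (\<phi> a)"
proof -
  have "(SUP x\<in>unit_box (n - 1). vnorm (lq_space q) (slice i a x)) \<le> lq_norm q (u a) + norm (\<phi> a)"
  proof (rule cSUP_least)
    show "(unit_box (n - 1) :: (nat \<Rightarrow> 'e) set) \<noteq> {}"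
      by (auto intro!: exI[of _ "\<lambda>_. 0"])
    fix x :: "nat \<Rightarrow> 'e" assume "x \<in> unit_box (n - 1)"
    then have x: "norm (x j) \<le> 1" if "j < n - 1" for j using that by simp
    define z where "z = insert_at i a x"
    have z: "norm (z j) \<le> 1" if "j < n" "j \<noteq> i" for j
      using that i by (auto simp: z_def insert_at_def intro!: x)
    have "lq_norm q (Ac z) \<le> lq_norm q (u (z i)) + norm (\<phi> (z i))"
      by (rule Ac_upper[OF z i])
    then show "vnorm (lq_space q) (slice i a x) \<le> lq_norm q (u a) + norm (\<phi> a)"
      by (simp add: slice_def A_def insert_at_same z_def)
  qed
  then show ?thesis by simp
qed

lemma slice_add:
  assumes i: "i < n"
  shows "slice i (a + b) = slice i a \<oplus>\<^bsub>L\<^esub> slice i b"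
proof
  fix x
  show "slice i (a + b) x = (slice i a \<oplus>\<^bsub>L\<^esub> slice i b) x"
    using continuous_multilinearD(3)[OF A_mem i, of "insert_at i 0 x" a b]
    unfolding multilinear_space_simps slice_def
    by (simp only: insert_at_eq_upd[of i _ x 0, symmetric])
qed

lemma slice_scale:
  assumes i: "i < n"
  shows "slice i (sE c a) = c \<odot>\<^bsub>L\<^esub> slice i a"
proof
  fix x
  show "slice i (sE c a) x = (c \<odot>\<^bsub>L\<^esub> slice i a) x"
    using continuous_multilinearD(4)[OF A_mem i, of "insert_at i 0 x" c a]
    unfolding multilinear_space_simps slice_def
    by (simp only: insert_at_eq_upd[of i _ x 0, symmetric])
qed

lemma normed_space_L: "normed_space L"
  by (rule normed_space_multilinear_space[OF scaling normed_space_lq_space[OF q]])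

lemma slice_continuous:
  assumes i: "i < n"
  shows "continuous_map euclidean (vtopology L) (slice i)"
proof -
  interpret L: Module.module scalars L using normed_space_L unfolding normed_space_def by blast
  have car: "slice i a \<in> carrier L" for a using slice_mem[OF i] by simp
  have dist: "vdist L (slice i x) (slice i y) \<le> 2 * norm (x - y)" for x y
  proof -
    have "slice i x = slice i y \<oplus>\<^bsub>L\<^esub> slice i (x - y)"
      using slice_add[OF i, of y "x - y"] by simp
    then have "slice i x \<ominus>\<^bsub>L\<^esub> slice i y = slice i (x - y)"
      using car[of y] car[of "x - y"] by (metis L.M.a_comm L.M.add.inv_solve_right L.M.add.m_closed L.M.minus_eq)
    then have "vdist L (slice i x) (slice i y) = vnorm L (slice i (x - y))"
      using car[of x] car[of y] by (simp add: vdist_def del: multilinear_space_simps)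
    also have "\<dots> \<le> norm (x - y) + norm (x - y)"
      by (rule order_trans[OF slice_norm_le[OF i] add_mono[OF u_norm_le \<phi>_le]])
    finally show ?thesis by simp
  qed
  show ?thesis
  proof (subst continuous_map_vtopology_iff[OF normed_space_L car], intro allI impI)
    fix x and e :: real assume e: "0 < e"
    have "vdist L (slice i x) (slice i y) < e" if "y \<in> ball x (e / 2)" for y
      using dist[of x y] that by (simp add: dist_norm)
    then show "\<exists>U. open U \<and> x \<in> U \<and> (\<forall>y\<in>U. vdist L (slice i x) (slice i y) < e)"
      using e by (intro exI[of _ "ball x (e / 2)"]) auto
  qed
qed

lemma slice_vnorm_nonneg: "i < n \<Longrightarrow> 0 \<le> vnorm L (slice i a)"
  by (rule vnorm_multilinear_space_nonneg[OF scaling normed_space_lq_space[OF q] slice_mem])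

lemma P_as_polynomial: "P \<in> as_polynomials q n sE (lq_space q)"
proof -
  have "slice i \<in> summing_operators q sE L" if i: "i < n" for i
  proof -
    have dom: "dual_dominated q (\<lambda>a. (h a + norm (\<phi> a) powr q) / 2)"
      by (rule dual_dominated_average[OF h_dominated dual_dominated_functional[OF \<phi>]])
    \<comment> \<open>Of the constant, \<open>2 powr q\<close> comes from \<open>powr_add_le\<close>
      and the other 2 undoes the average.\<close>
    have "vnorm L (slice i a) powr q \<le> (2 * 2 powr q) * ((h a + norm (\<phi> a) powr q) / 2)" for a
    proof -
      have "vnorm L (slice i a) powr q \<le> (lq_norm q (u a) + norm (\<phi> a)) powr q"
        using q0 slice_vnorm_nonneg[OF i] slice_norm_le[OF i] by (intro powr_mono2) auto
      also have "\<dots> \<le> 2 powr q * (lq_norm q (u a) powr q + norm (\<phi> a) powr q)"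
        by (intro powr_add_le lq_norm_nonneg q0) simp
      finally show ?thesis by (simp add: u_norm_powr)
    qed
    from summing_of_dual_dominated[OF q0 _ slice_vnorm_nonneg[OF i] this dom]
    have "\<exists>C\<ge>0. summing_bound q (\<lambda>a. vnorm L (slice i a)) C" by simp
    then show ?thesis
      unfolding summing_operators_def mem_Collect_eq
      using slice_mem[OF i] slice_add[OF i] slice_scale[OF i] slice_continuous[OF i]
      by (intro conjI allI) (auto simp only: multilinear_space_simps)
  qed
  then show ?thesis
    using P_mem by (simp add: as_polynomials_def associated_map_P slice_def[abs_def])
qed

lemma P_dominated: "P \<in> dominated_polynomials q n sE (lq_space q)"
proof -
  have dom: "dual_dominated q (\<lambda>a. (h a + norm (\<phi> a) powr q) / 2)"
    by (rule dual_dominated_average[OF h_dominated dual_dominated_functional[OF \<phi>]])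
  obtain \<mu> where \<mu>: "regular_prob_measure sE \<mu>"
    "\<And>a. (h a + norm (\<phi> a) powr q) / 2 \<le> moment \<mu> q a"
    using dual_dominated_measure[OF dom q0] by blast
  have "vnorm (lq_space q) (P x) \<le> 2 powr (real n / q) * moment \<mu> q x powr (real n / q)" for x
  proof -
    define I where "I = moment \<mu> q x"
    \<comment> \<open>One measure dominates the average of both functions, so \<open>m\<close>
      bounds |\<phi> x| as well as the norm of \<open>u x\<close>, and \<open>m ^ n\<close> bounds
      the polynomial.\<close>
    define m where "m = (2 * I) powr (1 / q)"
    have sumI: "(h x + norm (\<phi> x) powr q) / 2 \<le> I" unfolding I_def by (rule \<mu>(2))
    have aux: "a \<le> 2 * c \<and> b \<le> 2 * c" if "(a + b) / 2 \<le> c" "0 \<le> a" "0 \<le> b" for a b c :: real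
      using that by auto
    note le1 = conjunct1[OF aux[OF sumI h_nonneg powr_ge_zero]]
    note le2 = conjunct2[OF aux[OF sumI h_nonneg powr_ge_zero]]
    have "(lq_norm q (u x) powr q) powr (1 / q) \<le> m"
      unfolding m_def u_norm_powr using le1 h_nonneg q0 by (intro powr_mono2) auto
    then have um: "lq_norm q (u x) \<le> m" using q0 lq_norm_nonneg[of q "u x"] by (simp add: powr_powr)
    have "(norm (\<phi> x) powr q) powr (1 / q) \<le> m"
      unfolding m_def using le2 q0 by (intro powr_mono2) auto
    then have \<phi>m: "norm (\<phi> x) \<le> m" using q0 by (simp add: powr_powr)
    have m0: "0 \<le> m" by (simp add: m_def)
    have "vnorm (lq_space q) (P x) \<le> m ^ (n - 1) * m"
      unfolding norm_P using um \<phi>m m0 by (intro mult_mono power_mono lq_norm_nonneg) auto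
    also have "\<dots> = m ^ n" using n by (cases n) auto
    also have "\<dots> = (2 * I) powr (real n / q)"
      using n powr_power[of "2 * I" "1 / q" n] by (cases "I = 0") (auto simp: m_def power_0_left)
    also have "\<dots> = 2 powr (real n / q) * I powr (real n / q)" by (rule powr_mult)
    finally show ?thesis by (simp add: I_def)
  qed
  then show ?thesis
    unfolding dominated_polynomials_def using P_mem \<mu>(1) by (auto intro!: exI[of _ "2 powr (real n / q)"])
qed

text \<open>All arguments but the first are fixed at a multiple \<open>y\<close> of
  \<open>x0\<close> in the unit ball with \<phi> y = \<delta> > 0. The coefficient of
  \<open>u a\<close> is then \<delta> to the power n - 1, independent of \<open>a\<close>, and
  \<open>Ac_lower\<close> isolates \<open>u a\<close>.\<close>

lemma linear_bound_of_as:
  assumes r: "0 < r" and P: "P \<in> as_polynomials r n sE (lq_space q)"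
  obtains M g where "0 \<le> M" "\<And>a. 0 \<le> g a" "dual_dominated r g"
    "\<And>a. lq_norm q (u a) \<le> M * (g a powr (1 / r) + norm (\<phi> a))"
proof -
  have i: "0 < n" using n by simp
  define N where "N a = vnorm L (slice 0 a)" for a
  have "slice 0 \<in> summing_operators r sE L"
    using P i by (simp add: as_polynomials_def associated_map_P slice_def[abs_def])
  then obtain C where C: "0 \<le> C" and ineq: "summing_bound r N C"
    unfolding summing_operators_def mem_Collect_eq N_def by blast
  have N0: "0 \<le> N a" for a unfolding N_def by (rule slice_vnorm_nonneg[OF i])
  have Nh: "N (sE (of_real t) a) = t * N a" if "0 \<le> t" for t a
    unfolding N_def slice_scale[OF i]
    using vnorm_multilinear_space_smult[OF scaling normed_space_lq_space[OF q] slice_mem[OF i], of "of_real t" a] that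
    by simp
  define g where "g a = (N a / (C + 1)) powr r" for a
  have gD: "dual_dominated r g"
    unfolding g_def by (rule dual_dominated_of_summing[OF r N0 Nh C ineq])
  have g1: "N a = (C + 1) * g a powr (1 / r)" for a
    using N0[of a] C r by (simp add: g_def powr_powr)
  define \<delta> where "\<delta> = 1 / norm x0"
  have "x0 \<noteq> 0" using x0 \<phi>_le[of 0] by auto
  then have \<delta>: "0 < \<delta>" by (simp add: \<delta>_def)
  define y where "y = sE (of_real \<delta>) x0"
  have y: "norm y \<le> 1" "\<phi> y = of_real \<delta>"
    using \<open>x0 \<noteq> 0\<close> by (simp_all add: y_def norm_sE \<phi>_scale x0) (simp add: \<delta>_def)
  have "lq_norm q (u a) \<le> (real n * (C + 1) / \<delta> ^ (n - 1)) * (g a powr (1 / r) + norm (\<phi> a))" for a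
  proof -
    define z where "z = insert_at 0 a (\<lambda>_. y)"
    have z: "norm (z j) \<le> 1" if "j < n" "j \<noteq> 0" for j using that y by (simp add: z_def insert_at_def)
    have z0: "z 0 = a" by (simp add: z_def insert_at_def)
    have "cf 0 z = (\<Prod>j\<in>{..<n} - {0}. of_real \<delta>)"
      unfolding cf_def by (rule prod.cong) (auto simp: z_def insert_at_def y)
    also have "\<dots> = of_real \<delta> ^ (n - 1)" using i by simp
    finally have cf0: "norm (cf 0 z) = \<delta> ^ (n - 1)" using \<delta> by (simp add: norm_power)
    have "lq_norm q (Ac z) = vnorm (lq_space q) (slice 0 a (\<lambda>_. y))"
      by (simp add: slice_def A_def z_def)
    also have "\<dots> \<le> N a"
      unfolding N_def using y
      by (intro vnorm_multilinear_space_ge[OF scaling normed_space_lq_space[OF q] slice_mem[OF i]]) auto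
    finally have AcN: "lq_norm q (Ac z) \<le> N a" .
    have "norm (cf 0 z) * lq_norm q (u (z 0)) \<le> real n * (lq_norm q (Ac z) + norm (\<phi> (z 0)))"
      by (rule Ac_lower[OF z i])
    then have "\<delta> ^ (n - 1) * lq_norm q (u a) \<le> real n * (lq_norm q (Ac z) + norm (\<phi> a))"
      by (simp only: cf0 z0)
    also have "\<dots> \<le> real n * ((C + 1) * g a powr (1 / r) + (C + 1) * norm (\<phi> a))"
      using AcN C g1[of a] mult_right_mono[of 1 "C + 1" "norm (\<phi> a)"] by (intro mult_left_mono add_mono) auto
    finally show ?thesis
      using \<delta> by (simp add: field_simps)
  qed
  moreover have "0 \<le> real n * (C + 1) / \<delta> ^ (n - 1)" using C \<delta> by simp
  ultimately show ?thesis using that[of _ g] gD by (simp add: g_def)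
qed

text \<open>At \<open>a + 2 s x0\<close>, where \<open>\<phi> x0 = 1\<close> and \<open>s\<close> is the size of \<open>a\<close>, the factor \<open>\<phi>\<close> of the
  polynomial has size at least \<open>s\<close>, so that \<open>n - 1\<close> of the \<open>n\<close> powers of \<open>s\<close> cancel.\<close>

lemma linear_bound_of_dominated:
  assumes r: "0 < r" and P: "P \<in> dominated_polynomials r n sE (lq_space q)"
  obtains M g where "0 \<le> M" "\<And>a. 0 \<le> g a" "dual_dominated r g"
    "\<And>a. lq_norm q (u a) \<le> M * (g a powr (1 / r) + norm (\<phi> a))"
proof -
  obtain C \<mu> where C: "0 \<le> C" and \<mu>: "regular_prob_measure sE \<mu>"
    and le: "\<And>x. vnorm (lq_space q) (P x) \<le> C * moment \<mu> r x powr (real n / r)"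
    using P unfolding dominated_polynomials_def by blast
  define b where "b x = moment \<mu> r x" for x
  have b0: "0 \<le> b x" for x by (simp add: b_def)
  have bD: "dual_dominated r b" unfolding b_def by (rule dual_dominated_integral[OF \<mu> r])
  note int = integrable_evaluation_powr[OF \<mu> r]
  have b_add: "b (x + y) \<le> 2 powr r * (b x + b y)" for x y
  proof -
    have "b (x + y) \<le> (\<integral>\<phi>. 2 powr r * (norm (\<phi> x) powr r + norm (\<phi> y) powr r) \<partial>\<mu>)"
      unfolding b_def
    proof (rule integral_mono)
      fix \<eta> assume "\<eta> \<in> space \<mu>"
      then have "\<eta> (x + y) = \<eta> x + \<eta> y"
        using regular_prob_measure_space[OF \<mu>] by (simp add: mem_dual_ball_iff)
      then have "norm (\<eta> (x + y)) powr r \<le> (norm (\<eta> x) + norm (\<eta> y)) powr r"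
        using r by (intro powr_mono2) (auto intro: norm_triangle_ineq)
      also have "\<dots> \<le> 2 powr r * (norm (\<eta> x) powr r + norm (\<eta> y) powr r)"
        by (intro powr_add_le r) auto
      finally show "norm (\<eta> (x + y)) powr r \<le> 2 powr r * (norm (\<eta> x) powr r + norm (\<eta> y) powr r)" .
    qed (use int in auto)
    also have "\<dots> = 2 powr r * (b x + b y)" using int by (simp add: b_def)
    finally show ?thesis .
  qed
  \<comment> \<open>The constant in \<open>b (a + y) \<le> s powr r * K\<close>, from
    \<open>b_add\<close> with \<open>b a \<le> s powr r\<close> and norm y = 2 * s * norm x0. The
    second summand of \<open>M\<close> pays for passing back from a + y to a.\<close>
  define K where "K = 2 powr r * (1 + (2 * norm x0) powr r)"
  have K0: "0 \<le> K" by (simp add: K_def)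
  define M where "M = C * K powr (real n / r) + 2 * norm x0"
  have M0: "0 \<le> M" using C by (simp add: M_def)
  \<comment> \<open>Taking \<open>s\<close> strictly above the size of \<open>a\<close> makes it
    positive, so its powers can be cancelled; the bound at the size itself follows by a
    limit.\<close>
  have main: "lq_norm q (u a) \<le> M * s" if s: "b a powr (1 / r) + norm (\<phi> a) < s" for a s
  proof -
    have s0: "0 < s" using s by (smt (verit) norm_ge_zero powr_ge_zero)
    define y where "y = sE (of_real (2 * s)) x0"
    have ny: "norm y = 2 * s * norm x0" using s0 by (simp add: y_def norm_sE norm_mult)
    have "b a powr (1 / r) \<le> s" using s by (smt (verit) norm_ge_zero)
    then have "(b a powr (1 / r)) powr r \<le> s powr r" using r by (intro powr_mono2) auto
    then have ba: "b a \<le> s powr r" using r b0[of a] by (simp add: powr_powr)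
    have "b y \<le> norm y powr r" using dual_dominated_le[OF bD r] .
    then have by_le: "b y \<le> s powr r * (2 * norm x0) powr r"
      by (simp add: ny powr_mult ac_simps)
    have bay: "b (a + y) \<le> s powr r * K"
    proof -
      have "b (a + y) \<le> 2 powr r * (s powr r + s powr r * (2 * norm x0) powr r)"
        by (rule order_trans[OF b_add mult_left_mono[OF add_mono[OF ba by_le]]]) simp
      then show ?thesis by (simp add: K_def algebra_simps)
    qed
    have \<phi>ay: "s \<le> norm (\<phi> (a + y))"
    proof -
      have "\<phi> (a + y) = \<phi> a + of_real (2 * s)" by (simp add: \<phi>_add y_def \<phi>_scale x0)
      moreover have "norm (of_real (2 * s) :: 'k) \<le> norm (\<phi> a + of_real (2 * s)) + norm (\<phi> a)"
        by (metis add_diff_cancel_left' norm_triangle_ineq4)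
      moreover have "norm (\<phi> a) \<le> s" using s by (smt (verit) powr_ge_zero)
      moreover have "norm (of_real (2 * s) :: 'k) = 2 * s" using s0 unfolding norm_of_real by simp
      ultimately have "2 * s \<le> norm (\<phi> (a + y)) + norm (\<phi> a)" "norm (\<phi> a) \<le> s" by simp_all
      moreover have "t \<le> c" if "2 * t \<le> c + d" "d \<le> t" for t c d :: real using that by simp
      ultimately show ?thesis by blast
    qed
    have "s ^ (n - 1) * lq_norm q (u (a + y)) \<le> norm (\<phi> (a + y)) ^ (n - 1) * lq_norm q (u (a + y))"
      using \<phi>ay s0 by (intro mult_right_mono power_mono lq_norm_nonneg) auto
    also have "\<dots> \<le> C * b (a + y) powr (real n / r)" using le[of "a + y"] unfolding norm_P b_def .
    also have "\<dots> \<le> C * (s powr r * K) powr (real n / r)"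
      using C r b0 bay by (intro mult_left_mono powr_mono2) auto
    also have "\<dots> = C * K powr (real n / r) * s ^ n"
      using r s0 by (simp add: powr_mult powr_powr powr_realpow)
    also have "\<dots> = s ^ (n - 1) * (C * K powr (real n / r) * s)"
      using n by (cases n) (auto simp: ac_simps)
    finally have "lq_norm q (u (a + y)) \<le> C * K powr (real n / r) * s" using s0 by simp
    moreover have "lq_norm q (u y) \<le> 2 * norm x0 * s" using u_norm_le[of y] ny by (simp add: ac_simps)
    ultimately show ?thesis using u_triangle[of a y] by (simp add: M_def algebra_simps)
  qed
  show ?thesis
  proof (rule that[OF M0 b0 bD])
    fix a
    show "lq_norm q (u a) \<le> M * (b a powr (1 / r) + norm (\<phi> a))"
    proof (rule field_le_epsilon)
      fix e :: real assume e: "0 < e"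
      have M1: "0 < M + 1" using M0 by simp
      have "lq_norm q (u a) \<le> M * (b a powr (1 / r) + norm (\<phi> a) + e / (M + 1))"
        using e M1 by (intro main) simp
      also have "\<dots> = M * (b a powr (1 / r) + norm (\<phi> a)) + M * (e / (M + 1))" by (simp add: distrib_left)
      also have "M * (e / (M + 1)) \<le> e" using e M0 M1 by (simp add: pos_divide_le_eq algebra_simps)
      finally show "lq_norm q (u a) \<le> M * (b a powr (1 / r) + norm (\<phi> a)) + e" by simp
    qed
  qed
qed

text \<open>The error term costs only a constant: |\<phi>|^r is r-dominated, and so is its average
  with \<open>g\<close>.\<close>

lemma dual_dominated_of_linear_bound:
  assumes r: "0 < r" and M: "0 \<le> M" and g: "\<And>a. 0 \<le> g a" "dual_dominated r g"
    and le: "\<And>a. lq_norm q (u a) \<le> M * (g a powr (1 / r) + norm (\<phi> a))"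
  shows "\<exists>c>0. dual_dominated r (\<lambda>a. h a powr (r / q) / c)"
proof (intro exI[of _ "2 * 2 powr r * (M + 1) powr r"] conjI)
  show "0 < 2 * 2 powr r * (M + 1) powr r" using M by simp
  show "dual_dominated r (\<lambda>a. h a powr (r / q) / (2 * 2 powr r * (M + 1) powr r))"
  proof (rule dual_dominated_mono[OF dual_dominated_average[OF g(2) dual_dominated_functional[OF \<phi>]]])
    fix a
    have "h a powr (r / q) = lq_norm q (u a) powr r" by (rule h_powr)
    also have "\<dots> \<le> ((M + 1) * (g a powr (1 / r) + norm (\<phi> a))) powr r"
    proof (intro powr_mono2 lq_norm_nonneg order_trans[OF le])
      show "M * (g a powr (1 / r) + norm (\<phi> a)) \<le> (M + 1) * (g a powr (1 / r) + norm (\<phi> a))"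
        by (intro mult_right_mono add_nonneg_nonneg) auto
    qed (use r in auto)
    also have "\<dots> = (M + 1) powr r * (g a powr (1 / r) + norm (\<phi> a)) powr r" by (rule powr_mult)
    also have "\<dots> \<le> (M + 1) powr r * (2 powr r * ((g a powr (1 / r)) powr r + norm (\<phi> a) powr r))"
      using r by (intro mult_left_mono powr_add_le) auto
    also have "(g a powr (1 / r)) powr r = g a" using r g(1)[of a] by (simp add: powr_powr)
    finally have "h a powr (r / q) \<le> (2 * 2 powr r * (M + 1) powr r) * ((g a + norm (\<phi> a) powr r) / 2)"
      by (simp add: mult_ac)
    moreover have "0 < 2 * 2 powr r * (M + 1) powr r" using M by simp
    ultimately show "h a powr (r / q) / (2 * 2 powr r * (M + 1) powr r) \<le> (g a + norm (\<phi> a) powr r) / 2"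
      by (subst pos_divide_le_eq) (simp_all add: mult.commute)
  qed
qed

end

section \<open>From coincidence of polynomials to linear extrapolation\<close>

text \<open>Block k consists of \<open>T k\<close> equal weights with total (1/2) ^ (k + 1). A
  finite set of pairs is enlarged to a rectangle, which is summed block by block.\<close>

lemma tail_sum_le:
  fixes T :: "nat \<Rightarrow> nat"
  assumes D: "finite D" and T: "\<And>k. 0 < T k"
  shows "(\<Sum>(k, i)\<in>D. if i < T k then (1/2) ^ Suc k / real (T k) else 0) \<le> 1"
proof -
  let ?w = "\<lambda>k i. if i < T k then (1/2) ^ Suc k / real (T k) else (0::real)"
  have "(\<Sum>(k, i)\<in>D. ?w k i) \<le> (\<Sum>(k, i)\<in>fst ` D \<times> snd ` D. ?w k i)"
    using D by (intro sum_mono2) (force simp: image_iff)+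
  also have "\<dots> = (\<Sum>k\<in>fst ` D. \<Sum>i\<in>snd ` D. ?w k i)"
    by (simp add: sum.cartesian_product)
  also have "\<dots> \<le> (\<Sum>k\<in>fst ` D. (1/2) ^ Suc k)"
  proof (rule sum_mono)
    fix k
    have "(\<Sum>i\<in>snd ` D. ?w k i) = (\<Sum>i\<in>snd ` D \<inter> {..<T k}. (1/2) ^ Suc k / real (T k))"
      using D by (subst sum.inter_restrict) auto
    also have "\<dots> \<le> (\<Sum>i<T k. (1/2) ^ Suc k / real (T k))"
      by (intro sum_mono2) auto
    finally show "(\<Sum>i\<in>snd ` D. ?w k i) \<le> (1/2) ^ Suc k" using T[of k] by simp
  qed
  also have "\<dots> \<le> 1" using D by (intro half_powers_sum_le) auto
  finally show ?thesis .
qed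

context scaled_banach
begin

definition coincidence :: "real \<Rightarrow> real \<Rightarrow> nat \<Rightarrow> 'u itself \<Rightarrow> bool" where
  "coincidence r q n U \<longleftrightarrow>
     (\<forall>F :: ('k, ('k, 'u) universe) nspace. banach_space F \<longrightarrow>
        dominated_polynomials r n sE F = dominated_polynomials q n sE F) \<or>
     (\<forall>F :: ('k, ('k, 'u) universe) nspace. banach_space F \<longrightarrow>
        as_polynomials r n sE F = as_polynomials q n sE F)"

lemma coincidence_series:
  assumes co: "coincidence r q n (U :: 'u itself)" and q: "1 \<le> q" and n: "1 \<le> n" and r: "0 < r"
    and w: "\<And>i. 0 \<le> w i" "\<And>I. finite I \<Longrightarrow> sum w I \<le> 1" and \<psi>: "\<And>i :: nat. \<psi> i \<in> dual_ball sE"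
  shows "\<exists>c>0. dual_dominated r (\<lambda>a. (\<Sum>l. w l * norm (\<psi> l a) powr q) powr (r / q) / c)"
proof (cases "\<forall>\<phi>\<in>dual_ball sE. \<forall>x. \<phi> x = 0")
  \<comment> \<open>Without a nonzero functional there is no \<open>x0\<close> to build the test
    polynomial from, but then the series vanishes.\<close>
  case True
  then have "\<psi> l a = 0" for l a using \<psi> by blast
  then show ?thesis using dual_dominated_zero by (intro exI[of _ 1]) simp
next
  case False
  then obtain \<phi> x where \<phi>: "\<phi> \<in> dual_ball sE" "\<phi> x \<noteq> 0" by blast
  define x0 where "x0 = sE (inverse (\<phi> x)) x"
  have x0: "\<phi> x0 = 1" using \<phi> by (simp add: x0_def mem_dual_ball_iff)
  interpret test_polynomial sE q n w \<psi> \<phi> x0 U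
    by unfold_locales (use q n w \<psi> \<phi> x0 in auto)
  have banach: "banach_space (lq_space q :: ('k, ('k, 'u) universe) nspace)"
    by (rule banach_space_lq_space[OF q Cauchy_convergent_scalars])
  obtain M g where "0 \<le> M" "\<And>a. 0 \<le> g a" "dual_dominated r g"
    "\<And>a. lq_norm q (u a) \<le> M * (g a powr (1 / r) + norm (\<phi> a))"
    using co[unfolded coincidence_def]
  proof
    assume "\<forall>F :: ('k, ('k, 'u) universe) nspace. banach_space F \<longrightarrow>
        dominated_polynomials r n sE F = dominated_polynomials q n sE F"
    then have "P \<in> dominated_polynomials r n sE (lq_space q)" using banach P_dominated by blast
    from linear_bound_of_dominated[OF r this] that show ?thesis by blast
  next
    assume "\<forall>F :: ('k, ('k, 'u) universe) nspace. banach_space F \<longrightarrow>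
        as_polynomials r n sE F = as_polynomials q n sE F"
    then have "P \<in> as_polynomials r n sE (lq_space q)" using banach P_as_polynomial by blast
    from linear_bound_of_as[OF r this] that show ?thesis by blast
  qed
  from dual_dominated_of_linear_bound[OF r this] show ?thesis by (simp add: h_def)
qed

abbreviation empirical :: "nat \<Rightarrow> (nat \<Rightarrow> 'e \<Rightarrow> 'k) \<Rightarrow> real \<Rightarrow> 'e \<Rightarrow> real" where
  "empirical T t p a \<equiv> (\<Sum>i<T. norm (t i a) powr p) / real T"

text \<open>A uniform boundedness argument: \<open>coincidence_series\<close> gives a constant for
  each discrete measure. If the constants for averages of point masses were unbounded, worse and
  worse averages could be scaled and added up to one discrete measure whose constant would then
  serve for one of them too well.\<close>

lemma coincidence_empirical:
  assumes co: "coincidence r q n (U :: 'u itself)" and q: "1 \<le> q" and n: "1 \<le> n" and r: "0 < r"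
  shows "\<exists>c>0. \<forall>T>0. \<forall>t. (\<forall>i<T. t i \<in> dual_ball sE) \<longrightarrow>
    dual_dominated r (\<lambda>a. empirical T t q a powr (r / q) / c)"
proof (rule ccontr)
  assume neg: "\<not> ?thesis"
  \<comment> \<open>The power of \<open>2 ^ Suc k\<close> undoes the weight of block k inside the
    exponent r / q, and k + 1 outgrows every constant.\<close>
  define c where "c k = (real k + 1) * (2 ^ Suc k) powr (r / q)" for k
  define bad where "bad k Z \<longleftrightarrow> 0 < fst Z \<and> (\<forall>i<fst Z. snd Z i \<in> dual_ball sE) \<and>
      \<not> dual_dominated r (\<lambda>a. empirical (fst Z) (snd Z) q a powr (r / q) / c k)"
    for k and Z :: "nat \<times> (nat \<Rightarrow> 'e \<Rightarrow> 'k)"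
  have ex: "\<exists>Z. bad k Z" for k
  proof -
    have "\<forall>c>0. \<exists>T>0. \<exists>t. (\<forall>i<T. t i \<in> dual_ball sE) \<and>
      \<not> dual_dominated r (\<lambda>a. empirical T t q a powr (r / q) / c)"
      using neg by simp
    moreover have "0 < c k" by (simp add: c_def)
    ultimately obtain T t where "0 < T" "\<forall>i<T. t i \<in> dual_ball sE"
      "\<not> dual_dominated r (\<lambda>a. empirical T t q a powr (r / q) / c k)"
      by (auto dest!: spec[of _ "c k"])
    then show ?thesis by (intro exI[of _ "(T, t)"]) (simp add: bad_def)
  qed
  define Z where "Z k = (SOME Z. bad k Z)" for k
  have Z: "bad k (Z k)" for k unfolding Z_def by (rule someI_ex[OF ex])
  define T where "T k = fst (Z k)" for k
  define t where "t k = snd (Z k)" for k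
  have T: "0 < T k" and t: "i < T k \<Longrightarrow> t k i \<in> dual_ball sE"
    and nd: "\<not> dual_dominated r (\<lambda>a. empirical (T k) (t k) q a powr (r / q) / c k)" for k i
    using Z[of k] by (simp_all add: bad_def T_def t_def)
  define w' where "w' = (\<lambda>(k, i). if i < T k then (1/2) ^ Suc k / real (T k) else (0::real))"
  \<comment> \<open>Pairing enumerates all blocks by one index. Beyond the \<open>T k\<close>
    entries of block k the weight is 0 and the functional is zero, which keeps every
    \<open>\<psi> l\<close> in the dual ball.\<close>
  define w where "w = w' \<circ> prod_decode"
  define \<psi>' where "\<psi>' = (\<lambda>(k, i). if i < T k then t k i else (\<lambda>_. 0))"
  define \<psi> where "\<psi> = \<psi>' \<circ> prod_decode"
  have w0: "0 \<le> w l" for l by (simp add: w_def w'_def split: prod.split)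
  have w1: "sum w I \<le> 1" if "finite I" for I
  proof -
    have "sum w I = sum w' (prod_decode ` I)"
      unfolding w_def by (rule sum.reindex[symmetric]) (rule inj_prod_decode)
    also have "\<dots> \<le> 1" using tail_sum_le[of "prod_decode ` I" T] that T by (simp add: w'_def)
    finally show ?thesis .
  qed
  have \<psi>: "\<psi> l \<in> dual_ball sE" for l
    using t zero_in_dual_ball by (simp add: \<psi>_def \<psi>'_def split: prod.split)
  define H where "H a = (\<Sum>l. w l * norm (\<psi> l a) powr q)" for a
  have "\<exists>d>0. dual_dominated r (\<lambda>a. H a powr (r / q) / d)"
    unfolding H_def by (rule coincidence_series[OF co q n r w0 w1 \<psi>])
  then obtain d where d: "0 < d" and HD: "dual_dominated r (\<lambda>a. H a powr (r / q) / d)" by blast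
  have sm: "summable (\<lambda>l. w l * norm (\<psi> l a) powr q)" for a
    by (rule summableI_nonneg_bounded[OF _ weighted_functionals_le[OF _ w0 w1 \<psi>]]) (use q w0 in auto)
  obtain k :: nat where k: "d < real k" using reals_Archimedean2 by blast
  have "dual_dominated r (\<lambda>a. empirical (T k) (t k) q a powr (r / q) / c k)"
  proof (rule dual_dominated_mono[OF HD])
    fix a
    define E where "E = empirical (T k) (t k) q a"
    have E0: "0 \<le> E" by (simp add: E_def sum_nonneg)
    have inj: "inj_on (\<lambda>i. prod_encode (k, i)) {..<T k}" by (simp add: inj_on_def)
    have "(1/2) ^ Suc k * E = (\<Sum>i<T k. w (prod_encode (k, i)) * norm (\<psi> (prod_encode (k, i)) a) powr q)"
      by (simp add: E_def w_def w'_def \<psi>_def \<psi>'_def sum_divide_distrib sum_distrib_left)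
    also have "\<dots> = (\<Sum>l\<in>(\<lambda>i. prod_encode (k, i)) ` {..<T k}. w l * norm (\<psi> l a) powr q)"
      by (simp add: sum.reindex[OF inj])
    also have "\<dots> \<le> H a"
      unfolding H_def using w0 by (intro sum_le_suminf sm) auto
    finally have "E \<le> 2 ^ Suc k * H a" by (simp add: field_simps)
    then have "E powr (r / q) \<le> (2 ^ Suc k * H a) powr (r / q)"
      using E0 r q by (intro powr_mono2) auto
    also have "\<dots> = (2 ^ Suc k) powr (r / q) * H a powr (r / q)" by (rule powr_mult)
    finally have "E powr (r / q) / c k \<le> (2 ^ Suc k) powr (r / q) * H a powr (r / q) / c k"
      by (rule divide_right_mono) (simp add: c_def)
    also have "\<dots> = H a powr (r / q) / (real k + 1)" by (simp add: c_def)
    also have "\<dots> \<le> H a powr (r / q) / d" using d k by (intro divide_left_mono) auto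
    finally show "empirical (T k) (t k) q a powr (r / q) / c k \<le> H a powr (r / q) / d"
      by (simp add: E_def)
  qed
  then show False using nd by blast
qed

text \<open>Domination tests finitely many vectors, and on these \<open>h\<close> is bounded up to
  \<open>e\<close> by the q-moment of an average of point masses. The average changes with
  \<open>e\<close>, but the constant does not, so \<open>e\<close> can tend to 0.\<close>

lemma coincidence_dual_dominated:
  assumes co: "coincidence r q n (U :: 'u itself)" and q: "1 \<le> q" and n: "1 \<le> n" and r: "0 < r"
  shows "\<exists>c>0. transfers q r c"
proof -
  obtain c where c: "0 < c" and emp: "\<And>T t. 0 < T \<Longrightarrow> (\<And>i. i < T \<Longrightarrow> t i \<in> dual_ball sE) \<Longrightarrow>
    dual_dominated r (\<lambda>a. empirical T t q a powr (r / q) / c)"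
    using coincidence_empirical[OF co q n r] by blast
  have q0: "0 < q" and rq: "0 < r / q" using q r by auto
  have "dual_dominated r (\<lambda>x. h x powr (r / q) / c)"
    if h0: "\<And>x. 0 \<le> h x" and hD: "dual_dominated q h" for h
  proof (rule dual_dominatedI)
    fix k and x :: "nat \<Rightarrow> 'e" and s :: "nat \<Rightarrow> real" and B :: real
    assume s: "\<And>j. j < k \<Longrightarrow> 0 \<le> s j"
      and B: "\<And>\<phi>. \<phi> \<in> dual_ball sE \<Longrightarrow> (\<Sum>j<k. s j * norm (\<phi> (x j)) powr r) \<le> B"
    \<comment> \<open>Truncation at 0 keeps the argument of \<open>powr\<close> nonnegative, as
      monotonicity requires.\<close>
    have le: "(\<Sum>j<k. s j * (max 0 (h (x j) - e) powr (r / q) / c)) \<le> B" if e: "0 < e" for e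
    proof -
      obtain T t where T: "0 < T" "\<And>i. i < T \<Longrightarrow> t i \<in> dual_ball sE"
        and t: "\<And>y. y \<in> x ` {..<k} \<Longrightarrow> h y - e \<le> empirical T t q y"
        using dual_dominated_empirical[OF hD q0 _ e, of "x ` {..<k}"] by auto
      have "(\<Sum>j<k. s j * (max 0 (h (x j) - e) powr (r / q) / c))
          \<le> (\<Sum>j<k. s j * (empirical T t q (x j) powr (r / q) / c))"
        using s t c rq
        by (intro sum_mono mult_left_mono divide_right_mono powr_mono2) (auto simp: sum_nonneg)
      also have "\<dots> \<le> B" by (rule dual_dominatedD[OF emp[OF T] s B])
      finally show ?thesis .
    qed
    have "((\<lambda>e. \<Sum>j<k. s j * (max 0 (h (x j) - e) powr (r / q) / c)) \<longlongrightarrow>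
        (\<Sum>j<k. s j * (max 0 (h (x j) - 0) powr (r / q) / c))) (at_right 0)"
      using c rq by (intro tendsto_intros tendsto_powr') auto
    then have "(\<Sum>j<k. s j * (max 0 (h (x j) - 0) powr (r / q) / c)) \<le> B"
      using le by (intro tendsto_upperbound[where F = "at_right 0"])
        (auto intro!: eventually_mono[OF eventually_at_right_less[of 0]])
    then show "(\<Sum>j<k. s j * (h (x j) powr (r / q) / c)) \<le> B" using h0 by (simp add: max_def)
  qed
  then show ?thesis using c by blast
qed

text \<open>Both inclusions are one argument, \<open>change\<close>: an operator is summing exactly
  if a multiple of a power of its norm is dominated, and domination transfers between the exponents.
  From p to q this is \<open>dual_dominated_powr\<close>, with constant 1.\<close>

lemma summing_operators_eq:
  fixes G :: "('k, 'f) nspace"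
  assumes G: "normed_space G" and p: "0 < p" "p < q" and d: "0 < d"
    and H: "transfers q p d"
  shows "summing_operators p sE G = summing_operators q sE G"
proof -
  have q: "0 < q" using p by simp
  have iff: "(\<exists>C\<ge>0. summing_bound p (\<lambda>x. vnorm G (v x)) C) \<longleftrightarrow>
     (\<exists>C\<ge>0. summing_bound q (\<lambda>x. vnorm G (v x)) C)"
    (is "?sum p \<longleftrightarrow> ?sum q")
    if car: "\<And>x. v x \<in> carrier G" and sc: "\<And>c x. v (sE c x) = c \<odot>\<^bsub>G\<^esub> v x" for v
  proof -
    define N where "N x = vnorm G (v x)" for x
    have N: "0 \<le> N x" "0 \<le> t \<Longrightarrow> N (sE (of_real t) x) = t * N x" for x t
      by (simp_all add: N_def vnorm_nonneg[OF G car] sc vnorm_smult[OF G car])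
    have change: "?sum b"
      if ab: "0 < a" "0 < b" and sum: "?sum a" and e: "0 < e"
        and tr: "transfers a b e"
      for a b e
    proof -
      obtain C where C: "0 \<le> C" and ineq: "summing_bound a N C"
        using sum unfolding N_def by blast
      have "dual_dominated a (\<lambda>x. (N x / (C + 1)) powr a)"
        by (rule dual_dominated_of_summing[OF ab(1) N C ineq])
      then have D: "dual_dominated b (\<lambda>x. ((N x / (C + 1)) powr a) powr (b / a) / e)"
        by (intro tr[rule_format]) auto
      have "N x powr b \<le> ((C + 1) powr b * e) * (((N x / (C + 1)) powr a) powr (b / a) / e)" for x
      proof -
        have "((N x / (C + 1)) powr a) powr (b / a) = N x powr b / (C + 1) powr b"
          using ab C N(1)[of x] by (simp add: powr_powr powr_divide)
        then show ?thesis using e C by simp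
      qed
      from summing_of_dual_dominated[OF ab(2) _ N(1) this D] show ?thesis
        using e by (simp add: N_def)
    qed
    show ?thesis
    proof
      assume S: "?sum p"
      show "?sum q"
        by (rule change[OF p(1) q S zero_less_one]) (use p dual_dominated_powr in auto)
    next
      assume S: "?sum q"
      show "?sum p"
        by (rule change[OF q p(1) S d H])
    qed
  qed
  show ?thesis
    unfolding summing_operators_def by (intro Collect_cong conj_cong refl iff) auto
qed

lemma as_polynomials_eq:
  assumes F: "normed_space F" and p: "0 < p" "p < q" and d: "0 < d"
    and H: "transfers q p d"
  shows "as_polynomials p m sE F = as_polynomials q m sE F"
  unfolding as_polynomials_def
  by (simp only: summing_operators_eq[OF normed_space_multilinear_space[OF scaling F] p d H])

end

theorem theorem3:
  fixes sE :: "'k::real_or_complex \<Rightarrow> 'e::banach \<Rightarrow> 'e"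
    and q p0 :: real and n :: nat
  assumes "banach_scaling sE"
    and "1 \<le> q"
    and "1 \<le> n" and "0 < p0" and "p0 < q"
    and "(\<forall>F :: ('k, ('k, 'u) universe) nspace. banach_space F \<longrightarrow>
            dominated_polynomials p0 n sE F = dominated_polynomials q n sE F) \<or>
         (\<forall>F :: ('k, ('k, 'u) universe) nspace. banach_space F \<longrightarrow>
            as_polynomials p0 n sE F = as_polynomials q n sE F)"
  shows "\<forall>F :: ('k, ('k, 'u) universe) nspace. banach_space F \<longrightarrow>
           (\<forall>p m. 0 < p \<and> p < q \<and> 1 \<le> m \<longrightarrow>
              dominated_polynomials p m sE F = dominated_polynomials q m sE F \<and>
              as_polynomials p m sE F = as_polynomials q m sE F)"
proof (intro allI impI)
  fix F :: "('k, ('k, 'u) universe) nspace" and p :: real and m :: nat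
  assume F: "banach_space F" and pm: "0 < p \<and> p < q \<and> 1 \<le> m"
  interpret scaled_banach sE by unfold_locales fact
  have "coincidence p0 q n (TYPE('u))"
    using assms(6) unfolding coincidence_def by blast
  from coincidence_dual_dominated[OF this assms(2,3,4)]
  obtain c where c: "0 < c" and Hc: "transfers q p0 c" by (elim exE conjE)
  have p: "0 < p" "p < q" "1 \<le> m" using pm by auto
  from extrapolation[OF Hc assms(4,5) c p(1,2)]
  obtain d where d: "0 < d" and Hd: "transfers q p d" by (elim exE conjE)
  show "dominated_polynomials p m sE F = dominated_polynomials q m sE F \<and>
      as_polynomials p m sE F = as_polynomials q m sE F"
    using dominated_polynomials_eq[OF p d Hd] as_polynomials_eq[OF _ p(1,2) d Hd] F
    unfolding banach_space_def by blast
qed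

end
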